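(* Let $G$ be a $4$-dimensional real connected Lie group whose Lie algebra has a global basis $\{x_1,x_2,x_3,x_4\}$ of left invariant vector fields satisfying, for some $\lambda_1,\lambda_2,\lambda_3,\lambda_4\in\mathbb R$, $$\begin{aligned} [x_1,x_2]&=\lambda_1x_3+\lambda_2x_4, & [x_1,x_3]&=-\lambda_1x_2+\lambda_4x_4,\\ [x_2,x_3]&=\lambda_1x_1+\lambda_3x_4, & [x_1,x_4]&=-\lambda_2x_2-\lambda_4x_3,\\ [x_2,x_4]&=\lambda_2x_1-\lambda_3x_3, & [x_3,x_4]&=\lambda_4x_1+\lambda_3x_2, \end{aligned}$$ equipped with the left invariant metric $g$ for which $\{x_i\}$ is orthonormal (a Killing metric, i.e. $g([x_i,x_j],x_k)+g([x_i,x_k],x_j)=0$) and the circulant structure $q$ given by $qx_1=x_2$, $qx_2=x_3$, $qx_3=x_4$, $qx_4=x_1$. If $(G,g,q)$ satisfies the identity $R(qx,qy,qz,qu)=R(x,y,z,u)$ for all $x,y,z,u$, then, with $\varepsilon=\pm1$ such that $\lambda_1=\varepsilon\lambda_2=\varepsilon\lambda_3=\lambda_4$: (i) The nonzero components of the curvature tensor $R$ (up to the symmetries of $R$) are $$R_{1212}=R_{1414}=R_{2323}=R_{3434}=R_{1313}=R_{2424}=-\tfrac12\lambda_1^2,$$ $$R_{1213}=R_{2434}=R_{2324}=R_{1314}=R_{1424}=R_{3431}=R_{1323}=R_{2124}=-\tfrac14\varepsilon\lambda_1^2,$$ $$R_{1214}=R_{3234}=R_{1434}=R_{2123}=\tfrac14\lambda_1^2,$$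 and the nonzero components of the Ricci tensor $\rho$ (up to symmetry) are $$\rho_{11}=\rho_{22}=\rho_{33}=\rho_{44}=\tfrac32\lambda_1^2,\quad \rho_{12}=\rho_{14}=\rho_{23}=\rho_{34}=\tfrac12\varepsilon\lambda_1^2,\quad \rho_{13}=\rho_{24}=-\tfrac12\lambda_1^2.$$ (ii) The scalar curvature is $\tau=6\lambda_1^2$. (iii) $(G,g,q)$ is of constant sectional curvatures $$\mu(x_1,x_2)=\mu(x_1,x_4)=\mu(x_2,x_3)=\mu(x_2,x_4)=\mu(x_1,x_3)=-\tfrac12\lambda_1^2,$$ i.e. $(G,g,q)$ is a conformally flat manifold.
   Context: Curvature conventions: $\nabla$ is the Riemannian (Levi-Civita) connection of $g$, $R(x,y)z=\nabla_x\nabla_yz-\nabla_y\nabla_xz-\nabla_{[x,y]}z$, $R(x,y,z,u)=g(R(x,y)z,u)$, and $R_{ijkh}=R(x_i,x_j,x_k,x_h)$. The Ricci tensor is $\rho(y,z)=g^{ij}R(e_i,y,z,e_j)$ with $\rho_{ij}=\rho(x_i,x_j)$, and the scalar curvature is $\tau=g^{ij}\rho(e_i,e_j)$, where $\{e_i\}$ is a basis of the tangent space, $(g^{ij})$ is the inverse of the matrix $(g(e_i,e_j))$ and repeated indices are summed over $1,\dots,4$. The sectional curvature of the $2$-plane spanned by $x,y$ is $\mu(x,y)=\dfrac{R(x,y,x,y)}{g(x,x)g(y,y)-g(x,y)^2}$. *)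

theory Defs
  imports "HOL-Analysis.Analysis" "HOL-Algebra.Group"
begin

section \<open>Smooth manifolds\<close>

text \<open>\<open>C_k_on k S f\<close> and \<open>smooth_on S f\<close> are meant for open \<open>S\<close>.\<close>

primrec C_k_on ::
  "nat \<Rightarrow> 'a::real_normed_vector set \<Rightarrow> ('a \<Rightarrow> 'b::real_normed_vector) \<Rightarrow> bool" where
  "C_k_on 0 S f \<longleftrightarrow> continuous_on S f"
| "C_k_on (Suc k) S f \<longleftrightarrow>
     (\<forall>x\<in>S. f differentiable (at x)) \<and> (\<forall>v. C_k_on k S (\<lambda>x. frechet_derivative f (at x) v))"

definition smooth_on :: "'a::real_normed_vector set \<Rightarrow> ('a \<Rightarrow> 'b::real_normed_vector) \<Rightarrow> bool" where
  "smooth_on S f \<longleftrightarrow> (\<forall>k. C_k_on k S f)"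

text \<open>A chart is a pair of its domain and the coordinate map (values outside the domain are
  irrelevant). An atlas need not be maximal. The manifold is the whole type \<open>'m\<close>; being Hausdorff
  and second countable is imposed by type classes.\<close>

type_synonym ('m, 'e) atlas = "('m set \<times> ('m \<Rightarrow> 'e)) set"

definition smooth_atlas :: "('m::topological_space, 'e::euclidean_space) atlas \<Rightarrow> bool" where
  "smooth_atlas A \<longleftrightarrow>
     (\<Union>(U, \<phi>)\<in>A. U) = UNIV \<and>
     (\<forall>(U, \<phi>)\<in>A. open U \<and> open (\<phi> ` U) \<and> inj_on \<phi> U \<and>
        homeomorphism U (\<phi> ` U) \<phi> (inv_into U \<phi>)) \<and>
     (\<forall>(U, \<phi>)\<in>A. \<forall>(V, \<psi>)\<in>A. smooth_on (\<phi> ` (U \<inter> V)) (\<psi> \<circ> inv_into U \<phi>))"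

definition smooth_map ::
  "('m::topological_space, 'd::euclidean_space) atlas \<Rightarrow>
   ('n::topological_space, 'e::euclidean_space) atlas \<Rightarrow> ('m \<Rightarrow> 'n) \<Rightarrow> bool" where
  "smooth_map A B F \<longleftrightarrow> continuous_on UNIV F \<and>
     (\<forall>(U, \<phi>)\<in>A. \<forall>(V, \<psi>)\<in>B. smooth_on (\<phi> ` (U \<inter> F -` V)) (\<psi> \<circ> F \<circ> inv_into U \<phi>))"

definition prod_atlas :: "('m, 'd) atlas \<Rightarrow> ('n, 'e) atlas \<Rightarrow> ('m \<times> 'n, 'd \<times> 'e) atlas" where
  "prod_atlas A B = {(U \<times> V, map_prod \<phi> \<psi>) | U \<phi> V \<psi>. (U, \<phi>) \<in> A \<and> (V, \<psi>) \<in> B}"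

definition smooth_fun ::
  "('m::topological_space, 'e::euclidean_space) atlas \<Rightarrow> 'm set \<Rightarrow> ('m \<Rightarrow> real) \<Rightarrow> bool" where
  "smooth_fun A W f \<longleftrightarrow> (\<forall>(U, \<phi>)\<in>A. smooth_on (\<phi> ` (U \<inter> W)) (f \<circ> inv_into U \<phi>))"

definition smooth_at ::
  "('m::topological_space, 'e::euclidean_space) atlas \<Rightarrow> 'm \<Rightarrow> ('m \<Rightarrow> real) \<Rightarrow> bool" where
  "smooth_at A p f \<longleftrightarrow> (\<exists>W. open W \<and> p \<in> W \<and> smooth_fun A W f)"


section \<open>Tangent vectors and vector fields\<close>

text \<open>Tangent vectors at \<open>p\<close> are the derivations of the algebra of germs of smooth functions at \<open>p\<close>.
  A germ is given by any representative \<open>f\<close> on the whole type. As a normalisation, a tangent vector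
  is \<open>0\<close> on functions which are not smooth near \<open>p\<close>, so that equality of tangent vectors is
  equality of functions.\<close>

type_synonym 'm tvec = "('m \<Rightarrow> real) \<Rightarrow> real"
type_synonym 'm vfield = "'m \<Rightarrow> 'm tvec"
type_synonym 'm connection = "'m vfield \<Rightarrow> 'm vfield \<Rightarrow> 'm vfield"
type_synonym 'm metric = "'m \<Rightarrow> 'm tvec \<Rightarrow> 'm tvec \<Rightarrow> real"

definition tangent_space ::
  "('m::topological_space, 'e::euclidean_space) atlas \<Rightarrow> 'm \<Rightarrow> 'm tvec set" where
  "tangent_space A p = {v.
     (\<forall>f h a b. smooth_at A p f \<longrightarrow> smooth_at A p h \<longrightarrow>
        v (\<lambda>q. a * f q + b * h q) = a * v f + b * v h) \<and>
     (\<forall>f h. smooth_at A p f \<longrightarrow> smooth_at A p h \<longrightarrow>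
        v (\<lambda>q. f q * h q) = f p * v h + h p * v f) \<and>
     (\<forall>f h. smooth_at A p f \<longrightarrow> (\<forall>\<^sub>F q in nhds p. f q = h q) \<longrightarrow> v f = v h) \<and>
     (\<forall>f. \<not> smooth_at A p f \<longrightarrow> v f = 0)}"

text \<open>The following notions are relative to an open subset \<open>W\<close> of the manifold. A field on \<open>W\<close> may
  have arbitrary values outside \<open>W\<close>.\<close>

definition vector_field ::
  "('m::topological_space, 'e::euclidean_space) atlas \<Rightarrow> 'm set \<Rightarrow> 'm vfield \<Rightarrow> bool" where
  "vector_field A W X \<longleftrightarrow>
     (\<forall>p\<in>W. X p \<in> tangent_space A p) \<and>
     (\<forall>V f. open V \<longrightarrow> V \<subseteq> W \<longrightarrow> smooth_fun A V f \<longrightarrow> smooth_fun A V (\<lambda>p. X p f))"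

definition global_frame ::
  "('m::topological_space, 'e::euclidean_space) atlas \<Rightarrow> ('i::finite \<Rightarrow> 'm vfield) \<Rightarrow> bool" where
  "global_frame A e \<longleftrightarrow>
     (\<forall>i. vector_field A UNIV (e i)) \<and>
     (\<forall>p. \<forall>v\<in>tangent_space A p. \<exists>!c :: 'i \<Rightarrow> real. v = (\<lambda>f. \<Sum>i\<in>UNIV. c i * e i p f))"

definition vadd :: "'m vfield \<Rightarrow> 'm vfield \<Rightarrow> 'm vfield" where
  "vadd X Y = (\<lambda>p f. X p f + Y p f)"

definition vdiff :: "'m vfield \<Rightarrow> 'm vfield \<Rightarrow> 'm vfield" where
  "vdiff X Y = (\<lambda>p f. X p f - Y p f)"

definition vmult :: "('m \<Rightarrow> real) \<Rightarrow> 'm vfield \<Rightarrow> 'm vfield" where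
  "vmult h X = (\<lambda>p f. h p * X p f)"

definition vscale :: "real \<Rightarrow> 'm vfield \<Rightarrow> 'm vfield" where
  "vscale c X = vmult (\<lambda>_. c) X"

definition lie_bracket ::
  "('m::topological_space, 'e::euclidean_space) atlas \<Rightarrow> 'm vfield \<Rightarrow> 'm vfield \<Rightarrow> 'm vfield" where
  "lie_bracket A X Y =
     (\<lambda>p f. if smooth_at A p f then X p (\<lambda>q. Y q f) - Y p (\<lambda>q. X q f) else 0)"


section \<open>Riemannian metrics, Levi-Civita connection, curvature\<close>

definition riemannian_metric ::
  "('m::topological_space, 'e::euclidean_space) atlas \<Rightarrow> 'm set \<Rightarrow> 'm metric \<Rightarrow> bool" where
  "riemannian_metric A W g \<longleftrightarrow>
     (\<forall>p\<in>W. \<forall>u\<in>tangent_space A p. \<forall>v\<in>tangent_space A p. \<forall>w\<in>tangent_space A p. \<forall>a b.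
        g p (\<lambda>f. a * u f + b * v f) w = a * g p u w + b * g p v w \<and> g p v w = g p w v) \<and>
     (\<forall>p\<in>W. \<forall>v\<in>tangent_space A p. v \<noteq> (\<lambda>_. 0) \<longrightarrow> g p v v > 0) \<and>
     (\<forall>V X Y. open V \<longrightarrow> V \<subseteq> W \<longrightarrow> vector_field A V X \<longrightarrow> vector_field A V Y \<longrightarrow>
        smooth_fun A V (\<lambda>p. g p (X p) (Y p)))"

text \<open>\<open>D X Y\<close> stands for \<open>\<nabla>\<^sub>X Y\<close>: an affine connection on \<open>W\<close> that is torsion free and compatible
  with \<open>g\<close>.\<close>

definition affine_connection ::
  "('m::topological_space, 'e::euclidean_space) atlas \<Rightarrow> 'm set \<Rightarrow> 'm connection \<Rightarrow> bool" where
  "affine_connection A W D \<longleftrightarrow>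
     (\<forall>X Y. vector_field A W X \<longrightarrow> vector_field A W Y \<longrightarrow> vector_field A W (D X Y)) \<and>
     (\<forall>X X' Y. vector_field A W X \<longrightarrow> vector_field A W X' \<longrightarrow> vector_field A W Y \<longrightarrow>
        (\<forall>p\<in>W. D (vadd X X') Y p = vadd (D X Y) (D X' Y) p \<and>
                D Y (vadd X X') p = vadd (D Y X) (D Y X') p)) \<and>
     (\<forall>h X Y. smooth_fun A W h \<longrightarrow> vector_field A W X \<longrightarrow> vector_field A W Y \<longrightarrow>
        (\<forall>p\<in>W. D (vmult h X) Y p = vmult h (D X Y) p \<and>
                D X (vmult h Y) p = vadd (vmult (\<lambda>q. X q h) Y) (vmult h (D X Y)) p))"

definition levi_civita ::
  "('m::topological_space, 'e::euclidean_space) atlas \<Rightarrow> 'm set \<Rightarrow> 'm metric \<Rightarrow> 'm connection \<Rightarrow> bool"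
  where
  "levi_civita A W g D \<longleftrightarrow>
     affine_connection A W D \<and>
     (\<forall>X Y. vector_field A W X \<longrightarrow> vector_field A W Y \<longrightarrow>
        (\<forall>p\<in>W. vdiff (D X Y) (D Y X) p = lie_bracket A X Y p)) \<and>
     (\<forall>X Y Z. vector_field A W X \<longrightarrow> vector_field A W Y \<longrightarrow> vector_field A W Z \<longrightarrow>
        (\<forall>p\<in>W. X p (\<lambda>q. g q (Y q) (Z q)) = g p (D X Y p) (Z p) + g p (Y p) (D X Z p)))"

definition curvature_op ::
  "('m::topological_space, 'e::euclidean_space) atlas \<Rightarrow> 'm connection \<Rightarrow>
   'm vfield \<Rightarrow> 'm vfield \<Rightarrow> 'm vfield \<Rightarrow> 'm vfield" where
  "curvature_op A D X Y Z =
     vdiff (vdiff (D X (D Y Z)) (D Y (D X Z))) (D (lie_bracket A X Y) Z)"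

definition curvature ::
  "('m::topological_space, 'e::euclidean_space) atlas \<Rightarrow> 'm metric \<Rightarrow> 'm connection \<Rightarrow>
   'm vfield \<Rightarrow> 'm vfield \<Rightarrow> 'm vfield \<Rightarrow> 'm vfield \<Rightarrow> 'm \<Rightarrow> real" where
  "curvature A g D X Y Z U p = g p (curvature_op A D X Y Z p) (U p)"

definition inverse_gram :: "'m metric \<Rightarrow> ('i::finite \<Rightarrow> 'm vfield) \<Rightarrow> 'm \<Rightarrow> real^'i^'i" where
  "inverse_gram g e p = matrix_inv (\<chi> i j. g p (e i p) (e j p))"

text \<open>Ricci tensor and scalar curvature are computed in a frame \<open>e\<close>; they do not depend on it.
  In the sum, \<open>i\<close> and \<open>j\<close> sit in the first and last argument of \<open>R\<close>, which with the present
  sign of \<open>R(x,y)z\<close> makes \<open>\<rho>\<close> positive on round spheres, whereas \<open>R(x,y,x,y)\<close>, and hence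
  \<open>sectional_curvature\<close>, is negative there.\<close>

definition ricci ::
  "('m::topological_space, 'e::euclidean_space) atlas \<Rightarrow> 'm metric \<Rightarrow> 'm connection \<Rightarrow>
   ('i::finite \<Rightarrow> 'm vfield) \<Rightarrow> 'm vfield \<Rightarrow> 'm vfield \<Rightarrow> 'm \<Rightarrow> real" where
  "ricci A g D e Y Z p =
     (\<Sum>i\<in>UNIV. \<Sum>j\<in>UNIV. inverse_gram g e p $ i $ j * curvature A g D (e i) Y Z (e j) p)"

definition scalar_curvature ::
  "('m::topological_space, 'e::euclidean_space) atlas \<Rightarrow> 'm metric \<Rightarrow> 'm connection \<Rightarrow>
   ('i::finite \<Rightarrow> 'm vfield) \<Rightarrow> 'm \<Rightarrow> real" where
  "scalar_curvature A g D e p =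
     (\<Sum>i\<in>UNIV. \<Sum>j\<in>UNIV. inverse_gram g e p $ i $ j * ricci A g D e (e i) (e j) p)"

definition sectional_curvature ::
  "('m::topological_space, 'e::euclidean_space) atlas \<Rightarrow> 'm metric \<Rightarrow> 'm connection \<Rightarrow>
   'm vfield \<Rightarrow> 'm vfield \<Rightarrow> 'm \<Rightarrow> real" where
  "sectional_curvature A g D X Y p =
     curvature A g D X Y X Y p /
       (g p (X p) (X p) * g p (Y p) (Y p) - (g p (X p) (Y p))\<^sup>2)"

definition flat_on ::
  "('m::topological_space, 'e::euclidean_space) atlas \<Rightarrow> 'm set \<Rightarrow> 'm metric \<Rightarrow> bool" where
  "flat_on A W g \<longleftrightarrow> (\<exists>D. levi_civita A W g D \<and>
     (\<forall>X Y Z. vector_field A W X \<longrightarrow> vector_field A W Y \<longrightarrow> vector_field A W Z \<longrightarrow>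
        (\<forall>p\<in>W. curvature_op A D X Y Z p = (\<lambda>_. 0))))"

text \<open>Locally, \<open>g\<close> can be rescaled to a flat metric \<open>e\<^sup>2\<^sup>\<sigma> g\<close>.\<close>

definition conformally_flat ::
  "('m::topological_space, 'e::euclidean_space) atlas \<Rightarrow> 'm metric \<Rightarrow> bool" where
  "conformally_flat A g \<longleftrightarrow> (\<forall>p. \<exists>W \<sigma>. open W \<and> p \<in> W \<and> smooth_fun A W \<sigma> \<and>
     flat_on A W (\<lambda>q v w. exp (2 * \<sigma> q) * g q v w))"

text \<open>The index tuples which the symmetries
  \<open>R\<^sub>j\<^sub>i\<^sub>k\<^sub>h = - R\<^sub>i\<^sub>j\<^sub>k\<^sub>h\<close>, \<open>R\<^sub>i\<^sub>j\<^sub>h\<^sub>k = - R\<^sub>i\<^sub>j\<^sub>k\<^sub>h\<close>, \<open>R\<^sub>k\<^sub>h\<^sub>i\<^sub>j = R\<^sub>i\<^sub>j\<^sub>k\<^sub>h\<close> relate to a given one.\<close>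

fun curvature_orbit :: "'i \<times> 'i \<times> 'i \<times> 'i \<Rightarrow> ('i \<times> 'i \<times> 'i \<times> 'i) set" where
  "curvature_orbit (i, j, k, h) =
     {(i, j, k, h), (j, i, k, h), (i, j, h, k), (j, i, h, k),
      (k, h, i, j), (h, k, i, j), (k, h, j, i), (h, k, j, i)}"


section \<open>Lie groups\<close>

definition lie_group ::
  "'g::{t2_space, second_countable_topology} monoid \<Rightarrow> ('g, 'e::euclidean_space) atlas \<Rightarrow> bool"
  where
  "lie_group G A \<longleftrightarrow> Group.group G \<and> carrier G = UNIV \<and> smooth_atlas A \<and>
     smooth_map (prod_atlas A A) A (\<lambda>(a, b). a \<otimes>\<^bsub>G\<^esub> b) \<and>
     smooth_map A A (\<lambda>a. m_inv G a)"

text \<open>The differential of the left translation by \<open>a\<close>.\<close>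

definition left_push :: "'g monoid \<Rightarrow> 'g \<Rightarrow> 'g tvec \<Rightarrow> 'g tvec" where
  "left_push G a v = (\<lambda>f. v (\<lambda>q. f (a \<otimes>\<^bsub>G\<^esub> q)))"

definition left_invariant_field :: "'g monoid \<Rightarrow> 'g vfield \<Rightarrow> bool" where
  "left_invariant_field G X \<longleftrightarrow> (\<forall>a p. X (a \<otimes>\<^bsub>G\<^esub> p) = left_push G a (X p))"

definition left_invariant_metric ::
  "'g::{t2_space, second_countable_topology} monoid \<Rightarrow> ('g, 'e::euclidean_space) atlas \<Rightarrow>
   'g metric \<Rightarrow> bool" where
  "left_invariant_metric G A g \<longleftrightarrow>
     (\<forall>a p. \<forall>v\<in>tangent_space A p. \<forall>w\<in>tangent_space A p.
        g (a \<otimes>\<^bsub>G\<^esub> p) (left_push G a v) (left_push G a w) = g p v w)"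

text \<open>A field of endomorphisms of the tangent spaces, and the circulant one in the frame \<open>x\<close>
  (which is automatically smooth, being constant in a smooth frame).\<close>

definition endomorphism_field ::
  "('m::topological_space, 'e::euclidean_space) atlas \<Rightarrow> ('m \<Rightarrow> 'm tvec \<Rightarrow> 'm tvec) \<Rightarrow> bool" where
  "endomorphism_field A q \<longleftrightarrow>
     (\<forall>p. \<forall>v\<in>tangent_space A p. q p v \<in> tangent_space A p) \<and>
     (\<forall>p. \<forall>v\<in>tangent_space A p. \<forall>w\<in>tangent_space A p. \<forall>a b.
        q p (\<lambda>f. a * v f + b * w f) = (\<lambda>f. a * q p v f + b * q p w f))"

definition apply_endo :: "('m \<Rightarrow> 'm tvec \<Rightarrow> 'm tvec) \<Rightarrow> 'm vfield \<Rightarrow> 'm vfield" where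
  "apply_endo q X = (\<lambda>p. q p (X p))"

definition circulant_structure ::
  "('m::topological_space, 'e::euclidean_space) atlas \<Rightarrow> (4 \<Rightarrow> 'm vfield) \<Rightarrow>
   ('m \<Rightarrow> 'm tvec \<Rightarrow> 'm tvec) \<Rightarrow> bool" where
  "circulant_structure A x q \<longleftrightarrow> endomorphism_field A q \<and>
     apply_endo q (x 1) = x 2 \<and> apply_endo q (x 2) = x 3 \<and>
     apply_endo q (x 3) = x 4 \<and> apply_endo q (x 4) = x 1"

text \<open>For the left invariant metric with orthonormal frame \<open>x\<close>, these brackets express exactly the
  Killing property \<open>g([x\<^sub>i,x\<^sub>j],x\<^sub>k) + g([x\<^sub>i,x\<^sub>k],x\<^sub>j) = 0\<close>, which is therefore not assumed
  separately.\<close>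

definition killing_brackets ::
  "('m::topological_space, 'e::euclidean_space) atlas \<Rightarrow> (4 \<Rightarrow> 'm vfield) \<Rightarrow>
   real \<Rightarrow> real \<Rightarrow> real \<Rightarrow> real \<Rightarrow> bool" where
  "killing_brackets A x l1 l2 l3 l4 \<longleftrightarrow>
     lie_bracket A (x 1) (x 2) = vadd (vscale l1 (x 3)) (vscale l2 (x 4)) \<and>
     lie_bracket A (x 1) (x 3) = vadd (vscale (- l1) (x 2)) (vscale l4 (x 4)) \<and>
     lie_bracket A (x 2) (x 3) = vadd (vscale l1 (x 1)) (vscale l3 (x 4)) \<and>
     lie_bracket A (x 1) (x 4) = vadd (vscale (- l2) (x 2)) (vscale (- l4) (x 3)) \<and>
     lie_bracket A (x 2) (x 4) = vadd (vscale l2 (x 1)) (vscale (- l3) (x 3)) \<and>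
     lie_bracket A (x 3) (x 4) = vadd (vscale l4 (x 1)) (vscale l3 (x 2))"

end

theory Submission
  imports Defs
begin

text \<open>
  Write vectors in the orthonormal frame \<open>x\<close>, so that left invariant fields become elements of
  \<open>real^4\<close> and the Lie bracket becomes a bilinear map \<open>C\<close>. The Killing brackets say that
  \<open>C a b \<bullet> c\<close> is alternating, i.e. that the metric is bi-invariant. The Koszul formula then gives
  \<open>\<nabla>\<^sub>a b = C a b / 2\<close> (\<open>levi_civita_conn\<close>), and the Jacobi identity turns the curvature into
  \<open>R(a,b,c,d) = - (C a b \<bullet> C c d) / 4\<close> (\<open>curvature_comp\<close>). All components, the Ricci tensor, the
  scalar curvature and the sectional curvatures are read off from this formula. So is the relation
  between the \<open>\<lambda>\<^sub>i\<close>: invariance of \<open>R\<close> under \<open>q\<close> equates \<open>R\<^sub>1\<^sub>2\<^sub>1\<^sub>2\<close>, \<open>R\<^sub>2\<^sub>3\<^sub>2\<^sub>3\<close> and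
  \<open>R\<^sub>3\<^sub>4\<^sub>3\<^sub>4\<close>, also \<open>R\<^sub>1\<^sub>3\<^sub>1\<^sub>3\<close> and \<open>R\<^sub>2\<^sub>4\<^sub>2\<^sub>4\<close>, which makes the four squares equal; comparing
  \<open>R\<^sub>1\<^sub>2\<^sub>1\<^sub>3\<close>, \<open>R\<^sub>2\<^sub>3\<^sub>2\<^sub>4\<close> and \<open>R\<^sub>3\<^sub>4\<^sub>3\<^sub>1\<close> settles the signs.

  Conformal flatness rests on quaternions. Put \<open>w = (-\<lambda>\<^sub>3, \<lambda>\<^sub>4, -\<lambda>\<^sub>2, \<lambda>\<^sub>1)\<close>. This vector is
  central, and if it is not \<open>0\<close>, then \<open>C\<close> is a multiple of the vector product on its orthogonal
  complement: the group is locally the product of a line and a \<open>3\<close>-sphere, which is conformal to a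
  punctured flat space by polar coordinates. The conformal factor and the flat connection can be
  described in the frame itself. Identify \<open>real^4\<close> with the quaternions. The product
  \<open>a * b = b w' a / 2\<close>, with \<open>w'\<close> the conjugate of \<open>w\<close>, is associative and satisfies both \<open>a * b - b * a = C a b\<close> and
  \<open>a * b = (C a b + (w \<bullet> a) b + (w \<bullet> b) a - (a \<bullet> b) w) / 2\<close>. By the second formula, the
  connection with \<open>\<nabla>\<^sub>a b = a * b\<close> on left invariant fields is the Levi-Civita connection of
  \<open>e\<^sup>2\<^sup>\<sigma> g\<close> as soon as \<open>d\<sigma> = g(w, \<cdot>) / 2\<close>. By the first formula, its curvature is
  \<open>a * (b * c) - b * (a * c) - (a * b - b * a) * c\<close>, which vanishes by associativity
  (\<open>conformally_flatI\<close>).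

  A local solution \<open>\<sigma>\<close> exists because the form \<open>g(w, \<cdot>)\<close> is closed: it is left invariant and
  \<open>w\<close> is orthogonal to all brackets. Analysis enters here and in the chain rule for \<open>e\<^sup>2\<^sup>\<sigma>\<close>. As
  tangent vectors are derivations of germs, Hadamard's lemma is needed to express them in a chart
  (\<open>tangent_chart\<close>); then the Poincare lemma on a coordinate ball applies
  (\<open>closed_form_has_local_primitive\<close>). Both lemmas are obtained from the operator \<open>radial\<close>, which
  integrates a function along the rays of a ball.
\<close>

section \<open>Calculus of smooth functions\<close>

lemma C_k_on_cong_imp:
  "open S \<Longrightarrow> (\<And>x. x \<in> S \<Longrightarrow> f x = g x) \<Longrightarrow> C_k_on k S f \<Longrightarrow> C_k_on k S g"
proof (induction k arbitrary: f g)
  case 0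
  then show ?case by (simp cong: continuous_on_cong)
next
  case (Suc k)
  have d: "f differentiable (at x)" if "x \<in> S" for x
    using Suc.prems that by simp
  have fd: "frechet_derivative f (at x) = frechet_derivative g (at x)" if "x \<in> S" for x
    using frechet_derivative_transform_within_open[OF d[OF that] Suc.prems(1) that] Suc.prems(2) by blast
  have "g differentiable (at x)" if "x \<in> S" for x
    using d[OF that] has_derivative_transform_within_open[OF _ Suc.prems(1) that] Suc.prems(2)
    unfolding differentiable_def by blast
  moreover have "C_k_on k S (\<lambda>x. frechet_derivative g (at x) v)" for v
    by (rule Suc.IH[of "\<lambda>x. frechet_derivative f (at x) v", OF Suc.prems(1)]) (use Suc.prems(3) fd in auto)
  ultimately show ?case by simp
qed

lemma C_k_on_cong:
  "open S \<Longrightarrow> (\<And>x. x \<in> S \<Longrightarrow> f x = g x) \<Longrightarrow> C_k_on k S f \<longleftrightarrow> C_k_on k S g"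
  using C_k_on_cong_imp[of S f g] C_k_on_cong_imp[of S g f] by metis

lemma C_k_on_subset: "C_k_on k S f \<Longrightarrow> T \<subseteq> S \<Longrightarrow> C_k_on k T f"
  by (induction k arbitrary: f) (auto intro: continuous_on_subset)

lemma C_Suc_imp_C_k: "C_k_on (Suc k) S f \<Longrightarrow> C_k_on k S f"
proof (induction k arbitrary: f)
  case 0
  then show ?case
    by (auto intro!: continuous_at_imp_continuous_on differentiable_imp_continuous_within)
next
  case (Suc k)
  then show ?case by (metis C_k_on.simps(2))
qed

text \<open>Derivatives are unique, so any formula for the derivative will do in place of
  \<open>frechet_derivative\<close>; the closure properties below are inductions with this rule.\<close>

lemma C_k_on_SucI:
  assumes "open S"
    and "\<And>x. x \<in> S \<Longrightarrow> (f has_derivative f' x) (at x)"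
    and "\<And>v. C_k_on k S (\<lambda>x. f' x v)"
  shows "C_k_on (Suc k) S f"
proof -
  have "frechet_derivative f (at x) = f' x" if "x \<in> S" for x
    using frechet_derivative_at[OF assms(2)[OF that]] by simp
  then have "C_k_on k S (\<lambda>x. frechet_derivative f (at x) v)" for v
    by (subst C_k_on_cong[OF assms(1), of _ "\<lambda>x. f' x v"]) (auto simp: assms(3))
  then show ?thesis
    using assms(2) by (auto simp: differentiable_def)
qed

lemma C_k_on_has_derivative:
  "C_k_on (Suc k) S f \<Longrightarrow> x \<in> S \<Longrightarrow> (f has_derivative frechet_derivative f (at x)) (at x)"
  by (simp add: frechet_derivative_works[symmetric])

lemma C_k_on_const: "open S \<Longrightarrow> C_k_on k S (\<lambda>x. c)"
  by (induction k arbitrary: c) auto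

lemma C_k_on_add:
  "open S \<Longrightarrow> C_k_on k S f \<Longrightarrow> C_k_on k S g \<Longrightarrow> C_k_on k S (\<lambda>x. f x + g x)"
proof (induction k arbitrary: f g)
  case 0
  then show ?case by (auto intro: continuous_on_add)
next
  case (Suc k)
  show ?case
  proof (rule C_k_on_SucI[OF Suc.prems(1)])
    show "((\<lambda>x. f x + g x) has_derivative
        (\<lambda>v. frechet_derivative f (at x) v + frechet_derivative g (at x) v)) (at x)" if "x \<in> S" for x
      using C_k_on_has_derivative[OF Suc.prems(2) that] C_k_on_has_derivative[OF Suc.prems(3) that]
      by (rule has_derivative_add)
  qed (use Suc in auto)
qed

lemma C_k_on_sum:
  "open S \<Longrightarrow> (\<And>i. i \<in> I \<Longrightarrow> C_k_on k S (f i)) \<Longrightarrow> C_k_on k S (\<lambda>x. \<Sum>i\<in>I. f i x)"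
  by (induction I rule: infinite_finite_induct) (auto intro: C_k_on_const C_k_on_add)

lemma C_k_on_linear:
  assumes "open S" "bounded_linear L"
  shows "C_k_on k S f \<Longrightarrow> C_k_on k S (\<lambda>x. L (f x))"
proof (induction k arbitrary: f)
  case 0
  then show ?case using bounded_linear.continuous_on[OF assms(2)] by auto
next
  case (Suc k)
  show ?case
  proof (rule C_k_on_SucI[OF assms(1)])
    show "((\<lambda>x. L (f x)) has_derivative (\<lambda>v. L (frechet_derivative f (at x) v))) (at x)" if "x \<in> S" for x
      using bounded_linear.has_derivative[OF assms(2) C_k_on_has_derivative[OF Suc.prems that]] .
  qed (use Suc in auto)
qed

lemma C_k_on_mult:
  fixes f g :: "'a::real_normed_vector \<Rightarrow> real"
  shows "open S \<Longrightarrow> C_k_on k S f \<Longrightarrow> C_k_on k S g \<Longrightarrow> C_k_on k S (\<lambda>x. f x * g x)"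
proof (induction k arbitrary: f g)
  case 0
  then show ?case by (auto intro: continuous_on_mult)
next
  case (Suc k)
  show ?case
  proof (rule C_k_on_SucI[OF Suc.prems(1)])
    show "((\<lambda>x. f x * g x) has_derivative
        (\<lambda>v. f x * frechet_derivative g (at x) v + frechet_derivative f (at x) v * g x)) (at x)" if "x \<in> S" for x
      using C_k_on_has_derivative[OF Suc.prems(2) that] C_k_on_has_derivative[OF Suc.prems(3) that]
      by (rule has_derivative_mult)
    show "C_k_on k S (\<lambda>x. f x * frechet_derivative g (at x) v + frechet_derivative f (at x) v * g x)" for v
      using Suc.prems C_Suc_imp_C_k[OF Suc.prems(2)] C_Suc_imp_C_k[OF Suc.prems(3)]
      by (intro C_k_on_add Suc.IH) auto
  qed
qed

lemma linear_real_coords: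
  fixes f :: "'a::euclidean_space \<Rightarrow> real"
  shows "linear f \<Longrightarrow> f v = (\<Sum>b\<in>Basis. (v \<bullet> b) * f b)"
  using Linear_Algebra.linear_componentwise[of f v 1] by (simp only: inner_real_def mult_1_right)

text \<open>The chain rule in coordinates,
  \<open>D\<^sub>v (h \<circ> \<psi>) = (\<Sum>b. (D\<^sub>v \<psi> \<bullet> b) * ((D\<^sub>b h) \<circ> \<psi>))\<close>, expresses a derivative of the composition by
  products of functions for which the claim is known at the lower order.\<close>

lemma C_k_on_compose:
  fixes h :: "'b::euclidean_space \<Rightarrow> real" and \<psi> :: "'a::real_normed_vector \<Rightarrow> 'b"
  assumes "open S" "open T" "\<psi> ` S \<subseteq> T"
  shows "C_k_on k T h \<Longrightarrow> C_k_on k S \<psi> \<Longrightarrow> C_k_on k S (\<lambda>x. h (\<psi> x))"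
proof (induction k arbitrary: h)
  case 0
  then show ?case using assms(3) by (auto intro: continuous_on_compose2)
next
  case (Suc k)
  show ?case
  proof (rule C_k_on_SucI[OF assms(1)])
    fix x assume x: "x \<in> S"
    then have "\<psi> x \<in> T" using assms(3) by auto
    then have h: "(h has_derivative frechet_derivative h (at (\<psi> x))) (at (\<psi> x))"
      using C_k_on_has_derivative[OF Suc.prems(1)] by simp
    then have lin: "linear (frechet_derivative h (at (\<psi> x)))"
      by (rule has_derivative_linear)
    have "(\<lambda>v. frechet_derivative h (at (\<psi> x)) (frechet_derivative \<psi> (at x) v))
        = (\<lambda>v. \<Sum>b\<in>Basis. (frechet_derivative \<psi> (at x) v \<bullet> b) * frechet_derivative h (at (\<psi> x)) b)"
      by (rule ext) (rule linear_real_coords[OF lin])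
    with has_derivative_compose[OF C_k_on_has_derivative[OF Suc.prems(2) x] h]
    show "((\<lambda>x. h (\<psi> x)) has_derivative
        (\<lambda>v. \<Sum>b\<in>Basis. (frechet_derivative \<psi> (at x) v \<bullet> b) * frechet_derivative h (at (\<psi> x)) b)) (at x)"
      by (rule back_subst[where P="\<lambda>d. (_ has_derivative d) _"])
  next
    show "C_k_on k S (\<lambda>x. \<Sum>b\<in>Basis. (frechet_derivative \<psi> (at x) v \<bullet> b) * frechet_derivative h (at (\<psi> x)) b)" for v
      using Suc.prems C_Suc_imp_C_k[OF Suc.prems(2)]
      by (intro C_k_on_sum C_k_on_mult Suc.IH C_k_on_linear[OF _ bounded_linear_inner_left] assms) auto
  qed
qed

lemma smooth_on_cong:
  "open S \<Longrightarrow> (\<And>x. x \<in> S \<Longrightarrow> f x = g x) \<Longrightarrow> smooth_on S f \<longleftrightarrow> smooth_on S g"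
  unfolding smooth_on_def using C_k_on_cong[of S f g] by metis

lemma smooth_on_subset: "smooth_on S f \<Longrightarrow> T \<subseteq> S \<Longrightarrow> smooth_on T f"
  unfolding smooth_on_def using C_k_on_subset by blast

lemma smooth_on_const: "open S \<Longrightarrow> smooth_on S (\<lambda>x. c)"
  by (simp add: smooth_on_def C_k_on_const)

lemma smooth_on_add:
  "open S \<Longrightarrow> smooth_on S f \<Longrightarrow> smooth_on S g \<Longrightarrow> smooth_on S (\<lambda>x. f x + g x)"
  by (simp add: smooth_on_def C_k_on_add)

lemma smooth_on_sum:
  "open S \<Longrightarrow> (\<And>i. i \<in> I \<Longrightarrow> smooth_on S (f i)) \<Longrightarrow> smooth_on S (\<lambda>x. \<Sum>i\<in>I. f i x)"
  by (simp add: smooth_on_def C_k_on_sum)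

lemma smooth_on_linear:
  "open S \<Longrightarrow> bounded_linear L \<Longrightarrow> smooth_on S f \<Longrightarrow> smooth_on S (\<lambda>x. L (f x))"
  by (simp add: smooth_on_def C_k_on_linear)

lemma smooth_on_mult:
  fixes f g :: "'a::real_normed_vector \<Rightarrow> real"
  shows "open S \<Longrightarrow> smooth_on S f \<Longrightarrow> smooth_on S g \<Longrightarrow> smooth_on S (\<lambda>x. f x * g x)"
  by (simp add: smooth_on_def C_k_on_mult)

lemma smooth_on_compose:
  fixes h :: "'b::euclidean_space \<Rightarrow> real" and \<psi> :: "'a::real_normed_vector \<Rightarrow> 'b"
  shows "open S \<Longrightarrow> open T \<Longrightarrow> \<psi> ` S \<subseteq> T \<Longrightarrow> smooth_on T h \<Longrightarrow> smooth_on S \<psi> \<Longrightarrow>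
    smooth_on S (\<lambda>x. h (\<psi> x))"
  by (simp add: smooth_on_def C_k_on_compose)

lemma smooth_on_derivative:
  "smooth_on S f \<Longrightarrow> smooth_on S (\<lambda>x. frechet_derivative f (at x) v)"
  unfolding smooth_on_def by (metis C_k_on.simps(2))

lemma smooth_on_has_derivative:
  "smooth_on S f \<Longrightarrow> x \<in> S \<Longrightarrow> (f has_derivative frechet_derivative f (at x)) (at x)"
  unfolding smooth_on_def using C_k_on_has_derivative by blast

lemma smooth_on_continuous: "smooth_on S f \<Longrightarrow> continuous_on S f"
  unfolding smooth_on_def by (metis C_k_on.simps(1))

lemma smooth_on_ident: "open S \<Longrightarrow> smooth_on S (\<lambda>x. x)"
proof -
  assume S: "open S"
  have "C_k_on k S (\<lambda>x. x)" for k
  proof (cases k)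
    case (Suc n)
    show ?thesis unfolding Suc
      by (rule C_k_on_SucI[OF S]) (auto intro: has_derivative_ident C_k_on_const S)
  qed auto
  then show ?thesis by (simp add: smooth_on_def)
qed

lemma smooth_on_exp: "smooth_on UNIV (exp :: real \<Rightarrow> real)"
proof -
  have "C_k_on k UNIV (exp :: real \<Rightarrow> real)" for k
  proof (induction k)
    case 0
    then show ?case by (auto intro: continuous_intros)
  next
    case (Suc k)
    show ?case
    proof (rule C_k_on_SucI)
      show "(exp has_derivative (\<lambda>v. exp x * v)) (at x)" for x :: real
        using DERIV_exp[of x] unfolding has_field_derivative_def .
      show "C_k_on k UNIV (\<lambda>x. exp x * v)" for v :: real
        using Suc by (intro C_k_on_mult C_k_on_const) auto
    qed auto
  qed
  then show ?thesis by (simp add: smooth_on_def)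
qed

section \<open>Radial integrals\<close>

text \<open>The weight \<open>t ^ m\<close> is there because differentiation increases the exponent: the derivative of
  \<open>radial m c f\<close> in direction \<open>v\<close> is \<open>radial (Suc m) c\<close> of the derivative of \<open>f\<close>. The family of
  these operators is therefore closed under differentiation.\<close>

definition radial :: "nat \<Rightarrow> 'a::real_normed_vector \<Rightarrow> ('a \<Rightarrow> real) \<Rightarrow> 'a \<Rightarrow> real" where
  "radial m c f x = integral {0..1} (\<lambda>t. t ^ m * f (c + t *\<^sub>R (x - c)))"

lemma radial_point_in_ball:
  "x \<in> ball c r \<Longrightarrow> t \<in> {0..1} \<Longrightarrow> c + t *\<^sub>R (x - c) \<in> ball (c::'a::real_normed_vector) r"
proof -
  assume x: "x \<in> ball c r" and t: "t \<in> {0..1::real}"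
  have "norm (t *\<^sub>R (x - c)) = t * norm (x - c)" using t by simp
  also have "\<dots> \<le> 1 * norm (x - c)" using t by (intro mult_right_mono) auto
  also have "\<dots> < r" using x by (simp add: dist_norm norm_minus_commute)
  finally show ?thesis by (simp add: dist_norm)
qed

lemma continuous_on_radial_integrand:
  fixes f :: "'a::real_normed_vector \<Rightarrow> real"
  assumes "continuous_on (ball c r) f" "x \<in> ball c r"
  shows "continuous_on {0..1} (\<lambda>t. t ^ m * f (c + t *\<^sub>R (x - c)))"
  using radial_point_in_ball[OF assms(2)]
  by (intro continuous_intros continuous_on_compose2[OF assms(1)]) auto

text \<open>Differentiation under the integral sign; the inner derivative of \<open>c + t (x - c)\<close> contributes the
  additional factor \<open>t\<close>.\<close>

lemma radial_has_derivative:
  fixes f :: "'a::euclidean_space \<Rightarrow> real"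
  assumes f: "smooth_on (ball c r) f" and x: "x \<in> ball c r"
  shows "(radial m c f has_derivative
    (\<lambda>v. radial (Suc m) c (\<lambda>y. frechet_derivative f (at y) v) x)) (at x)"
proof -
  let ?B = "ball c r" and ?D = "\<lambda>y v. frechet_derivative f (at y) v"
  let ?p = "\<lambda>x t. c + t *\<^sub>R (x - c)"
  define F where "F x t = Blinfun (\<lambda>v. t ^ Suc m * ?D (?p x t) v)" for x t
  have bl: "bounded_linear (\<lambda>v. t ^ Suc m * ?D (?p x t) v)"
    if "x \<in> ?B" "t \<in> {0..1}" for x t
    using has_derivative_bounded_linear[OF smooth_on_has_derivative[OF f radial_point_in_ball[OF that]]]
    by (rule bounded_linear_const_mult)
  have F: "blinfun_apply (F x t) = (\<lambda>v. t ^ Suc m * ?D (?p x t) v)"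
    if "x \<in> ?B" "t \<in> {0..1}" for x t
    unfolding F_def by (rule bounded_linear_Blinfun_apply[OF bl[OF that]])
  have cD: "continuous_on ?B (\<lambda>y. ?D y v)" for v
    by (rule smooth_on_continuous[OF smooth_on_derivative[OF f]])
  have cont: "continuous_on (?B \<times> cbox 0 1) (\<lambda>(x, t). F x t)"
  proof (rule continuous_on_blinfun_componentwise)
    fix i :: 'a assume "i \<in> Basis"
    have "continuous_on (?B \<times> cbox 0 1) (\<lambda>z. snd z ^ Suc m * ?D (?p (fst z) (snd z)) i)"
      by (intro continuous_intros continuous_on_compose2[OF cD] image_subsetI radial_point_in_ball)
        (auto simp: cbox_interval)
    then show "continuous_on (?B \<times> cbox 0 1) (\<lambda>z. blinfun_apply (case z of (x, t) \<Rightarrow> F x t) i)"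
      by (rule continuous_on_eq) (auto simp: F cbox_interval)
  qed
  have der: "((\<lambda>x. t ^ m * f (?p x t)) has_derivative blinfun_apply (F x t)) (at x within ?B)"
    if "x \<in> ?B" "t \<in> cbox 0 1" for x t
  proof -
    have t: "t \<in> {0..1}" using that by (simp add: cbox_interval)
    note Df = smooth_on_has_derivative[OF f radial_point_in_ball[OF that(1) t]]
    have "((\<lambda>x. ?p x t) has_derivative (\<lambda>v. t *\<^sub>R v)) (at x)"
      by (auto intro!: derivative_eq_intros)
    from has_derivative_mult_right[OF has_derivative_compose[OF this Df], of "t ^ m"]
    show ?thesis
      using linear_cmul[OF has_derivative_linear[OF Df]]
      by (auto simp: F[OF that(1) t] mult.assoc mult.left_commute intro: has_derivative_at_withinI)
  qed
  have int: "(\<lambda>t. t ^ m * f (?p x t)) integrable_on cbox 0 1" if "x \<in> ?B" for x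
    using continuous_on_radial_integrand[OF smooth_on_continuous[OF f] that]
    by (simp add: cbox_interval integrable_continuous_real)
  have "((\<lambda>x. integral (cbox 0 1) (\<lambda>t. t ^ m * f (?p x t))) has_derivative
      blinfun_apply (integral (cbox 0 1) (F x))) (at x within ?B)"
    by (rule leibniz_rule[OF der int cont x]) auto
  then have "(radial m c f has_derivative blinfun_apply (integral (cbox 0 1) (F x))) (at x)"
    using at_within_open[OF x] by (simp add: radial_def[abs_def] cbox_interval)
  moreover have "blinfun_apply (integral (cbox 0 1) (F x)) v
      = radial (Suc m) c (\<lambda>y. ?D y v) x" for v
  proof -
    have "continuous_on (cbox 0 1) (\<lambda>t. case (x, t) of (x, t) \<Rightarrow> F x t)"
      by (rule continuous_on_compose2[OF cont continuous_on_Pair[OF continuous_on_const continuous_on_id]])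
        (use x in auto)
    then have "continuous_on (cbox 0 1) (F x)" by simp
    then have "F x integrable_on cbox 0 1" by (rule integrable_continuous)
    then have "blinfun_apply (integral (cbox 0 1) (F x)) v = integral (cbox 0 1) (\<lambda>t. blinfun_apply (F x t) v)"
      by (rule blinfun_apply_integral)
    also have "\<dots> = integral {0..1} (\<lambda>t. t ^ Suc m * ?D (?p x t) v)"
      unfolding cbox_interval by (rule integral_cong) (simp add: F[OF x])
    finally show ?thesis by (simp add: radial_def)
  qed
  ultimately show ?thesis by (metis (no_types, lifting) has_derivative_eq_rhs ext)
qed

text \<open>Induction on the order, for all weights and all smooth functions at once, since a derivative of
  a radial integral is again a radial integral.\<close>

lemma smooth_on_radial:
  fixes f :: "'a::euclidean_space \<Rightarrow> real"
  assumes "smooth_on (ball c r) f"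
  shows "smooth_on (ball c r) (radial m c f)"
proof -
  have "C_k_on k (ball c r) (radial m c f)" if "smooth_on (ball c r) f" for k m and f :: "'a \<Rightarrow> real"
    using that
  proof (induction k arbitrary: m f)
    case 0
    show ?case
      using radial_has_derivative[OF 0]
      by (auto intro!: continuous_at_imp_continuous_on has_derivative_continuous)
  next
    case (Suc k)
    show ?case
      by (rule C_k_on_SucI[OF open_ball radial_has_derivative[OF Suc.prems]])
        (auto intro: Suc.IH smooth_on_derivative Suc.prems)
  qed
  then show ?thesis using assms by (simp add: smooth_on_def)
qed

lemma has_real_derivative_along_ray:
  fixes f :: "'a::euclidean_space \<Rightarrow> real"
  assumes "smooth_on (ball c r) f" "x \<in> ball c r" "t \<in> {0..1}"
  shows "((\<lambda>t. f (c + t *\<^sub>R (x - c))) has_real_derivative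
    frechet_derivative f (at (c + t *\<^sub>R (x - c))) (x - c)) (at t)"
proof -
  note Df = smooth_on_has_derivative[OF assms(1) radial_point_in_ball[OF assms(2,3)]]
  have "((\<lambda>t. c + t *\<^sub>R (x - c)) has_derivative (\<lambda>s. s *\<^sub>R (x - c))) (at t)"
    by (auto intro!: derivative_eq_intros)
  from has_derivative_compose[OF this Df] show ?thesis
    using linear_cmul[OF has_derivative_linear[OF Df]]
    by (simp add: has_field_derivative_def mult.commute[of _ "frechet_derivative _ _ _"] mult_commute_abs)
qed

lemma frechet_derivative_coords:
  fixes f :: "'a::euclidean_space \<Rightarrow> real"
  assumes "smooth_on S f" "y \<in> S"
  shows "frechet_derivative f (at y) v = (\<Sum>b\<in>Basis. (v \<bullet> b) * frechet_derivative f (at y) b)"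
  by (rule linear_real_coords[OF has_derivative_linear[OF smooth_on_has_derivative[OF assms]]])

lemma radial_sum:
  fixes f :: "'b \<Rightarrow> 'a::euclidean_space \<Rightarrow> real"
  assumes "finite I" "\<And>i. i \<in> I \<Longrightarrow> smooth_on (ball c r) (f i)" "x \<in> ball c r"
  shows "radial m c (\<lambda>y. \<Sum>i\<in>I. k i * f i y) x = (\<Sum>i\<in>I. k i * radial m c (f i) x)"
proof -
  have "radial m c (\<lambda>y. \<Sum>i\<in>I. k i * f i y) x
      = integral {0..1} (\<lambda>t. \<Sum>i\<in>I. k i * (t ^ m * f i (c + t *\<^sub>R (x - c))))"
    by (simp add: radial_def sum_distrib_left mult.left_commute)
  also have "\<dots> = (\<Sum>i\<in>I. integral {0..1} (\<lambda>t. k i * (t ^ m * f i (c + t *\<^sub>R (x - c)))))"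
    by (intro integral_sum assms(1) integrable_continuous_real continuous_on_mult_left
        continuous_on_radial_integrand[OF smooth_on_continuous[OF assms(2)] assms(3)])
  finally show ?thesis by (simp add: radial_def)
qed

text \<open>The fundamental theorem of calculus along the ray from \<open>c\<close> to \<open>x\<close>. What matters is that the
  factors of \<open>(x - c) \<bullet> b\<close> are smooth functions of \<open>x\<close>.\<close>

lemma hadamard:
  fixes f :: "'a::euclidean_space \<Rightarrow> real"
  assumes f: "smooth_on (ball c r) f" and x: "x \<in> ball c r"
  shows "f x = f c + (\<Sum>b\<in>Basis. ((x - c) \<bullet> b) * radial 0 c (\<lambda>y. frechet_derivative f (at y) b) x)"
proof -
  let ?p = "\<lambda>t. c + t *\<^sub>R (x - c)"
  have "((\<lambda>t. frechet_derivative f (at (?p t)) (x - c)) has_integral f (?p 1) - f (?p 0)) {0..1}"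
    using has_real_derivative_along_ray[OF f x]
    by (intro fundamental_theorem_of_calculus)
      (auto simp: has_real_derivative_iff_has_vector_derivative[symmetric] intro: has_field_derivative_at_within)
  then have "f x - f c = radial 0 c (\<lambda>y. frechet_derivative f (at y) (x - c)) x"
    by (simp add: radial_def integral_unique)
  also have "\<dots> = radial 0 c (\<lambda>y. \<Sum>b\<in>Basis. ((x - c) \<bullet> b) * frechet_derivative f (at y) b) x"
    unfolding radial_def
    by (rule integral_cong) (simp add: frechet_derivative_coords[OF f radial_point_in_ball[OF x]])
  also have "\<dots> = (\<Sum>b\<in>Basis. ((x - c) \<bullet> b) * radial 0 c (\<lambda>y. frechet_derivative f (at y) b) x)"
    by (rule radial_sum[OF finite_Basis smooth_on_derivative[OF f] x])
  finally show ?thesis by simp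
qed

text \<open>The primitive of \<open>\<Sum>d. a\<^sub>d dx\<^sub>d\<close> is \<open>s x = (\<Sum>d. ((x - c) \<bullet> d) * radial 0 c a\<^sub>d x)\<close>. In the
  derivative \<open>D\<^sub>b s\<close>, closedness replaces \<open>D\<^sub>b a\<^sub>d\<close> by \<open>D\<^sub>d a\<^sub>b\<close>, and the result is the integral of the
  derivative of \<open>t * a\<^sub>b (c + t (x - c))\<close> over the unit interval.\<close>

lemma poincare_ball:
  fixes a :: "'a::euclidean_space \<Rightarrow> 'a \<Rightarrow> real"
  assumes a: "\<And>b. b \<in> Basis \<Longrightarrow> smooth_on (ball c r) (a b)"
    and closed: "\<And>b d y. b \<in> Basis \<Longrightarrow> d \<in> Basis \<Longrightarrow> y \<in> ball c r \<Longrightarrow>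
      frechet_derivative (a d) (at y) b = frechet_derivative (a b) (at y) d"
  obtains s where "smooth_on (ball c r) s"
    and "\<And>b y. b \<in> Basis \<Longrightarrow> y \<in> ball c r \<Longrightarrow> frechet_derivative s (at y) b = a b y"
proof
  let ?B = "ball c r" and ?s = "\<lambda>x. \<Sum>d\<in>Basis. ((x - c) \<bullet> d) * radial 0 c (a d) x"
  have "smooth_on ?B (\<lambda>x. (x + - c) \<bullet> d)" for d :: 'a
    by (intro smooth_on_linear[OF open_ball bounded_linear_inner_left] smooth_on_add
        smooth_on_ident smooth_on_const) auto
  then show "smooth_on ?B ?s"
    by (intro smooth_on_sum smooth_on_mult smooth_on_radial a) auto
  fix b :: 'a and x assume b: "b \<in> Basis" and x: "x \<in> ?B"
  let ?p = "\<lambda>t. c + t *\<^sub>R (x - c)"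
  have der: "(?s has_derivative (\<lambda>v. \<Sum>d\<in>Basis.
      ((x - c) \<bullet> d) * radial (Suc 0) c (\<lambda>y. frechet_derivative (a d) (at y) v) x
        + (v \<bullet> d) * radial 0 c (a d) x)) (at x)"
  proof (rule has_derivative_sum)
    fix d :: 'a assume "d \<in> Basis"
    have "((\<lambda>x. (x - c) \<bullet> d) has_derivative (\<lambda>v. v \<bullet> d)) (at x)"
      by (auto intro!: derivative_eq_intros)
    then show "((\<lambda>x. ((x - c) \<bullet> d) * radial 0 c (a d) x) has_derivative
        (\<lambda>v. ((x - c) \<bullet> d) * radial (Suc 0) c (\<lambda>y. frechet_derivative (a d) (at y) v) x
          + (v \<bullet> d) * radial 0 c (a d) x)) (at x)"
      by (rule has_derivative_mult[OF _ radial_has_derivative[OF a[OF \<open>d \<in> Basis\<close>] x]])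
  qed
  have "frechet_derivative ?s (at x) b = (\<Sum>d\<in>Basis.
      ((x - c) \<bullet> d) * radial (Suc 0) c (\<lambda>y. frechet_derivative (a d) (at y) b) x
        + (b \<bullet> d) * radial 0 c (a d) x)"
    by (rule fun_cong[OF frechet_derivative_at[OF der], of b, symmetric])
  also have "\<dots> = (\<Sum>d\<in>Basis. ((x - c) \<bullet> d) * radial (Suc 0) c (\<lambda>y. frechet_derivative (a d) (at y) b) x)
      + radial 0 c (a b) x"
    using b by (simp add: sum.distrib inner_Basis if_distrib[of "\<lambda>z. z * _"] sum.delta cong: if_cong)
  also have "(\<Sum>d\<in>Basis. ((x - c) \<bullet> d) * radial (Suc 0) c (\<lambda>y. frechet_derivative (a d) (at y) b) x)
      = (\<Sum>d\<in>Basis. ((x - c) \<bullet> d) * radial (Suc 0) c (\<lambda>y. frechet_derivative (a b) (at y) d) x)"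
    unfolding radial_def
    by (intro sum.cong arg_cong2[where f="(*)"] integral_cong)
      (auto simp: closed[OF b _ radial_point_in_ball[OF x]])
  also have "\<dots> = radial (Suc 0) c (\<lambda>y. \<Sum>d\<in>Basis. ((x - c) \<bullet> d) * frechet_derivative (a b) (at y) d) x"
    by (rule radial_sum[OF finite_Basis smooth_on_derivative[OF a[OF b]] x, symmetric])
  also have "\<dots> = radial (Suc 0) c (\<lambda>y. frechet_derivative (a b) (at y) (x - c)) x"
    unfolding radial_def
    by (rule integral_cong) (simp add: frechet_derivative_coords[OF a[OF b] radial_point_in_ball[OF x], of _ "x - c"])
  also have "\<dots> + radial 0 c (a b) x = integral {0..1} (\<lambda>t. t * frechet_derivative (a b) (at (?p t)) (x - c) + a b (?p t))"
    unfolding radial_def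
    using continuous_on_radial_integrand[OF smooth_on_continuous[OF a[OF b]] x, of 0]
      continuous_on_radial_integrand[OF smooth_on_continuous[OF smooth_on_derivative[OF a[OF b]]] x, of 1]
    by (simp add: integral_add[symmetric] integrable_continuous_real)
  also have "\<dots> = 1 * a b (?p 1) - 0 * a b (?p 0)"
  proof (intro integral_unique fundamental_theorem_of_calculus)
    fix t :: real assume t: "t \<in> {0..1}"
    have "((\<lambda>t. t * a b (?p t)) has_real_derivative
        t * frechet_derivative (a b) (at (?p t)) (x - c) + a b (?p t)) (at t)"
      by (auto intro!: derivative_eq_intros has_real_derivative_along_ray[OF a[OF b] x t])
    then show "((\<lambda>t. t * a b (?p t)) has_vector_derivative
        t * frechet_derivative (a b) (at (?p t)) (x - c) + a b (?p t)) (at t within {0..1})"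
      by (simp add: has_real_derivative_iff_has_vector_derivative[symmetric] has_field_derivative_at_within)
  qed auto
  finally show "frechet_derivative ?s (at x) b = a b x" by simp
qed

section \<open>Smooth functions on a manifold\<close>

locale smooth_manifold =
  fixes A :: "('m::topological_space, 'e::euclidean_space) atlas"
  assumes atlas: "smooth_atlas A"
begin

lemma chart_ex: obtains U \<phi> where "(U, \<phi>) \<in> A" "p \<in> U"
proof -
  have "(\<Union>(U, \<phi>)\<in>A. U) = UNIV" using atlas by (simp add: smooth_atlas_def)
  then have "p \<in> (\<Union>(U, \<phi>)\<in>A. U)" by simp
  then show thesis using that by auto
qed

lemma
  assumes "(U, \<phi>) \<in> A"
  shows chart_open: "open U" and chart_open_range: "open (\<phi> ` U)" and chart_inj: "inj_on \<phi> U"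
    and chart_homeo: "homeomorphism U (\<phi> ` U) \<phi> (inv_into U \<phi>)"
proof -
  have "\<forall>(U, \<phi>)\<in>A. open U \<and> open (\<phi> ` U) \<and> inj_on \<phi> U \<and>
      homeomorphism U (\<phi> ` U) \<phi> (inv_into U \<phi>)"
    using atlas unfolding smooth_atlas_def by (elim conjE)
  then show "open U" "open (\<phi> ` U)" "inj_on \<phi> U" "homeomorphism U (\<phi> ` U) \<phi> (inv_into U \<phi>)"
    using assms by auto
qed

lemma chart_transition:
  assumes "(U, \<phi>) \<in> A" "(V, \<psi>) \<in> A"
  shows "smooth_on (\<phi> ` (U \<inter> V)) (\<lambda>y. \<psi> (inv_into U \<phi> y))"
proof -
  have "\<forall>(U, \<phi>)\<in>A. \<forall>(V, \<psi>)\<in>A. smooth_on (\<phi> ` (U \<inter> V)) (\<psi> \<circ> inv_into U \<phi>)"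
    using atlas unfolding smooth_atlas_def by (elim conjE)
  from bspec[OF this assms(1)] have "\<forall>(V, \<psi>)\<in>A. smooth_on (\<phi> ` (U \<inter> V)) (\<psi> \<circ> inv_into U \<phi>)" by simp
  from bspec[OF this assms(2)] show ?thesis by (simp add: o_def)
qed

lemma chart_open_image:
  assumes "(U, \<phi>) \<in> A" "open W"
  shows "open (\<phi> ` (U \<inter> W))"
proof -
  have "\<phi> ` (U \<inter> W) = \<phi> ` U \<inter> inv_into U \<phi> -` W"
    using chart_inj[OF assms(1)] by auto
  moreover have "open (\<phi> ` U \<inter> inv_into U \<phi> -` W)"
    using homeomorphism_cont2[OF chart_homeo[OF assms(1)]] chart_open_range[OF assms(1)] assms(2)
    by (rule continuous_open_preimage)
  ultimately show ?thesis by simp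
qed

lemma chart_open_preimage:
  assumes "(U, \<phi>) \<in> A" "open B"
  shows "open (U \<inter> \<phi> -` B)"
  using homeomorphism_cont1[OF chart_homeo[OF assms(1)]] chart_open[OF assms(1)] assms(2)
  by (rule continuous_open_preimage)

lemma smooth_funI:
  "(\<And>U \<phi>. (U, \<phi>) \<in> A \<Longrightarrow> smooth_on (\<phi> ` (U \<inter> W)) (\<lambda>y. f (inv_into U \<phi> y))) \<Longrightarrow> smooth_fun A W f"
  unfolding smooth_fun_def o_def by auto

lemma smooth_funD:
  "smooth_fun A W f \<Longrightarrow> (U, \<phi>) \<in> A \<Longrightarrow> smooth_on (\<phi> ` (U \<inter> W)) (\<lambda>y. f (inv_into U \<phi> y))"
  unfolding smooth_fun_def o_def by auto

lemma smooth_fun_mono: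
  assumes "smooth_fun A W f" "V \<subseteq> W"
  shows "smooth_fun A V f"
proof (rule smooth_funI)
  fix U \<phi> assume c: "(U, \<phi>) \<in> A"
  show "smooth_on (\<phi> ` (U \<inter> V)) (\<lambda>y. f (inv_into U \<phi> y))"
    by (rule smooth_on_subset[OF smooth_funD[OF assms(1) c]]) (use assms(2) in auto)
qed

lemma smooth_fun_cong:
  assumes "open W" "\<And>q. q \<in> W \<Longrightarrow> f q = h q" "smooth_fun A W f"
  shows "smooth_fun A W h"
proof (rule smooth_funI)
  fix U \<phi> assume c: "(U, \<phi>) \<in> A"
  have eq: "f (inv_into U \<phi> y) = h (inv_into U \<phi> y)" if y: "y \<in> \<phi> ` (U \<inter> W)" for y
  proof -
    obtain q where "q \<in> U" "q \<in> W" "y = \<phi> q" using y by blast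
    then show ?thesis using assms(2) chart_inj[OF c] by simp
  qed
  show "smooth_on (\<phi> ` (U \<inter> W)) (\<lambda>y. h (inv_into U \<phi> y))"
    by (rule iffD1[OF smooth_on_cong[OF chart_open_image[OF c assms(1)] eq] smooth_funD[OF assms(3) c]])
qed

lemma smooth_fun_const: "open W \<Longrightarrow> smooth_fun A W (\<lambda>q. c)"
  by (intro smooth_funI smooth_on_const chart_open_image)

lemma smooth_fun_add:
  assumes "open W" "smooth_fun A W f" "smooth_fun A W h"
  shows "smooth_fun A W (\<lambda>q. f q + h q)"
  by (rule smooth_funI)
    (rule smooth_on_add[OF chart_open_image[OF _ assms(1)] smooth_funD[OF assms(2)] smooth_funD[OF assms(3)]])

lemma smooth_fun_mult:
  assumes "open W" "smooth_fun A W f" "smooth_fun A W h"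
  shows "smooth_fun A W (\<lambda>q. f q * h q)"
  by (rule smooth_funI)
    (rule smooth_on_mult[OF chart_open_image[OF _ assms(1)] smooth_funD[OF assms(2)] smooth_funD[OF assms(3)]])

lemma smooth_fun_sum:
  "open W \<Longrightarrow> (\<And>i. i \<in> I \<Longrightarrow> smooth_fun A W (f i)) \<Longrightarrow> smooth_fun A W (\<lambda>q. \<Sum>i\<in>I. f i q)"
  by (induction I rule: infinite_finite_induct) (simp_all add: smooth_fun_const smooth_fun_add)

lemma smooth_fun_diff:
  assumes "open W" "smooth_fun A W f" "smooth_fun A W h"
  shows "smooth_fun A W (\<lambda>q. f q - h q)"
  using smooth_fun_add[OF assms(1,2) smooth_fun_mult[OF assms(1) smooth_fun_const[OF assms(1), of "-1"] assms(3)]]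
  by simp

lemma smooth_fun_exp:
  assumes "open W" "smooth_fun A W f"
  shows "smooth_fun A W (\<lambda>q. exp (f q))"
  by (rule smooth_funI)
    (rule smooth_on_compose[OF chart_open_image[OF _ assms(1)] open_UNIV subset_UNIV smooth_on_exp
        smooth_funD[OF assms(2)]])

lemma smooth_atI: "smooth_fun A W f \<Longrightarrow> open W \<Longrightarrow> p \<in> W \<Longrightarrow> smooth_at A p f"
  unfolding smooth_at_def by blast

lemma smooth_atE:
  assumes "smooth_at A p f"
  obtains W where "open W" "p \<in> W" "smooth_fun A W f"
  using assms unfolding smooth_at_def by blast

lemma smooth_at_const: "smooth_at A p (\<lambda>q. c)"
  by (rule smooth_atI[OF smooth_fun_const[OF open_UNIV] open_UNIV UNIV_I])

lemma smooth_at_add: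
  assumes "smooth_at A p f" "smooth_at A p h"
  shows "smooth_at A p (\<lambda>q. f q + h q)"
proof -
  obtain V where V: "open V" "p \<in> V" "smooth_fun A V f" using assms(1) by (rule smooth_atE)
  obtain W where W: "open W" "p \<in> W" "smooth_fun A W h" using assms(2) by (rule smooth_atE)
  have VW: "open (V \<inter> W)" using V W by auto
  show ?thesis
    by (rule smooth_atI[OF smooth_fun_add[OF VW smooth_fun_mono[OF V(3)] smooth_fun_mono[OF W(3)]] VW])
      (use V W in auto)
qed

lemma smooth_at_mult:
  assumes "smooth_at A p f" "smooth_at A p h"
  shows "smooth_at A p (\<lambda>q. f q * h q)"
proof -
  obtain V where V: "open V" "p \<in> V" "smooth_fun A V f" using assms(1) by (rule smooth_atE)
  obtain W where W: "open W" "p \<in> W" "smooth_fun A W h" using assms(2) by (rule smooth_atE)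
  have VW: "open (V \<inter> W)" using V W by auto
  show ?thesis
    by (rule smooth_atI[OF smooth_fun_mult[OF VW smooth_fun_mono[OF V(3)] smooth_fun_mono[OF W(3)]] VW])
      (use V W in auto)
qed

lemma smooth_at_cmult: "smooth_at A p f \<Longrightarrow> smooth_at A p (\<lambda>q. c * f q)"
  by (rule smooth_at_mult[OF smooth_at_const])

lemma smooth_at_lin:
  "smooth_at A p f \<Longrightarrow> smooth_at A p h \<Longrightarrow> smooth_at A p (\<lambda>q. a * f q + b * h q)"
  by (intro smooth_at_add smooth_at_cmult)

lemma smooth_at_sum:
  "(\<And>i. i \<in> I \<Longrightarrow> smooth_at A p (f i)) \<Longrightarrow> smooth_at A p (\<lambda>q. \<Sum>i\<in>I. f i q)"
  by (induction I rule: infinite_finite_induct) (simp_all add: smooth_at_const smooth_at_add)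

lemma smooth_at_cong:
  assumes "smooth_at A p f" "\<forall>\<^sub>F q in nhds p. f q = h q"
  shows "smooth_at A p h"
proof -
  obtain V where V: "open V" "p \<in> V" "smooth_fun A V f" using assms(1) by (rule smooth_atE)
  obtain W where W: "open W" "p \<in> W" "\<And>q. q \<in> W \<Longrightarrow> f q = h q"
    using assms(2) unfolding eventually_nhds by blast
  have VW: "open (V \<inter> W)" using V W by auto
  show ?thesis
    by (rule smooth_atI[OF smooth_fun_cong[OF VW _ smooth_fun_mono[OF V(3)]] VW])
      (use V W in auto)
qed

lemma smooth_at_eventually:
  assumes "smooth_at A p f"
  shows "\<forall>\<^sub>F q in nhds p. smooth_at A q f"
  using assms unfolding eventually_nhds by (metis smooth_atE smooth_atI)

lemma chart_pullback_smooth: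
  fixes h :: "'e \<Rightarrow> real"
  assumes c: "(U, \<phi>) \<in> A" and B: "open B" "smooth_on B h"
  shows "smooth_fun A (U \<inter> \<phi> -` B) (\<lambda>q. h (\<phi> q))"
proof (rule smooth_funI)
  fix V \<psi> assume d: "(V, \<psi>) \<in> A"
  note S = chart_open_image[OF d chart_open_preimage[OF c B(1)]]
  have maps: "(\<lambda>y. \<phi> (inv_into V \<psi> y)) ` \<psi> ` (V \<inter> (U \<inter> \<phi> -` B)) \<subseteq> B"
    using chart_inj[OF d] by auto
  have sub: "\<psi> ` (V \<inter> (U \<inter> \<phi> -` B)) \<subseteq> \<psi> ` (V \<inter> U)" by auto
  show "smooth_on (\<psi> ` (V \<inter> (U \<inter> \<phi> -` B))) (\<lambda>y. h (\<phi> (inv_into V \<psi> y)))"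
    by (rule smooth_on_compose[OF S B(1) maps B(2) smooth_on_subset[OF chart_transition[OF d c] sub]])
qed

lemma chart_coordinate_smooth:
  assumes c: "(U, \<phi>) \<in> A"
  shows "smooth_fun A U (\<lambda>q. \<phi> q \<bullet> b)"
  using chart_pullback_smooth[OF c open_UNIV
      smooth_on_linear[OF open_UNIV bounded_linear_inner_left smooth_on_ident[OF open_UNIV]], of b]
  by simp

lemma chart_coordinate_smooth_at: "(U, \<phi>) \<in> A \<Longrightarrow> p \<in> U \<Longrightarrow> smooth_at A p (\<lambda>q. \<phi> q \<bullet> b)"
  using smooth_atI[OF chart_coordinate_smooth] chart_open by blast

lemma smooth_at_in_chart:
  assumes c: "(U, \<phi>) \<in> A" "p \<in> U" and f: "smooth_at A p f"
  obtains r where "r > 0" "ball (\<phi> p) r \<subseteq> \<phi> ` U" "smooth_on (ball (\<phi> p) r) (\<lambda>y. f (inv_into U \<phi> y))"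
proof -
  obtain W where W: "open W" "p \<in> W" "smooth_fun A W f" using f by (rule smooth_atE)
  obtain r where r: "r > 0" "ball (\<phi> p) r \<subseteq> \<phi> ` (U \<inter> W)"
    using openE[OF chart_open_image[OF c(1) W(1)], of "\<phi> p"] W(2) c(2) by blast
  show thesis
    by (rule that[OF r(1) _ smooth_on_subset[OF smooth_funD[OF W(3) c(1)] r(2)]]) (use r in auto)
qed

lemma smooth_at_exp:
  assumes "smooth_at A p f" shows "smooth_at A p (\<lambda>q. exp (f q))"
  using assms by (metis smooth_atE smooth_atI smooth_fun_exp)

lemma smooth_at_has_derivative:
  assumes c: "(U, \<phi>) \<in> A" "p \<in> U" and f: "smooth_at A p f"
  shows "((\<lambda>y. f (inv_into U \<phi> y)) has_derivative
    frechet_derivative (\<lambda>y. f (inv_into U \<phi> y)) (at (\<phi> p))) (at (\<phi> p))"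
  using smooth_at_in_chart[OF assms] smooth_on_has_derivative by (metis centre_in_ball)

section \<open>Tangent vectors in coordinates\<close>

lemma tangent_lin:
  "v \<in> tangent_space A p \<Longrightarrow> smooth_at A p f \<Longrightarrow> smooth_at A p h \<Longrightarrow>
    v (\<lambda>q. a * f q + b * h q) = a * v f + b * v h"
  unfolding tangent_space_def by blast

lemma tangent_mult:
  "v \<in> tangent_space A p \<Longrightarrow> smooth_at A p f \<Longrightarrow> smooth_at A p h \<Longrightarrow>
    v (\<lambda>q. f q * h q) = f p * v h + h p * v f"
  unfolding tangent_space_def by blast

lemma tangent_cong:
  "v \<in> tangent_space A p \<Longrightarrow> smooth_at A p f \<Longrightarrow> \<forall>\<^sub>F q in nhds p. f q = h q \<Longrightarrow> v f = v h"
  unfolding tangent_space_def by blast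

lemma tangent_nonsmooth: "v \<in> tangent_space A p \<Longrightarrow> \<not> smooth_at A p f \<Longrightarrow> v f = 0"
  unfolding tangent_space_def by blast

lemma tangent_spaceI:
  assumes "\<And>f h a b. smooth_at A p f \<Longrightarrow> smooth_at A p h \<Longrightarrow>
      v (\<lambda>q. a * f q + b * h q) = a * v f + b * v h"
    and "\<And>f h. smooth_at A p f \<Longrightarrow> smooth_at A p h \<Longrightarrow> v (\<lambda>q. f q * h q) = f p * v h + h p * v f"
    and "\<And>f h. smooth_at A p f \<Longrightarrow> smooth_at A p h \<Longrightarrow> \<forall>\<^sub>F q in nhds p. f q = h q \<Longrightarrow> v f = v h"
    and "\<And>f. \<not> smooth_at A p f \<Longrightarrow> v f = 0"
  shows "v \<in> tangent_space A p"
  unfolding tangent_space_def mem_Collect_eq using assms smooth_at_cong by (metis (no_types, lifting))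

lemma tangent_add:
  "v \<in> tangent_space A p \<Longrightarrow> smooth_at A p f \<Longrightarrow> smooth_at A p h \<Longrightarrow> v (\<lambda>q. f q + h q) = v f + v h"
  using tangent_lin[of v p f h 1 1] by simp

lemma tangent_diff:
  "v \<in> tangent_space A p \<Longrightarrow> smooth_at A p f \<Longrightarrow> smooth_at A p h \<Longrightarrow> v (\<lambda>q. f q - h q) = v f - v h"
  using tangent_lin[of v p f h 1 "-1"] by simp

lemma tangent_const: "v \<in> tangent_space A p \<Longrightarrow> v (\<lambda>q. c) = 0"
proof -
  assume v: "v \<in> tangent_space A p"
  have "v (\<lambda>q. 1) = 0"
    using tangent_mult[OF v smooth_at_const smooth_at_const, of 1 1] by simp
  then show ?thesis
    using tangent_lin[OF v smooth_at_const smooth_at_const, of c 1 0 1] by simp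
qed

lemma tangent_cmult:
  "v \<in> tangent_space A p \<Longrightarrow> smooth_at A p f \<Longrightarrow> v (\<lambda>q. c * f q) = c * v f"
  using tangent_mult[of v p "\<lambda>_. c" f] by (simp add: smooth_at_const tangent_const)

lemma tangent_sum:
  assumes "v \<in> tangent_space A p"
  shows "(\<And>i. i \<in> I \<Longrightarrow> smooth_at A p (f i)) \<Longrightarrow> v (\<lambda>q. \<Sum>i\<in>I. f i q) = (\<Sum>i\<in>I. v (f i))"
  by (induction I rule: infinite_finite_induct)
    (auto simp: tangent_const[OF assms] tangent_add[OF assms] smooth_at_sum)

lemma tangent_space_lincomb:
  assumes "\<And>i. i \<in> I \<Longrightarrow> v i \<in> tangent_space A p"
  shows "(\<lambda>f. \<Sum>i\<in>I. c i * v i f) \<in> tangent_space A p"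
proof (rule tangent_spaceI)
  fix f h a b assume f: "smooth_at A p f" and h: "smooth_at A p h"
  have "(\<Sum>i\<in>I. c i * v i (\<lambda>q. a * f q + b * h q)) = (\<Sum>i\<in>I. a * (c i * v i f) + b * (c i * v i h))"
    by (rule sum.cong) (simp_all add: tangent_lin[OF assms f h] algebra_simps)
  then show "(\<Sum>i\<in>I. c i * v i (\<lambda>q. a * f q + b * h q)) = a * (\<Sum>i\<in>I. c i * v i f) + b * (\<Sum>i\<in>I. c i * v i h)"
    by (simp add: sum.distrib sum_distrib_left)
  have "(\<Sum>i\<in>I. c i * v i (\<lambda>q. f q * h q)) = (\<Sum>i\<in>I. f p * (c i * v i h) + h p * (c i * v i f))"
    by (rule sum.cong) (simp_all add: tangent_mult[OF assms f h] algebra_simps)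
  then show "(\<Sum>i\<in>I. c i * v i (\<lambda>q. f q * h q)) = f p * (\<Sum>i\<in>I. c i * v i h) + h p * (\<Sum>i\<in>I. c i * v i f)"
    by (simp add: sum.distrib sum_distrib_left)
next
  fix f h assume "smooth_at A p f" "\<forall>\<^sub>F q in nhds p. f q = h q"
  then show "(\<Sum>i\<in>I. c i * v i f) = (\<Sum>i\<in>I. c i * v i h)"
    by (intro sum.cong) (auto dest: tangent_cong[OF assms])
next
  fix f assume "\<not> smooth_at A p f"
  then show "(\<Sum>i\<in>I. c i * v i f) = 0"
    by (intro sum.neutral) (auto dest: tangent_nonsmooth[OF assms])
qed

lemma tangent_zero: "(\<lambda>f. 0) \<in> tangent_space A p"
  using tangent_space_lincomb[of "{}"] by simp

text \<open>By Hadamard's lemma \<open>f = f p + (\<Sum>b. (x\<^sub>b - x\<^sub>b p) * h\<^sub>b)\<close> near \<open>p\<close>, with smooth \<open>h\<^sub>b\<close>. The Leibniz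
  rule annihilates everything except \<open>h\<^sub>b p * v x\<^sub>b\<close>, and \<open>h\<^sub>b p\<close> is the partial derivative of \<open>f\<close>.\<close>

lemma tangent_chart:
  assumes c: "(U, \<phi>) \<in> A" "p \<in> U" and v: "v \<in> tangent_space A p" and f: "smooth_at A p f"
  shows "v f = (\<Sum>b\<in>Basis. v (\<lambda>q. \<phi> q \<bullet> b) *
    frechet_derivative (\<lambda>y. f (inv_into U \<phi> y)) (at (\<phi> p)) b)"
proof -
  let ?F = "\<lambda>y. f (inv_into U \<phi> y)" and ?c = "\<phi> p"
  obtain r where r: "r > 0" "ball ?c r \<subseteq> \<phi> ` U" "smooth_on (ball ?c r) ?F"
    by (rule smooth_at_in_chart[OF c f])
  define h where "h b = radial 0 ?c (\<lambda>y. frechet_derivative ?F (at y) b)" for b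
  have hb: "smooth_on (ball ?c r) (h b)" for b
    unfolding h_def by (intro smooth_on_radial smooth_on_derivative r)
  have hs: "smooth_at A p (\<lambda>q. h b (\<phi> q))" for b
    by (rule smooth_atI[OF chart_pullback_smooth[OF c(1) open_ball hb] chart_open_preimage[OF c(1) open_ball]])
      (use r(1) c(2) in simp)
  let ?x = "\<lambda>b q. \<phi> q \<bullet> b - ?c \<bullet> b"
  have xs: "smooth_at A p (?x b)" for b
    using smooth_at_add[OF chart_coordinate_smooth_at[OF c] smooth_at_const[of p "- (?c \<bullet> b)"], of b]
    by simp
  have taylor: "f q = f p + (\<Sum>b\<in>Basis. ?x b q * h b (\<phi> q))" if q: "q \<in> U \<inter> \<phi> -` ball ?c r" for q
  proof -
    have "\<phi> q \<in> ball ?c r" using q by simp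
    from hadamard[OF r(3) this] have "f (inv_into U \<phi> (\<phi> q))
        = f (inv_into U \<phi> ?c) + (\<Sum>b\<in>Basis. ?x b q * h b (\<phi> q))"
      unfolding h_def inner_diff_left .
    moreover have "inv_into U \<phi> (\<phi> q) = q" "inv_into U \<phi> ?c = p"
      using q c(2) chart_inj[OF c(1)] by auto
    ultimately show ?thesis by metis
  qed
  have "\<forall>\<^sub>F q in nhds p. q \<in> U \<inter> \<phi> -` ball ?c r"
    by (rule eventually_nhds_in_open[OF chart_open_preimage[OF c(1) open_ball]]) (use r(1) c(2) in simp)
  then have ev: "\<forall>\<^sub>F q in nhds p. f q = f p + (\<Sum>b\<in>Basis. ?x b q * h b (\<phi> q))"
    by eventually_elim (rule taylor)
  have "v f = v (\<lambda>q. f p + (\<Sum>b\<in>Basis. ?x b q * h b (\<phi> q)))"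
    by (rule tangent_cong[OF v f ev])
  also have "\<dots> = v (\<lambda>q. f p) + v (\<lambda>q. \<Sum>b\<in>Basis. ?x b q * h b (\<phi> q))"
    by (rule tangent_add[OF v smooth_at_const smooth_at_sum[OF smooth_at_mult[OF xs hs]]])
  also have "\<dots> = (\<Sum>b\<in>Basis. v (\<lambda>q. ?x b q * h b (\<phi> q)))"
    unfolding tangent_const[OF v] add_0_left by (rule tangent_sum[OF v smooth_at_mult[OF xs hs]])
  also have "\<dots> = (\<Sum>b\<in>Basis. h b ?c * v (\<lambda>q. \<phi> q \<bullet> b))"
    by (simp only: tangent_mult[OF v xs hs] tangent_diff[OF v chart_coordinate_smooth_at[OF c] smooth_at_const]
        tangent_const[OF v]) simp
  also have "\<dots> = (\<Sum>b\<in>Basis. v (\<lambda>q. \<phi> q \<bullet> b) * frechet_derivative ?F (at ?c) b)"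
    by (simp add: h_def radial_def mult.commute)
  finally show ?thesis .
qed

text \<open>A derivation is only assumed to respect sums and products; the chain rule follows once it is
  a combination of partial derivatives.\<close>

lemma tangent_exp:
  assumes v: "v \<in> tangent_space A p" and f: "smooth_at A p f"
  shows "v (\<lambda>q. exp (f q)) = exp (f p) * v f"
proof -
  obtain U \<phi> where c: "(U, \<phi>) \<in> A" "p \<in> U" by (rule chart_ex)
  have p: "inv_into U \<phi> (\<phi> p) = p" using chart_inj[OF c(1)] c(2) by simp
  let ?F = "\<lambda>y. f (inv_into U \<phi> y)"
  note d = smooth_at_has_derivative[OF c f]
  have "((\<lambda>y. exp (?F y)) has_derivative (\<lambda>u. exp (f p) * frechet_derivative ?F (at (\<phi> p)) u)) (at (\<phi> p))"
    using has_derivative_exp[OF d] by (simp add: p mult.commute)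
  from frechet_derivative_at[OF this]
  have d': "frechet_derivative (\<lambda>y. exp (?F y)) (at (\<phi> p)) u = exp (f p) * frechet_derivative ?F (at (\<phi> p)) u" for u
    by (rule fun_cong[symmetric])
  have "v (\<lambda>q. exp (f q)) = (\<Sum>b\<in>Basis. v (\<lambda>q. \<phi> q \<bullet> b) * (exp (f p) * frechet_derivative ?F (at (\<phi> p)) b))"
    using tangent_chart[OF c v smooth_at_exp[OF f]] unfolding d' .
  also have "\<dots> = exp (f p) * v f"
    unfolding tangent_chart[OF c v f] sum_distrib_left by (intro sum.cong refl mult.left_commute)
  finally show ?thesis .
qed

section \<open>Vector fields and brackets\<close>

lemma vector_fieldI:
  "(\<And>p. p \<in> W \<Longrightarrow> X p \<in> tangent_space A p) \<Longrightarrow>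
   (\<And>V f. open V \<Longrightarrow> V \<subseteq> W \<Longrightarrow> smooth_fun A V f \<Longrightarrow> smooth_fun A V (\<lambda>p. X p f)) \<Longrightarrow> vector_field A W X"
  unfolding vector_field_def by blast

lemma vector_field_tangent: "vector_field A W X \<Longrightarrow> p \<in> W \<Longrightarrow> X p \<in> tangent_space A p"
  unfolding vector_field_def by blast

lemma vector_field_smooth:
  "vector_field A W X \<Longrightarrow> open V \<Longrightarrow> V \<subseteq> W \<Longrightarrow> smooth_fun A V f \<Longrightarrow> smooth_fun A V (\<lambda>p. X p f)"
  unfolding vector_field_def by blast

lemma vector_field_mono:
  assumes "vector_field A W X" "V \<subseteq> W"
  shows "vector_field A V X"
  by (rule vector_fieldI)
    (rule vector_field_tangent[OF assms(1) subsetD[OF assms(2)]]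
      vector_field_smooth[OF assms(1) _ order_trans[OF _ assms(2)]]; assumption)+

lemma vector_field_smooth_at:
  assumes "vector_field A W X" "open W" "p \<in> W" "smooth_at A p f"
  shows "smooth_at A p (\<lambda>q. X q f)"
proof -
  obtain V where V: "open V" "p \<in> V" "smooth_fun A V f" using assms(4) by (rule smooth_atE)
  have VW: "open (V \<inter> W)" using V assms(2) by auto
  show ?thesis
    by (rule smooth_atI[OF vector_field_smooth[OF assms(1) VW _ smooth_fun_mono[OF V(3)]] VW])
      (use V assms(3) in auto)
qed

lemma vector_field_lincomb:
  assumes "open W" "\<And>i. i \<in> I \<Longrightarrow> smooth_fun A W (c i)" "\<And>i. i \<in> I \<Longrightarrow> vector_field A W (e i)"
  shows "vector_field A W (\<lambda>p f. \<Sum>i\<in>I. c i p * e i p f)"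
proof (rule vector_fieldI)
  show "(\<lambda>f. \<Sum>i\<in>I. c i p * e i p f) \<in> tangent_space A p" if "p \<in> W" for p
    by (rule tangent_space_lincomb) (rule vector_field_tangent[OF assms(3) that])
  show "smooth_fun A V (\<lambda>p. \<Sum>i\<in>I. c i p * e i p f)" if "open V" "V \<subseteq> W" "smooth_fun A V f" for V f
    by (intro smooth_fun_sum smooth_fun_mult that(1) smooth_fun_mono[OF assms(2) that(2)]
        vector_field_smooth[OF assms(3) that])
qed

text \<open>The terms that spoil the Leibniz rule for \<open>X Y\<close>, namely \<open>X f * Y h + Y f * X h\<close>, are symmetric in
  \<open>X\<close> and \<open>Y\<close>.\<close>

lemma lie_bracket_tangent:
  assumes W: "open W" "p \<in> W" and X: "vector_field A W X" and Y: "vector_field A W Y"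
  shows "lie_bracket A X Y p \<in> tangent_space A p"
proof -
  note s = vector_field_smooth_at[OF X W] vector_field_smooth_at[OF Y W]
  note t = vector_field_tangent[OF X W(2)] vector_field_tangent[OF Y W(2)]
  have inW: "\<forall>\<^sub>F q in nhds p. q \<in> W" by (rule eventually_nhds_in_open[OF W])
  have lin: "u (\<lambda>q. Z q (\<lambda>q. a * f q + b * h q)) = a * u (\<lambda>q. Z q f) + b * u (\<lambda>q. Z q h)"
    if f: "smooth_at A p f" and h: "smooth_at A p h" and u: "u \<in> tangent_space A p"
      and Z: "vector_field A W Z" for f h a b u Z
  proof -
    note zs = vector_field_smooth_at[OF Z W]
    have "\<forall>\<^sub>F q in nhds p. Z q (\<lambda>q. a * f q + b * h q) = a * Z q f + b * Z q h"
      using inW smooth_at_eventually[OF f] smooth_at_eventually[OF h]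
      by eventually_elim (rule tangent_lin[OF vector_field_tangent[OF Z]])
    from tangent_cong[OF u zs[OF smooth_at_lin[OF f h]] this] show ?thesis
      using tangent_lin[OF u zs[OF f] zs[OF h]] by simp
  qed
  have mul: "u (\<lambda>q. Z q (\<lambda>q. f q * h q))
      = f p * u (\<lambda>q. Z q h) + Z p h * u f + (h p * u (\<lambda>q. Z q f) + Z p f * u h)"
    if f: "smooth_at A p f" and h: "smooth_at A p h" and u: "u \<in> tangent_space A p"
      and Z: "vector_field A W Z" for f h u Z
  proof -
    note zs = vector_field_smooth_at[OF Z W]
    have "\<forall>\<^sub>F q in nhds p. Z q (\<lambda>q. f q * h q) = f q * Z q h + h q * Z q f"
      using inW smooth_at_eventually[OF f] smooth_at_eventually[OF h]
      by eventually_elim (rule tangent_mult[OF vector_field_tangent[OF Z]])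
    from tangent_cong[OF u zs[OF smooth_at_mult[OF f h]] this] show ?thesis
      by (simp add: tangent_add[OF u] tangent_mult[OF u] smooth_at_mult f h zs)
  qed
  show ?thesis
  proof (rule tangent_spaceI)
    fix f h assume f: "smooth_at A p f" and h: "smooth_at A p h"
    show "lie_bracket A X Y p (\<lambda>q. a * f q + b * h q) = a * lie_bracket A X Y p f + b * lie_bracket A X Y p h" for a b
      using f h by (simp add: lie_bracket_def smooth_at_lin lin[OF f h t(1) Y] lin[OF f h t(2) X] algebra_simps)
    show "lie_bracket A X Y p (\<lambda>q. f q * h q) = f p * lie_bracket A X Y p h + h p * lie_bracket A X Y p f"
      using f h by (simp add: lie_bracket_def smooth_at_mult mul[OF f h t(1) Y] mul[OF f h t(2) X] algebra_simps)
    assume ev: "\<forall>\<^sub>F q in nhds p. f q = h q"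
    have *: "\<forall>\<^sub>F q in nhds p. Z q f = Z q h" if Z: "vector_field A W Z" for Z
      using inW smooth_at_eventually[OF f] ev[unfolded eventually_eventually[of "\<lambda>q. f q = h q" p, symmetric]]
      by eventually_elim (rule tangent_cong[OF vector_field_tangent[OF Z]])
    show "lie_bracket A X Y p f = lie_bracket A X Y p h"
      using f h tangent_cong[OF t(1) s(2)[OF f] *[OF Y]] tangent_cong[OF t(2) s(1)[OF f] *[OF X]]
      by (simp add: lie_bracket_def)
  qed (simp add: lie_bracket_def)
qed

lemma lie_bracket_vector_field:
  assumes W: "open W" and X: "vector_field A W X" and Y: "vector_field A W Y"
  shows "vector_field A W (lie_bracket A X Y)"
proof (rule vector_fieldI)
  show "lie_bracket A X Y p \<in> tangent_space A p" if "p \<in> W" for p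
    by (rule lie_bracket_tangent[OF W that X Y])
  fix V f assume V: "open V" "V \<subseteq> W" and f: "smooth_fun A V f"
  show "smooth_fun A V (\<lambda>p. lie_bracket A X Y p f)"
    by (rule smooth_fun_cong[OF V(1) _ smooth_fun_diff[OF V(1)
            vector_field_smooth[OF X V vector_field_smooth[OF Y V f]]
            vector_field_smooth[OF Y V vector_field_smooth[OF X V f]]]])
      (simp add: lie_bracket_def smooth_atI[OF f V(1)])
qed

text \<open>The coordinate field \<open>\<partial>/\<partial>b\<close> of a chart. It is \<open>0\<close> on functions that are not smooth near the
  point, as tangent vectors are.\<close>

definition chart_field :: "'m set \<Rightarrow> ('m \<Rightarrow> 'e) \<Rightarrow> 'e \<Rightarrow> 'm vfield" where
  "chart_field U \<phi> b p f =
    (if smooth_at A p f then frechet_derivative (\<lambda>y. f (inv_into U \<phi> y)) (at (\<phi> p)) b else 0)"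

lemma chart_field_eqI:
  assumes "smooth_at A p f" "((\<lambda>y. f (inv_into U \<phi> y)) has_derivative d) (at (\<phi> p))"
  shows "chart_field U \<phi> b p f = d b"
  using frechet_derivative_at[OF assms(2)] assms(1) by (simp add: chart_field_def)

lemma chart_field_tangent:
  assumes c: "(U, \<phi>) \<in> A" "p \<in> U"
  shows "chart_field U \<phi> b p \<in> tangent_space A p"
proof (rule tangent_spaceI)
  have p: "inv_into U \<phi> (\<phi> p) = p" using chart_inj[OF c(1)] c(2) by simp
  note d = smooth_at_has_derivative[OF c]
  fix f h assume f: "smooth_at A p f" and h: "smooth_at A p h"
  have v: "chart_field U \<phi> b p g = frechet_derivative (\<lambda>y. g (inv_into U \<phi> y)) (at (\<phi> p)) b"
    if "smooth_at A p g" for g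
    using that by (simp add: chart_field_def)
  show "chart_field U \<phi> b p (\<lambda>q. x * f q + y * h q) = x * chart_field U \<phi> b p f + y * chart_field U \<phi> b p h" for x y
    using chart_field_eqI[OF smooth_at_lin[OF f h] has_derivative_add[OF
          has_derivative_mult_right[OF d[OF f]] has_derivative_mult_right[OF d[OF h]]]]
    by (simp add: v f h)
  show "chart_field U \<phi> b p (\<lambda>q. f q * h q) = f p * chart_field U \<phi> b p h + h p * chart_field U \<phi> b p f"
    using chart_field_eqI[OF smooth_at_mult[OF f h] has_derivative_mult[OF d[OF f] d[OF h]]]
    by (simp add: v f h p mult.commute)
  assume "\<forall>\<^sub>F q in nhds p. f q = h q"
  then obtain W where W: "open W" "p \<in> W" "\<And>q. q \<in> W \<Longrightarrow> f q = h q"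
    unfolding eventually_nhds by blast
  have "((\<lambda>y. h (inv_into U \<phi> y)) has_derivative
      frechet_derivative (\<lambda>y. f (inv_into U \<phi> y)) (at (\<phi> p))) (at (\<phi> p))"
    by (rule has_derivative_transform_within_open[OF d[OF f] chart_open_image[OF c(1) W(1)]])
      (use W c chart_inj[OF c(1)] in auto)
  from chart_field_eqI[OF h this] show "chart_field U \<phi> b p f = chart_field U \<phi> b p h"
    by (simp add: v f)
qed (simp add: chart_field_def)

lemma chart_field_vector_field:
  assumes c: "(U, \<phi>) \<in> A"
  shows "vector_field A U (chart_field U \<phi> b)"
proof (rule vector_fieldI)
  show "chart_field U \<phi> b p \<in> tangent_space A p" if "p \<in> U" for p
    by (rule chart_field_tangent[OF c that])
  fix V f assume V: "open V" "V \<subseteq> U" and f: "smooth_fun A V f"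
  have V_eq: "U \<inter> \<phi> -` (\<phi> ` (U \<inter> V)) = V"
    using V chart_inj[OF c] by (auto dest: inj_onD)
  have "smooth_fun A V (\<lambda>q. frechet_derivative (\<lambda>y. f (inv_into U \<phi> y)) (at (\<phi> q)) b)"
    using chart_pullback_smooth[OF c chart_open_image[OF c V(1)] smooth_on_derivative[OF smooth_funD[OF f c]], of b]
    unfolding V_eq .
  then show "smooth_fun A V (\<lambda>p. chart_field U \<phi> b p f)"
    by (rule smooth_fun_cong[OF V(1), rotated]) (simp add: chart_field_def smooth_atI[OF f V(1)])
qed

lemma chart_field_coordinate:
  assumes c: "(U, \<phi>) \<in> A" "p \<in> U"
  shows "chart_field U \<phi> b p (\<lambda>q. \<phi> q \<bullet> d) = b \<bullet> d"
proof -
  have "((\<lambda>y. y \<bullet> d) has_derivative (\<lambda>v. v \<bullet> d)) (at (\<phi> p))"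
    by (auto intro!: derivative_eq_intros)
  then have "((\<lambda>y. \<phi> (inv_into U \<phi> y) \<bullet> d) has_derivative (\<lambda>v. v \<bullet> d)) (at (\<phi> p))"
    by (rule has_derivative_transform_within_open[OF _ chart_open_range[OF c(1)]])
      (use c chart_inj[OF c(1)] in auto)
  from chart_field_eqI[OF chart_coordinate_smooth_at[OF c] this] show ?thesis .
qed

lemma tangent_chart_field:
  assumes c: "(U, \<phi>) \<in> A" "p \<in> U" and v: "v \<in> tangent_space A p"
  shows "v = (\<lambda>f. \<Sum>b\<in>Basis. v (\<lambda>q. \<phi> q \<bullet> b) * chart_field U \<phi> b p f)"
proof
  fix f
  show "v f = (\<Sum>b\<in>Basis. v (\<lambda>q. \<phi> q \<bullet> b) * chart_field U \<phi> b p f)"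
    using tangent_chart[OF c v, of f] tangent_nonsmooth[OF v, of f]
    by (cases "smooth_at A p f") (auto simp: chart_field_def)
qed

text \<open>The bracket is a tangent vector that kills all coordinate functions, because their derivatives
  along coordinate fields are constant.\<close>

lemma lie_bracket_chart_field:
  assumes c: "(U, \<phi>) \<in> A" "p \<in> U"
  shows "lie_bracket A (chart_field U \<phi> b) (chart_field U \<phi> d) p = (\<lambda>f. 0)"
proof -
  let ?L = "lie_bracket A (chart_field U \<phi> b) (chart_field U \<phi> d) p"
  have zero: "chart_field U \<phi> b' p (\<lambda>q. chart_field U \<phi> d' q (\<lambda>q. \<phi> q \<bullet> k)) = 0" for b' d' k
  proof -
    have "\<forall>\<^sub>F q in nhds p. d' \<bullet> k = chart_field U \<phi> d' q (\<lambda>q. \<phi> q \<bullet> k)"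
      using eventually_nhds_in_open[OF chart_open[OF c(1)] c(2)]
      by eventually_elim (simp add: chart_field_coordinate[OF c(1)])
    from tangent_cong[OF chart_field_tangent[OF c] smooth_at_const this] show ?thesis
      using tangent_const[OF chart_field_tangent[OF c]] by metis
  qed
  have coord: "?L (\<lambda>q. \<phi> q \<bullet> k) = 0" for k
    by (simp add: lie_bracket_def zero)
  note L = lie_bracket_tangent[OF chart_open[OF c(1)] c(2)
      chart_field_vector_field[OF c(1)] chart_field_vector_field[OF c(1)], of b d]
  have "?L f = (\<Sum>k\<in>Basis. ?L (\<lambda>q. \<phi> q \<bullet> k) * chart_field U \<phi> k p f)" for f
    by (rule fun_cong[OF tangent_chart_field[OF c L]])
  then show ?thesis unfolding coord by (simp add: fun_eq_iff)
qed

text \<open>The assumption on \<open>X\<close>, \<open>Y\<close> is \<open>d\<theta>(X,Y) = 0\<close> written without \<open>d\<close>. Applied to commuting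
  coordinate fields it is the hypothesis of the Poincare lemma for the coefficients of \<open>\<theta>\<close>.\<close>

lemma closed_form_has_local_primitive:
  fixes \<theta> :: "'m \<Rightarrow> 'm tvec \<Rightarrow> real"
  assumes lin: "\<And>q I v c. (\<And>i::'e. i \<in> I \<Longrightarrow> v i \<in> tangent_space A q) \<Longrightarrow> finite I \<Longrightarrow>
      \<theta> q (\<lambda>f. \<Sum>i\<in>I. c i * v i f) = (\<Sum>i\<in>I. c i * \<theta> q (v i))"
    and smooth: "\<And>W X. open W \<Longrightarrow> vector_field A W X \<Longrightarrow> smooth_fun A W (\<lambda>q. \<theta> q (X q))"
    and closed: "\<And>W X Y q. open W \<Longrightarrow> vector_field A W X \<Longrightarrow> vector_field A W Y \<Longrightarrow> q \<in> W \<Longrightarrow>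
      X q (\<lambda>r. \<theta> r (Y r)) - Y q (\<lambda>r. \<theta> r (X r)) = \<theta> q (lie_bracket A X Y q)"
  obtains W \<sigma> where "open W" "p \<in> W" "smooth_fun A W \<sigma>"
    "\<And>q v. q \<in> W \<Longrightarrow> v \<in> tangent_space A q \<Longrightarrow> v \<sigma> = \<theta> q v"
proof -
  obtain U \<phi> where c: "(U, \<phi>) \<in> A" "p \<in> U" by (rule chart_ex)
  note U = chart_open[OF c(1)] and inj = chart_inj[OF c(1)]
  let ?e = "chart_field U \<phi>"
  obtain r where r: "r > 0" "ball (\<phi> p) r \<subseteq> \<phi> ` U"
    using openE[OF chart_open_range[OF c(1)], of "\<phi> p"] c(2) by blast
  define a where "a b y = \<theta> (inv_into U \<phi> y) (?e b (inv_into U \<phi> y))" for b y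
  have \<theta>s: "smooth_fun A U (\<lambda>q. \<theta> q (?e b q))" for b
    by (rule smooth[OF U chart_field_vector_field[OF c(1)]])
  have as: "smooth_on (ball (\<phi> p) r) (a b)" for b
    unfolding a_def using smooth_on_subset[OF smooth_funD[OF \<theta>s c(1)], of "ball (\<phi> p) r"] r(2) by simp
  have da: "frechet_derivative (a d) (at (\<phi> q)) b = ?e b q (\<lambda>r. \<theta> r (?e d r))" if "q \<in> U" for b d q
    using smooth_atI[OF \<theta>s U that] by (simp add: chart_field_def a_def[abs_def])
  have "frechet_derivative (a d) (at y) b = frechet_derivative (a b) (at y) d"
    if y: "y \<in> ball (\<phi> p) r" for b d y
  proof -
    obtain q where q: "q \<in> U" "y = \<phi> q" using subsetD[OF r(2) y] by blast
    have "\<theta> q (\<lambda>f. 0) = 0" using lin[of "{}"] by simp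
    then show ?thesis
      using closed[OF U chart_field_vector_field[OF c(1)] chart_field_vector_field[OF c(1)] q(1), of b d]
      by (simp add: lie_bracket_chart_field[OF c(1) q(1)] da[OF q(1)] q(2))
  qed
  then obtain s where s: "smooth_on (ball (\<phi> p) r) s"
    "\<And>b y. b \<in> Basis \<Longrightarrow> y \<in> ball (\<phi> p) r \<Longrightarrow> frechet_derivative s (at y) b = a b y"
    using poincare_ball[of "\<phi> p" r a] as by blast
  let ?W = "U \<inter> \<phi> -` ball (\<phi> p) r"
  show thesis
  proof
    show W: "open ?W" by (rule chart_open_preimage[OF c(1) open_ball])
    show "p \<in> ?W" using c(2) r(1) by simp
    show \<sigma>: "smooth_fun A ?W (\<lambda>q. s (\<phi> q))" by (rule chart_pullback_smooth[OF c(1) open_ball s(1)])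
    fix q v assume q: "q \<in> ?W" and v: "v \<in> tangent_space A q"
    have cq: "(U, \<phi>) \<in> A" "q \<in> U" using c(1) q by auto
    have e: "?e b q (\<lambda>q. s (\<phi> q)) = \<theta> q (?e b q)" if "b \<in> Basis" for b
    proof -
      have "((\<lambda>y. s (\<phi> (inv_into U \<phi> y))) has_derivative frechet_derivative s (at (\<phi> q))) (at (\<phi> q))"
        by (rule has_derivative_transform_within_open[OF smooth_on_has_derivative[OF s(1)] open_ball])
          (use q r(2) inj in \<open>auto simp: subset_iff f_inv_into_f\<close>)
      from chart_field_eqI[OF smooth_atI[OF \<sigma> W q] this] show ?thesis
        using q s(2)[OF that] inj by (simp add: a_def)
    qed
    have "v (\<lambda>q. s (\<phi> q)) = (\<Sum>b\<in>Basis. v (\<lambda>q. \<phi> q \<bullet> b) * ?e b q (\<lambda>q. s (\<phi> q)))"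
      by (rule fun_cong[OF tangent_chart_field[OF cq v]])
    also have "\<dots> = (\<Sum>b\<in>Basis. v (\<lambda>q. \<phi> q \<bullet> b) * \<theta> q (?e b q))"
      by (simp add: e)
    also have "\<dots> = \<theta> q (\<lambda>f. \<Sum>b\<in>Basis. v (\<lambda>q. \<phi> q \<bullet> b) * ?e b q f)"
      by (rule lin[OF chart_field_tangent[OF cq] finite_Basis, symmetric])
    also have "\<dots> = \<theta> q v" using tangent_chart_field[OF cq v] by metis
    finally show "v (\<lambda>q. s (\<phi> q)) = \<theta> q v" .
  qed
qed

end

section \<open>Orthonormal frames with constant structure coefficients\<close>

lemma bilinear_coords:
  fixes B :: "real^'n \<Rightarrow> real^'n \<Rightarrow> 'b::real_vector"
  assumes "bilinear B"
  shows "B u v = (\<Sum>i\<in>UNIV. \<Sum>j\<in>UNIV. (u $ i * v $ j) *\<^sub>R B (axis i 1) (axis j 1))"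
proof -
  have l: "linear (\<lambda>u. B u v)" for v
    using assms by (simp add: bilinear_def)
  have r: "linear (B u)" for u
    using assms by (simp add: bilinear_def)
  have e: "u = (\<Sum>i\<in>UNIV. u $ i *\<^sub>R axis i 1)" for u :: "real^'n"
    using basis_expansion[of u] by (simp add: scalar_mult_eq_scaleR)
  have "B u v = (\<Sum>i\<in>UNIV. u $ i *\<^sub>R B (axis i 1) v)"
    by (subst e[of u]) (simp only: linear_sum[OF l] linear_cmul[OF l])
  also have "\<dots> = (\<Sum>i\<in>UNIV. \<Sum>j\<in>UNIV. (u $ i * v $ j) *\<^sub>R B (axis i 1) (axis j 1))"
    by (subst e[of v]) (simp only: linear_sum[OF r] linear_cmul[OF r] scaleR_sum_right scaleR_scaleR)
  finally show ?thesis .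
qed

lemma bilinear_coords_nth:
  fixes B :: "real^'n \<Rightarrow> real^'n \<Rightarrow> real^'n"
  assumes "bilinear B"
  shows "B u v $ k = (\<Sum>i\<in>UNIV. \<Sum>j\<in>UNIV. B (axis i 1) (axis j 1) $ k * (u $ i * v $ j))"
  by (subst bilinear_coords[OF assms]) (simp add: sum_component mult.commute)

text \<open>The constant structure coefficients of the frame are encoded by a bilinear bracket \<open>C\<close> on
  coefficient vectors; for left invariant fields this is the bracket of the Lie algebra.\<close>

locale orthonormal_frame = smooth_manifold A
  for A :: "('m::topological_space, 'e::euclidean_space) atlas" +
  fixes x :: "'n::finite \<Rightarrow> 'm vfield" and g :: "'m metric" and C :: "real^'n \<Rightarrow> real^'n \<Rightarrow> real^'n"
  assumes frame: "global_frame A x"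
    and metric: "riemannian_metric A UNIV g"
    and orthonormal: "g p (x i p) (x j p) = (if i = j then 1 else 0)"
    and bilinear_C: "bilinear C"
    and bracket: "lie_bracket A (x i) (x j) p f = (\<Sum>k\<in>UNIV. C (axis i 1) (axis j 1) $ k * x k p f)"
begin

definition comp :: "'m \<Rightarrow> 'm tvec \<Rightarrow> real^'n" where
  "comp p v = (\<chi> k. g p v (x k p))"

definition of_comp :: "'m \<Rightarrow> real^'n \<Rightarrow> 'm tvec" where
  "of_comp p c = (\<lambda>f. \<Sum>k\<in>UNIV. c $ k * x k p f)"

definition vderiv :: "'m tvec \<Rightarrow> ('m \<Rightarrow> real^'n) \<Rightarrow> real^'n" where
  "vderiv v h = (\<chi> k. v (\<lambda>q. h q $ k))"

text \<open>The connection whose covariant derivatives in the frame are constant, with \<open>\<Gamma>\<close> in the role of the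
  Christoffel symbols.\<close>

definition conn :: "(real^'n \<Rightarrow> real^'n \<Rightarrow> real^'n) \<Rightarrow> 'm connection" where
  "conn \<Gamma> X Y p =
    of_comp p (vderiv (X p) (\<lambda>q. comp q (Y q)) + \<Gamma> (comp p (X p)) (comp p (Y p)))"

lemma frame_vector_field: "vector_field A UNIV (x i)"
  using frame by (simp add: global_frame_def)

lemma frame_tangent: "x i p \<in> tangent_space A p"
  by (rule vector_field_tangent[OF frame_vector_field UNIV_I])

lemma of_comp_tangent: "of_comp p c \<in> tangent_space A p"
  unfolding of_comp_def by (rule tangent_space_lincomb[OF frame_tangent])

lemma metric_lin:
  "u \<in> tangent_space A p \<Longrightarrow> v \<in> tangent_space A p \<Longrightarrow> w \<in> tangent_space A p \<Longrightarrow>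
    g p (\<lambda>f. a * u f + b * v f) w = a * g p u w + b * g p v w"
  using metric unfolding riemannian_metric_def by (elim conjE) simp

lemma metric_sym:
  "v \<in> tangent_space A p \<Longrightarrow> w \<in> tangent_space A p \<Longrightarrow> g p v w = g p w v"
  using metric unfolding riemannian_metric_def by (elim conjE) blast

lemma metric_smooth:
  "open W \<Longrightarrow> vector_field A W X \<Longrightarrow> vector_field A W Y \<Longrightarrow> smooth_fun A W (\<lambda>p. g p (X p) (Y p))"
  using metric unfolding riemannian_metric_def by (elim conjE) simp

lemma metric_sum:
  assumes "w \<in> tangent_space A p" "finite I"
  shows "(\<And>i. i \<in> I \<Longrightarrow> v i \<in> tangent_space A p) \<Longrightarrow>
    g p (\<lambda>f. \<Sum>i\<in>I. c i * v i f) w = (\<Sum>i\<in>I. c i * g p (v i) w)"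
  using assms(2)
proof (induction I rule: finite_induct)
  case empty
  show ?case using metric_lin[OF tangent_zero tangent_zero assms(1), of 0 0] by simp
next
  case (insert i I)
  have "(\<lambda>f. \<Sum>j\<in>I. c j * v j f) \<in> tangent_space A p"
    by (rule tangent_space_lincomb) (use insert.prems in auto)
  from metric_lin[OF _ this assms(1), of "v i" "c i" 1] show ?case
    using insert by simp
qed

lemma comp_lincomb:
  assumes "finite I" "\<And>i. i \<in> I \<Longrightarrow> v i \<in> tangent_space A p"
  shows "comp p (\<lambda>f. \<Sum>i\<in>I. c i * v i f) = (\<Sum>i\<in>I. c i *\<^sub>R comp p (v i))"
  using metric_sum[OF frame_tangent assms] by (simp add: comp_def vec_eq_iff sum_component)

lemma comp_lin:
  assumes "u \<in> tangent_space A p" "v \<in> tangent_space A p"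
  shows "comp p (\<lambda>f. a * u f + b * v f) = a *\<^sub>R comp p u + b *\<^sub>R comp p v"
  using metric_lin[OF assms frame_tangent] by (simp add: comp_def vec_eq_iff)

lemma comp_frame: "comp p (x i p) = axis i 1"
  by (simp add: comp_def vec_eq_iff axis_def orthonormal)

lemma comp_of_comp: "comp p (of_comp p c) = c"
proof -
  have "comp p (of_comp p c) = (\<Sum>k\<in>UNIV. c $ k *\<^sub>R axis k 1)"
    unfolding of_comp_def by (simp only: comp_lincomb[OF finite frame_tangent] comp_frame)
  then show ?thesis using basis_expansion[of c] by (simp add: scalar_mult_eq_scaleR)
qed

lemma of_comp_comp:
  assumes v: "v \<in> tangent_space A p"
  shows "of_comp p (comp p v) = v"
proof -
  obtain c where "v = (\<lambda>f. \<Sum>i\<in>UNIV. c i * x i p f)"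
    using frame v unfolding global_frame_def by metis
  then have "v = of_comp p (\<chi> i. c i)" by (simp add: of_comp_def)
  then show ?thesis using comp_of_comp by metis
qed

lemma of_comp_add: "of_comp p (a + b) = (\<lambda>f. of_comp p a f + of_comp p b f)"
  by (simp add: of_comp_def sum.distrib algebra_simps)

lemma of_comp_diff: "of_comp p (a - b) = (\<lambda>f. of_comp p a f - of_comp p b f)"
  by (simp add: of_comp_def sum_subtractf algebra_simps)

lemma of_comp_scaleR: "of_comp p (c *\<^sub>R a) = (\<lambda>f. c * of_comp p a f)"
  by (simp add: of_comp_def sum_distrib_left mult.assoc)

lemma of_comp_zero: "of_comp p 0 = (\<lambda>f. 0)"
  by (simp add: of_comp_def)

lemma metric_comp:
  assumes "v \<in> tangent_space A p" "w \<in> tangent_space A p"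
  shows "g p v w = comp p v \<bullet> comp p w"
proof -
  have "g p (of_comp p (comp p v)) w = (\<Sum>k\<in>UNIV. comp p v $ k * g p (x k p) w)"
    unfolding of_comp_def by (rule metric_sum[OF assms(2) finite frame_tangent])
  also have "\<dots> = comp p v \<bullet> comp p w"
    by (simp add: inner_vec_def comp_def metric_sym[OF assms(2) frame_tangent])
  finally show ?thesis by (simp only: of_comp_comp[OF assms(1)])
qed

lemma comp_smooth:
  "open W \<Longrightarrow> vector_field A W X \<Longrightarrow> smooth_fun A W (\<lambda>q. comp q (X q) $ k)"
  using metric_smooth[OF _ _ vector_field_mono[OF frame_vector_field subset_UNIV], of W X k]
  by (simp add: comp_def)

lemma comp_smooth_at:
  "open W \<Longrightarrow> p \<in> W \<Longrightarrow> vector_field A W X \<Longrightarrow> smooth_at A p (\<lambda>q. comp q (X q) $ k)"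
  by (rule smooth_atI[OF comp_smooth])

lemma of_comp_vector_field:
  assumes "open W" "\<And>k. smooth_fun A W (\<lambda>q. c q $ k)"
  shows "vector_field A W (\<lambda>p. of_comp p (c p))"
  unfolding of_comp_def
  by (rule vector_field_lincomb[OF assms vector_field_mono[OF frame_vector_field subset_UNIV]])

section \<open>Differentiating component functions\<close>

lemma vderiv_add:
  assumes "v \<in> tangent_space A p" "\<And>k. smooth_at A p (\<lambda>q. a q $ k)" "\<And>k. smooth_at A p (\<lambda>q. b q $ k)"
  shows "vderiv v (\<lambda>q. a q + b q) = vderiv v a + vderiv v b"
  by (simp add: vderiv_def vec_eq_iff tangent_add[OF assms])

lemma vderiv_cong:
  assumes v: "v \<in> tangent_space A p" and a: "\<And>k. smooth_at A p (\<lambda>q. a q $ k)"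
    and W: "open W" "p \<in> W" "\<And>q. q \<in> W \<Longrightarrow> a q = b q"
  shows "vderiv v a = vderiv v b"
proof -
  have "v (\<lambda>q. a q $ k) = v (\<lambda>q. b q $ k)" for k
  proof (rule tangent_cong[OF v a])
    show "\<forall>\<^sub>F q in nhds p. a q $ k = b q $ k"
      using eventually_nhds_in_open[OF W(1,2)] by eventually_elim (simp add: W(3))
  qed
  then show ?thesis by (simp add: vderiv_def vec_eq_iff)
qed

lemma vderiv_scale:
  assumes v: "v \<in> tangent_space A p" and "smooth_at A p h" "\<And>k. smooth_at A p (\<lambda>q. a q $ k)"
  shows "vderiv v (\<lambda>q. h q *\<^sub>R a q) = v h *\<^sub>R a p + h p *\<^sub>R vderiv v a"
  by (simp add: vderiv_def vec_eq_iff tangent_mult[OF assms] mult.commute)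

lemma vderiv_const: "v \<in> tangent_space A p \<Longrightarrow> vderiv v (\<lambda>q. c) = 0"
  by (simp add: vderiv_def vec_eq_iff tangent_const)

lemma tangent_bilinear_form:
  fixes b :: "'n \<Rightarrow> 'n \<Rightarrow> real"
  assumes v: "v \<in> tangent_space A p" and u: "\<And>k. smooth_at A p (\<lambda>q. u q $ k)"
    and w: "\<And>k. smooth_at A p (\<lambda>q. w q $ k)"
  shows "v (\<lambda>q. \<Sum>i\<in>UNIV. \<Sum>j\<in>UNIV. b i j * (u q $ i * w q $ j))
    = (\<Sum>i\<in>UNIV. \<Sum>j\<in>UNIV. b i j * (vderiv v u $ i * w p $ j))
      + (\<Sum>i\<in>UNIV. \<Sum>j\<in>UNIV. b i j * (u p $ i * vderiv v w $ j))"
proof -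
  have s: "smooth_at A p (\<lambda>q. u q $ i * w q $ j)" for i j by (rule smooth_at_mult[OF u w])
  have "v (\<lambda>q. \<Sum>i\<in>UNIV. \<Sum>j\<in>UNIV. b i j * (u q $ i * w q $ j))
      = (\<Sum>i\<in>UNIV. v (\<lambda>q. \<Sum>j\<in>UNIV. b i j * (u q $ i * w q $ j)))"
    by (rule tangent_sum[OF v smooth_at_sum[OF smooth_at_cmult[OF s]]])
  also have "\<dots> = (\<Sum>i\<in>UNIV. \<Sum>j\<in>UNIV. v (\<lambda>q. b i j * (u q $ i * w q $ j)))"
    by (rule sum.cong[OF refl tangent_sum[OF v smooth_at_cmult[OF s]]])
  also have "\<dots> = (\<Sum>i\<in>UNIV. \<Sum>j\<in>UNIV. b i j * (vderiv v u $ i * w p $ j) + b i j * (u p $ i * vderiv v w $ j))"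
    by (intro sum.cong refl, subst tangent_cmult[OF v s], subst tangent_mult[OF v u w])
      (simp add: vderiv_def algebra_simps)
  finally show ?thesis by (simp only: sum.distrib)
qed

lemma smooth_fun_bilinear:
  fixes B :: "real^'n \<Rightarrow> real^'n \<Rightarrow> real^'n"
  assumes "bilinear B" and W: "open W" and u: "\<And>k. smooth_fun A W (\<lambda>q. u q $ k)"
    and w: "\<And>k. smooth_fun A W (\<lambda>q. w q $ k)"
  shows "smooth_fun A W (\<lambda>q. B (u q) (w q) $ k)"
  unfolding bilinear_coords_nth[OF assms(1), of "u _"]
  by (rule smooth_fun_sum[OF W smooth_fun_sum[OF W smooth_fun_mult[OF W smooth_fun_const[OF W]
          smooth_fun_mult[OF W u w]]]])

lemma smooth_at_bilinear:
  fixes B :: "real^'n \<Rightarrow> real^'n \<Rightarrow> real^'n"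
  assumes "bilinear B" and u: "\<And>k. smooth_at A p (\<lambda>q. u q $ k)"
    and w: "\<And>k. smooth_at A p (\<lambda>q. w q $ k)"
  shows "smooth_at A p (\<lambda>q. B (u q) (w q) $ k)"
  unfolding bilinear_coords_nth[OF assms(1), of "u _"]
  by (rule smooth_at_sum[OF smooth_at_sum[OF smooth_at_cmult[OF smooth_at_mult[OF u w]]]])

lemma vderiv_bilinear:
  fixes B :: "real^'n \<Rightarrow> real^'n \<Rightarrow> real^'n"
  assumes B: "bilinear B" and v: "v \<in> tangent_space A p" and u: "\<And>k. smooth_at A p (\<lambda>q. u q $ k)"
    and w: "\<And>k. smooth_at A p (\<lambda>q. w q $ k)"
  shows "vderiv v (\<lambda>q. B (u q) (w q)) = B (vderiv v u) (w p) + B (u p) (vderiv v w)"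
proof -
  have "vderiv v (\<lambda>q. B (u q) (w q)) $ k
      = v (\<lambda>q. \<Sum>i\<in>UNIV. \<Sum>j\<in>UNIV. B (axis i 1) (axis j 1) $ k * (u q $ i * w q $ j))" for k
    by (simp only: vderiv_def vec_lambda_beta bilinear_coords_nth[OF B, of "u _"])
  also have "\<dots> k = B (vderiv v u) (w p) $ k + B (u p) (vderiv v w) $ k" for k
    by (simp only: tangent_bilinear_form[OF v u w] bilinear_coords_nth[OF B, of "vderiv v u"]
        bilinear_coords_nth[OF B, of "u p"])
  finally show ?thesis by (simp only: vec_eq_iff vector_add_component simp_thms)
qed

lemma tangent_inner:
  assumes v: "v \<in> tangent_space A p" and u: "\<And>k. smooth_at A p (\<lambda>q. u q $ k)"
    and w: "\<And>k. smooth_at A p (\<lambda>q. w q $ k)"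
  shows "v (\<lambda>q. u q \<bullet> w q) = vderiv v u \<bullet> w p + u p \<bullet> vderiv v w"
proof -
  have "v (\<lambda>q. \<Sum>k\<in>UNIV. u q $ k * w q $ k) = (\<Sum>k\<in>UNIV. v (\<lambda>q. u q $ k * w q $ k))"
    by (rule tangent_sum[OF v smooth_at_mult[OF u w]])
  also have "\<dots> = (\<Sum>k\<in>UNIV. u p $ k * vderiv v w $ k + w p $ k * vderiv v u $ k)"
    by (rule sum.cong[OF refl]) (simp add: tangent_mult[OF v u w] vderiv_def)
  finally show ?thesis by (simp add: inner_vec_def sum.distrib mult.commute add.commute)
qed

lemma smooth_at_inner:
  assumes "\<And>k. smooth_at A p (\<lambda>q. u q $ k)" "\<And>k. smooth_at A p (\<lambda>q. w q $ k)"
  shows "smooth_at A p (\<lambda>q. u q \<bullet> (w q :: real^'n))"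
  unfolding inner_vec_def inner_real_def by (rule smooth_at_sum[OF smooth_at_mult[OF assms]])

text \<open>On frame fields only the last term is present; in general the Leibniz rule adds the derivatives of
  the coefficients, while the second derivatives \<open>x\<^sub>i (x\<^sub>k f)\<close> combine to brackets of frame fields.\<close>

lemma comp_lie_bracket:
  assumes W: "open W" "p \<in> W" and X: "vector_field A W X" and Y: "vector_field A W Y"
  shows "comp p (lie_bracket A X Y p) = vderiv (X p) (\<lambda>q. comp q (Y q))
    - vderiv (Y p) (\<lambda>q. comp q (X q)) + C (comp p (X p)) (comp p (Y p))" (is "_ = ?c")
proof -
  have snd: "Z p (\<lambda>q. Z' q f) = (\<Sum>k\<in>UNIV. vderiv (Z p) (\<lambda>q. comp q (Z' q)) $ k * x k p f)
      + (\<Sum>k\<in>UNIV. \<Sum>i\<in>UNIV. (comp p (Z' p) $ k * comp p (Z p) $ i) * x i p (\<lambda>q. x k q f))"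
    if Z: "vector_field A W Z" and Z': "vector_field A W Z'" and f: "smooth_at A p f" for Z Z' f
  proof -
    note v = vector_field_tangent[OF Z W(2)]
    note cs = comp_smooth_at[OF W Z'] and xs = vector_field_smooth_at[OF frame_vector_field open_UNIV UNIV_I f]
    have "Z' q f = (\<Sum>k\<in>UNIV. comp q (Z' q) $ k * x k q f)" if "q \<in> W" for q
      using fun_cong[OF of_comp_comp[OF vector_field_tangent[OF Z' that]], of f] by (simp add: of_comp_def)
    then have "\<forall>\<^sub>F q in nhds p. Z' q f = (\<Sum>k\<in>UNIV. comp q (Z' q) $ k * x k q f)"
      using eventually_nhds_in_open[OF W] by (rule eventually_mono[rotated])
    from tangent_cong[OF v vector_field_smooth_at[OF Z' W f] this]
    have "Z p (\<lambda>q. Z' q f) = Z p (\<lambda>q. \<Sum>k\<in>UNIV. comp q (Z' q) $ k * x k q f)" .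
    also have "\<dots> = (\<Sum>k\<in>UNIV. Z p (\<lambda>q. comp q (Z' q) $ k * x k q f))"
      by (rule tangent_sum[OF v smooth_at_mult[OF cs xs]])
    also have "\<dots> = (\<Sum>k\<in>UNIV. vderiv (Z p) (\<lambda>q. comp q (Z' q)) $ k * x k p f
        + (\<Sum>i\<in>UNIV. (comp p (Z' p) $ k * comp p (Z p) $ i) * x i p (\<lambda>q. x k q f)))"
    proof (rule sum.cong[OF refl])
      fix k
      have "Z p (\<lambda>q. x k q f) = (\<Sum>i\<in>UNIV. comp p (Z p) $ i * x i p (\<lambda>q. x k q f))"
        using fun_cong[OF of_comp_comp[OF v], of "\<lambda>q. x k q f"] by (simp add: of_comp_def)
      then show "Z p (\<lambda>q. comp q (Z' q) $ k * x k q f) = vderiv (Z p) (\<lambda>q. comp q (Z' q)) $ k * x k p f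
        + (\<Sum>i\<in>UNIV. (comp p (Z' p) $ k * comp p (Z p) $ i) * x i p (\<lambda>q. x k q f))"
        unfolding tangent_mult[OF v cs xs] by (simp add: vderiv_def sum_distrib_left mult.assoc)
    qed
    finally show ?thesis by (simp only: sum.distrib)
  qed
  have "lie_bracket A X Y p f = of_comp p ?c f" for f
  proof (cases "smooth_at A p f")
    case False
    then show ?thesis
      using tangent_nonsmooth[OF of_comp_tangent] by (simp add: lie_bracket_def)
  next
    case True
    let ?a = "comp p (X p)" and ?b = "comp p (Y p)"
    let ?x = "\<lambda>i k. x i p (\<lambda>q. x k q f)"
    have "(\<Sum>k\<in>UNIV. \<Sum>i\<in>UNIV. (?b $ k * ?a $ i) * ?x i k) - (\<Sum>k\<in>UNIV. \<Sum>i\<in>UNIV. (?a $ k * ?b $ i) * ?x i k)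
        = (\<Sum>i\<in>UNIV. \<Sum>k\<in>UNIV. (?a $ i * ?b $ k) * (?x i k - ?x k i))"
      by (subst sum.swap) (simp add: sum_subtractf[symmetric] algebra_simps)
    also have "\<dots> = (\<Sum>i\<in>UNIV. \<Sum>k\<in>UNIV. (?a $ i * ?b $ k) * (\<Sum>l\<in>UNIV. C (axis i 1) (axis k 1) $ l * x l p f))"
      using bracket[of _ _ p f] True by (simp add: lie_bracket_def)
    also have "\<dots> = (\<Sum>i\<in>UNIV. \<Sum>l\<in>UNIV. \<Sum>k\<in>UNIV. C (axis i 1) (axis k 1) $ l * (?a $ i * ?b $ k) * x l p f)"
      by (subst sum.swap) (simp add: sum_distrib_left mult_ac)
    also have "\<dots> = (\<Sum>l\<in>UNIV. \<Sum>i\<in>UNIV. \<Sum>k\<in>UNIV. C (axis i 1) (axis k 1) $ l * (?a $ i * ?b $ k) * x l p f)"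
      by (rule sum.swap)
    also have "\<dots> = of_comp p (C ?a ?b) f"
      unfolding of_comp_def bilinear_coords_nth[OF bilinear_C, of ?a ?b] by (simp only: sum_distrib_right)
    finally show ?thesis
      using True unfolding of_comp_add of_comp_diff
      by (simp add: lie_bracket_def snd[OF X Y] snd[OF Y X]) (simp add: of_comp_def)
  qed
  then have "lie_bracket A X Y p = of_comp p ?c" by blast
  then show ?thesis by (simp only: comp_of_comp)
qed

section \<open>Connections with constant coefficients\<close>

lemma comp_conn:
  "comp p (conn \<Gamma> X Y p) = vderiv (X p) (\<lambda>q. comp q (Y q)) + \<Gamma> (comp p (X p)) (comp p (Y p))"
  by (simp only: conn_def comp_of_comp)

lemma vderiv_field_smooth:
  assumes W: "open W" and X: "vector_field A W X" and Y: "vector_field A W Y"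
  shows "smooth_fun A W (\<lambda>q. vderiv (X q) (\<lambda>r. comp r (Y r)) $ k)"
  using vector_field_smooth[OF X W order_refl comp_smooth[OF W Y]] by (simp add: vderiv_def)

lemma conn_vector_field:
  assumes \<Gamma>: "bilinear \<Gamma>" and W: "open W" and X: "vector_field A W X" and Y: "vector_field A W Y"
  shows "vector_field A W (conn \<Gamma> X Y)"
  unfolding conn_def
  by (rule of_comp_vector_field[OF W], unfold vector_add_component)
    (rule smooth_fun_add[OF W vderiv_field_smooth[OF W X Y]
        smooth_fun_bilinear[OF \<Gamma> W comp_smooth[OF W X] comp_smooth[OF W Y]]])

lemma vderiv_lie_bracket:
  assumes "\<And>k. smooth_at A p (\<lambda>q. c q $ k)"
  shows "vderiv (lie_bracket A X Y p) c
    = vderiv (X p) (\<lambda>q. vderiv (Y q) c) - vderiv (Y p) (\<lambda>q. vderiv (X q) c)"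
  using assms by (simp add: vderiv_def vec_eq_iff lie_bracket_def)

text \<open>The curvature is a tensor: all derivatives of the coefficients of \<open>X\<close>, \<open>Y\<close>, \<open>Z\<close> cancel, the second
  ones by the definition of the bracket, the first ones between the Leibniz terms and the formula
  for \<open>[X, Y]\<close>. What remains is the value on frame fields. Taking any \<open>D\<close> that agrees with \<open>conn \<Gamma>\<close>
  on an open set covers both a given Levi-Civita connection and a locally constructed one.\<close>

lemma curvature_conn:
  assumes \<Gamma>: "bilinear \<Gamma>" and W: "open W" "p \<in> W"
    and D: "\<And>X Y q. vector_field A W X \<Longrightarrow> vector_field A W Y \<Longrightarrow> q \<in> W \<Longrightarrow> D X Y q = conn \<Gamma> X Y q"
    and Dvf: "\<And>X Y. vector_field A W X \<Longrightarrow> vector_field A W Y \<Longrightarrow> vector_field A W (D X Y)"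
    and X: "vector_field A W X" and Y: "vector_field A W Y" and Z: "vector_field A W Z"
  defines "a \<equiv> comp p (X p)" and "b \<equiv> comp p (Y p)" and "c \<equiv> comp p (Z p)"
  shows "curvature_op A D X Y Z p = of_comp p (\<Gamma> a (\<Gamma> b c) - \<Gamma> b (\<Gamma> a c) - \<Gamma> (C a b) c)"
proof -
  let ?Z = "\<lambda>q. comp q (Z q)"
  have l: "linear (\<lambda>u. \<Gamma> u v)" and r: "linear (\<Gamma> v)" for v
    using \<Gamma> by (simp_all add: bilinear_def)
  note Zs = comp_smooth_at[OF W Z]
  have second: "comp p (D X' (D Y' Z) p) = vderiv (X' p) (\<lambda>q. vderiv (Y' q) ?Z)
      + (\<Gamma> (vderiv (X' p) (\<lambda>q. comp q (Y' q))) c + \<Gamma> (comp p (Y' p)) (vderiv (X' p) ?Z))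
      + \<Gamma> (comp p (X' p)) (vderiv (Y' p) ?Z + \<Gamma> (comp p (Y' p)) c)"
    if X': "vector_field A W X'" and Y': "vector_field A W Y'" for X' Y'
  proof -
    note v = vector_field_tangent[OF X' W(2)]
    have DYZ: "comp q (D Y' Z q) = vderiv (Y' q) ?Z + \<Gamma> (comp q (Y' q)) (?Z q)" if "q \<in> W" for q
      by (simp only: D[OF Y' Z that] comp_conn)
    have "vderiv (X' p) (\<lambda>q. comp q (D Y' Z q))
        = vderiv (X' p) (\<lambda>q. vderiv (Y' q) ?Z + \<Gamma> (comp q (Y' q)) (?Z q))"
      by (rule vderiv_cong[OF v comp_smooth_at[OF W Dvf[OF Y' Z]] W DYZ])
    also have "\<dots> = vderiv (X' p) (\<lambda>q. vderiv (Y' q) ?Z) + vderiv (X' p) (\<lambda>q. \<Gamma> (comp q (Y' q)) (?Z q))"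
      by (rule vderiv_add[OF v smooth_atI[OF vderiv_field_smooth[OF W(1) Y' Z] W]
            smooth_at_bilinear[OF \<Gamma> comp_smooth_at[OF W Y'] Zs]])
    also have "vderiv (X' p) (\<lambda>q. \<Gamma> (comp q (Y' q)) (?Z q))
        = \<Gamma> (vderiv (X' p) (\<lambda>q. comp q (Y' q))) c + \<Gamma> (comp p (Y' p)) (vderiv (X' p) ?Z)"
      unfolding c_def by (rule vderiv_bilinear[OF \<Gamma> v comp_smooth_at[OF W Y'] Zs])
    finally show ?thesis
      by (simp only: D[OF X' Dvf[OF Y' Z] W(2)] comp_conn DYZ[OF W(2)] c_def)
  qed
  have dir: "D X' Y' p = of_comp p (comp p (D X' Y' p))"
    if "vector_field A W X'" "vector_field A W Y'" for X' Y'
    by (rule of_comp_comp[OF vector_field_tangent[OF Dvf[OF that] W(2)], symmetric])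
  note B = lie_bracket_vector_field[OF W(1) X Y]
  have third: "comp p (D (lie_bracket A X Y) Z p) = vderiv (X p) (\<lambda>q. vderiv (Y q) ?Z)
      - vderiv (Y p) (\<lambda>q. vderiv (X q) ?Z) + \<Gamma> (vderiv (X p) (\<lambda>q. comp q (Y q))
      - vderiv (Y p) (\<lambda>q. comp q (X q)) + C a b) c"
    by (simp only: D[OF B Z W(2)] comp_conn vderiv_lie_bracket[OF Zs] comp_lie_bracket[OF W X Y] a_def b_def c_def)
  have "curvature_op A D X Y Z p = of_comp p (comp p (D X (D Y Z) p) - comp p (D Y (D X Z) p)
      - comp p (D (lie_bracket A X Y) Z p))"
    unfolding curvature_op_def vdiff_def of_comp_diff dir[OF X Dvf[OF Y Z], symmetric]
      dir[OF Y Dvf[OF X Z], symmetric] dir[OF B Z, symmetric] ..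
  also have "comp p (D X (D Y Z) p) - comp p (D Y (D X Z) p) - comp p (D (lie_bracket A X Y) Z p)
      = \<Gamma> a (\<Gamma> b c) - \<Gamma> b (\<Gamma> a c) - \<Gamma> (C a b) c"
    unfolding second[OF X Y] second[OF Y X] third a_def[symmetric] b_def[symmetric] c_def[symmetric]
    by (simp add: linear_add[OF l] linear_diff[OF l] linear_add[OF r])
  finally show ?thesis .
qed

end

section \<open>The Levi-Civita connection in a frame\<close>

context smooth_manifold
begin

lemma vector_field_vmult:
  assumes "open W" "smooth_fun A W h" "vector_field A W X"
  shows "vector_field A W (vmult h X)"
  using vector_field_lincomb[of W "{()}" "\<lambda>_. h" "\<lambda>_. X"] assms by (simp add: vmult_def)

lemma affine_connection_vector_field:
  assumes "affine_connection A W D" "vector_field A W X" "vector_field A W Y"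
  shows "vector_field A W (D X Y)"
proof -
  have "\<forall>X Y. vector_field A W X \<longrightarrow> vector_field A W Y \<longrightarrow> vector_field A W (D X Y)"
    using assms(1) unfolding affine_connection_def by (elim conjE)
  then show ?thesis using assms(2,3) by blast
qed

lemma affine_connection_sum_right:
  assumes D: "affine_connection A W D" and W: "open W" and X: "vector_field A W X" and p: "p \<in> W"
  shows "finite I \<Longrightarrow> (\<And>k. k \<in> I \<Longrightarrow> smooth_fun A W (h k)) \<Longrightarrow> (\<And>k. k \<in> I \<Longrightarrow> vector_field A W (e k)) \<Longrightarrow>
    D X (\<lambda>p f. \<Sum>k\<in>I. h k p * e k p f) p
      = (\<lambda>f. \<Sum>k\<in>I. X p (h k) * e k p f + h k p * D X (e k) p f)"
proof (induction I rule: finite_induct)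
  case empty
  have z: "vector_field A W (\<lambda>p f. 0)"
    using vector_field_lincomb[OF W, of "{}"] by simp
  have "D X (vmult (\<lambda>q. 0) (\<lambda>p f. 0)) p
      = vadd (vmult (\<lambda>q. X q (\<lambda>q. 0)) (\<lambda>p f. 0)) (vmult (\<lambda>q. 0) (D X (\<lambda>p f. 0))) p"
    using D X z smooth_fun_const[OF W, of 0] p unfolding affine_connection_def by blast
  then show ?case by (simp add: vadd_def vmult_def)
next
  case (insert i I)
  let ?S = "\<lambda>p f. \<Sum>k\<in>I. h k p * e k p f"
  have hi: "smooth_fun A W (h i)" and ei: "vector_field A W (e i)" using insert.prems by auto
  have S: "vector_field A W ?S"
    by (rule vector_field_lincomb[OF W]) (use insert.prems in auto)
  have m: "vector_field A W (vmult (h i) (e i))" by (rule vector_field_vmult[OF W hi ei])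
  have "D X (vadd (vmult (h i) (e i)) ?S) p = vadd (D X (vmult (h i) (e i))) (D X ?S) p"
    using D X m S p unfolding affine_connection_def by blast
  moreover have "D X (vmult (h i) (e i)) p = vadd (vmult (\<lambda>q. X q (h i)) (e i)) (vmult (h i) (D X (e i))) p"
    using D X hi ei p unfolding affine_connection_def by blast
  moreover have "D X ?S p = (\<lambda>f. \<Sum>k\<in>I. X p (h k) * e k p f + h k p * D X (e k) p f)"
    by (rule insert.IH) (use insert.prems in auto)
  ultimately have "D X (vadd (vmult (h i) (e i)) ?S) p
      = (\<lambda>f. \<Sum>k\<in>insert i I. X p (h k) * e k p f + h k p * D X (e k) p f)"
    using insert.hyps by (simp add: vadd_def vmult_def)
  moreover have "vadd (vmult (h i) (e i)) ?S = (\<lambda>p f. \<Sum>k\<in>insert i I. h k p * e k p f)"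
    using insert.hyps by (simp add: vadd_def vmult_def)
  ultimately show ?case by (simp only:)
qed

lemma affine_connection_sum_left:
  assumes D: "affine_connection A W D" and W: "open W" and Y: "vector_field A W Y" and p: "p \<in> W"
  shows "finite I \<Longrightarrow> (\<And>k. k \<in> I \<Longrightarrow> smooth_fun A W (h k)) \<Longrightarrow> (\<And>k. k \<in> I \<Longrightarrow> vector_field A W (e k)) \<Longrightarrow>
    D (\<lambda>p f. \<Sum>k\<in>I. h k p * e k p f) Y p = (\<lambda>f. \<Sum>k\<in>I. h k p * D (e k) Y p f)"
proof (induction I rule: finite_induct)
  case empty
  have z: "vector_field A W (\<lambda>p f. 0)"
    using vector_field_lincomb[OF W, of "{}"] by simp
  have "D (vmult (\<lambda>q. 0) (\<lambda>p f. 0)) Y p = vmult (\<lambda>q. 0) (D (\<lambda>p f. 0) Y) p"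
    using D Y z smooth_fun_const[OF W, of 0] p unfolding affine_connection_def by blast
  then show ?case by (simp add: vmult_def)
next
  case (insert i I)
  let ?S = "\<lambda>p f. \<Sum>k\<in>I. h k p * e k p f"
  have hi: "smooth_fun A W (h i)" and ei: "vector_field A W (e i)" using insert.prems by auto
  have S: "vector_field A W ?S"
    by (rule vector_field_lincomb[OF W]) (use insert.prems in auto)
  have m: "vector_field A W (vmult (h i) (e i))" by (rule vector_field_vmult[OF W hi ei])
  have "D (vadd (vmult (h i) (e i)) ?S) Y p = vadd (D (vmult (h i) (e i)) Y) (D ?S Y) p"
    using D Y m S p unfolding affine_connection_def by blast
  moreover have "D (vmult (h i) (e i)) Y p = vmult (h i) (D (e i) Y) p"
    using D Y hi ei p unfolding affine_connection_def by blast
  moreover have "D ?S Y p = (\<lambda>f. \<Sum>k\<in>I. h k p * D (e k) Y p f)"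
    by (rule insert.IH) (use insert.prems in auto)
  ultimately have "D (vadd (vmult (h i) (e i)) ?S) Y p = (\<lambda>f. \<Sum>k\<in>insert i I. h k p * D (e k) Y p f)"
    using insert.hyps by (simp add: vadd_def vmult_def)
  moreover have "vadd (vmult (h i) (e i)) ?S = (\<lambda>p f. \<Sum>k\<in>insert i I. h k p * e k p f)"
    using insert.hyps by (simp add: vadd_def vmult_def)
  ultimately show ?case by (simp only:)
qed

end

lemma matrix_inv_eq:
  fixes M N :: "real^'n^'n"
  assumes "M ** N = mat 1"
  shows "matrix_inv M = N"
proof -
  have "M ** N = mat 1 \<and> N ** M = mat 1"
    using assms matrix_left_right_inverse by blast
  then have "M ** matrix_inv M = mat 1 \<and> matrix_inv M ** M = mat 1"
    unfolding matrix_inv_def by (rule someI)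
  then show ?thesis using assms by (metis matrix_mul_assoc matrix_mul_lid matrix_mul_rid)
qed

context orthonormal_frame
begin

lemma comp_diff:
  assumes "u \<in> tangent_space A p" "v \<in> tangent_space A p"
  shows "comp p (\<lambda>f. u f - v f) = comp p u - comp p v"
  using comp_lin[OF assms, of 1 "-1"] by simp

lemma comp_bracket_frame: "comp p (lie_bracket A (x i) (x j) p) = C (axis i 1) (axis j 1)"
proof -
  have "lie_bracket A (x i) (x j) p = of_comp p (C (axis i 1) (axis j 1))"
    by (rule ext) (simp add: bracket of_comp_def)
  then show ?thesis by (simp only: comp_of_comp)
qed

lemma field_eq_of_comp:
  assumes "vector_field A UNIV X"
  shows "X = (\<lambda>p f. \<Sum>k\<in>UNIV. comp p (X p) $ k * x k p f)"
  using of_comp_comp[OF vector_field_tangent[OF assms UNIV_I]] unfolding of_comp_def by (rule ext[OF sym])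

lemma of_comp_sum: "of_comp p (\<Sum>i\<in>I. a i) = (\<lambda>f. \<Sum>i\<in>I. of_comp p (a i) f)"
proof (induction I rule: infinite_finite_induct)
  case (insert i I)
  then show ?case by (simp only: sum.insert of_comp_add simp_thms if_False)
qed (simp_all add: of_comp_zero)

text \<open>The Koszul formula for frame fields. The products \<open>g(x\<^sub>j, x\<^sub>k)\<close> are constant, so
  \<open>G i j k = g(\<nabla>\<^sub>i x\<^sub>j, x\<^sub>k)\<close> is antisymmetric in \<open>j\<close>, \<open>k\<close>, and torsion-freeness says that
  \<open>G i j k - G j i k\<close> is \<open>g([x\<^sub>i, x\<^sub>j], x\<^sub>k)\<close>. The solution is a combination of three cyclic
  permutations of the latter, which are equal since \<open>C\<close> is alternating.\<close>

lemma levi_civita_frame: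
  assumes LC: "levi_civita A UNIV g D"
    and anti: "\<And>a b. C a b = - C b a" and skew: "\<And>a b c. C a b \<bullet> c = - (C a c \<bullet> b)"
  shows "comp p (D (x i) (x j) p) = (1/2) *\<^sub>R C (axis i 1) (axis j 1)"
proof -
  define G where "G i j k = comp p (D (x i) (x j) p) $ k" for i j k
  define c where "c i j k = C (axis i 1) (axis j 1) $ k" for i j k
  note vf = frame_vector_field
  have D: "affine_connection A UNIV D"
    and tor: "\<And>X Y p. vector_field A UNIV X \<Longrightarrow> vector_field A UNIV Y \<Longrightarrow>
        vdiff (D X Y) (D Y X) p = lie_bracket A X Y p"
    and com: "\<And>X Y Z p. vector_field A UNIV X \<Longrightarrow> vector_field A UNIV Y \<Longrightarrow> vector_field A UNIV Z \<Longrightarrow>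
        X p (\<lambda>q. g q (Y q) (Z q)) = g p (D X Y p) (Z p) + g p (Y p) (D X Z p)"
    using LC unfolding levi_civita_def by blast+
  have Dvf: "vector_field A UNIV (D (x i) (x j))" for i j
    by (rule affine_connection_vector_field[OF D vf vf])
  note t = vector_field_tangent[OF Dvf UNIV_I]
  have c1: "c i j k = - c j i k" for i j k
    unfolding c_def by (subst anti) simp
  have c2: "c i j k = - c i k j" for i j k
    using skew[of "axis i 1" "axis j 1" "axis k 1"] by (simp add: c_def inner_axis)
  have G1: "G i j k - G j i k = c i j k" for i j k
  proof -
    have "comp p (\<lambda>f. D (x i) (x j) p f - D (x j) (x i) p f) = C (axis i 1) (axis j 1)"
      using tor[OF vf[of i] vf[of j], of p] comp_bracket_frame[of p i j] by (simp add: vdiff_def)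
    then show ?thesis
      unfolding comp_diff[OF t t] G_def c_def by (metis vector_minus_component)
  qed
  have G2: "G i j k + G i k j = 0" for i j k
  proof -
    have "x i p (\<lambda>q. g q (x j q) (x k q)) = 0"
      unfolding orthonormal by (rule tangent_const[OF frame_tangent])
    then show ?thesis
      using com[OF vf[of i] vf[of j] vf[of k], of p] metric_sym[OF frame_tangent[of j p] t[of i k p]]
      by (simp add: G_def comp_def)
  qed
  have "2 * G i j k = c i j k" for k
    using G1[of i j k] G1[of k i j] G1[of j k i] G2[of i j k] G2[of j k i] G2[of k i j]
      c1[of i j k] c2[of j k i] c1[of k i j] c2[of i k j]
    by linarith
  then show ?thesis
    by (simp add: vec_eq_iff G_def c_def field_simps)
qed

text \<open>A connection is determined by its values on a frame: expanding both arguments, the Leibniz rule in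
  the second one produces the derivatives of the coefficients.\<close>

lemma levi_civita_conn:
  assumes LC: "levi_civita A UNIV g D"
    and anti: "\<And>a b. C a b = - C b a" and skew: "\<And>a b c. C a b \<bullet> c = - (C a c \<bullet> b)"
    and X: "vector_field A UNIV X" and Y: "vector_field A UNIV Y"
  shows "D X Y p = conn (\<lambda>a b. (1/2) *\<^sub>R C a b) X Y p"
proof -
  let ?X = "comp p (X p)" and ?Y = "comp p (Y p)" and ?c = "\<lambda>i j. C (axis i 1) (axis j 1)"
  note vf = frame_vector_field
  have D: "affine_connection A UNIV D"
    using LC unfolding levi_civita_def by (elim conjE)
  have "D (x i) (x j) p \<in> tangent_space A p" for i j
    by (rule vector_field_tangent[OF affine_connection_vector_field[OF D vf vf] UNIV_I])
  from of_comp_comp[OF this]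
  have Dij: "D (x i) (x j) p = of_comp p ((1/2) *\<^sub>R ?c i j)" for i j
    unfolding levi_civita_frame[OF LC anti skew] by (rule sym)
  have DX: "D X (x j) p = (\<lambda>f. \<Sum>i\<in>UNIV. ?X $ i * of_comp p ((1/2) *\<^sub>R ?c i j) f)" for j
    by (subst field_eq_of_comp[OF X])
      (simp only: affine_connection_sum_left[OF D open_UNIV vf UNIV_I finite comp_smooth[OF open_UNIV X] vf] Dij)
  have "D X Y p f = of_comp p (vderiv (X p) (\<lambda>q. comp q (Y q)) + (1/2) *\<^sub>R C ?X ?Y) f" for f
  proof -
    have first: "of_comp p (vderiv (X p) (\<lambda>q. comp q (Y q))) f
        = (\<Sum>k\<in>UNIV. X p (\<lambda>q. comp q (Y q) $ k) * x k p f)"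
      by (simp add: of_comp_def vderiv_def)
    have "D X Y p f = D X (\<lambda>p f. \<Sum>k\<in>UNIV. comp p (Y p) $ k * x k p f) p f"
      using field_eq_of_comp[OF Y] by simp
    also have "\<dots> = (\<Sum>k\<in>UNIV. X p (\<lambda>q. comp q (Y q) $ k) * x k p f
        + ?Y $ k * (\<Sum>i\<in>UNIV. ?X $ i * of_comp p ((1/2) *\<^sub>R ?c i k) f))"
      by (simp only: affine_connection_sum_right[OF D open_UNIV X UNIV_I finite comp_smooth[OF open_UNIV Y] vf] DX)
    also have "\<dots> = of_comp p (vderiv (X p) (\<lambda>q. comp q (Y q))) f
        + (\<Sum>k\<in>UNIV. \<Sum>i\<in>UNIV. of_comp p ((?X $ i * ?Y $ k) *\<^sub>R ((1/2) *\<^sub>R ?c i k)) f)"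
      unfolding first by (simp add: sum.distrib of_comp_scaleR sum_distrib_left mult_ac)
    also have "(\<Sum>k\<in>UNIV. \<Sum>i\<in>UNIV. of_comp p ((?X $ i * ?Y $ k) *\<^sub>R ((1/2) *\<^sub>R ?c i k)) f)
        = (\<Sum>i\<in>UNIV. \<Sum>k\<in>UNIV. of_comp p ((?X $ i * ?Y $ k) *\<^sub>R ((1/2) *\<^sub>R ?c i k)) f)"
      by (rule sum.swap)
    also have "\<dots> = of_comp p ((1/2) *\<^sub>R (\<Sum>i\<in>UNIV. \<Sum>k\<in>UNIV. (?X $ i * ?Y $ k) *\<^sub>R ?c i k)) f"
      by (simp only: scaleR_sum_right of_comp_sum scaleR_left_commute[of "1/2"])
    also have "(\<Sum>i\<in>UNIV. \<Sum>k\<in>UNIV. (?X $ i * ?Y $ k) *\<^sub>R ?c i k) = C ?X ?Y"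
      by (rule bilinear_coords[OF bilinear_C, symmetric])
    finally show ?thesis by (simp only: of_comp_add)
  qed
  then show ?thesis unfolding conn_def by blast
qed

section \<open>Rescaling the metric\<close>

text \<open>For the rescaled metric, \<open>X (e\<^sup>2\<^sup>\<sigma> g(Y,Z))\<close> contains the additional term \<open>2 (X \<sigma>) e\<^sup>2\<^sup>\<sigma> g(Y,Z)\<close>. The
  last assumption says that the failure of \<open>\<Gamma>\<close> to be skew is exactly this term.\<close>

lemma conn_levi_civita_rescaled:
  assumes \<Gamma>: "bilinear \<Gamma>" and W: "open W" and \<sigma>: "smooth_fun A W \<sigma>"
    and d\<sigma>: "\<And>q v. q \<in> W \<Longrightarrow> v \<in> tangent_space A q \<Longrightarrow> v \<sigma> = \<eta> \<bullet> comp q v"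
    and torsion: "\<And>a b. \<Gamma> a b - \<Gamma> b a = C a b"
    and conformal: "\<And>a b c. \<Gamma> a b \<bullet> c + b \<bullet> \<Gamma> a c = 2 * (\<eta> \<bullet> a) * (b \<bullet> c)"
  shows "levi_civita A W (\<lambda>q v w. exp (2 * \<sigma> q) * g q v w) (conn \<Gamma>)"
proof -
  have l: "linear (\<lambda>u. \<Gamma> u v)" and r: "linear (\<Gamma> v)" for v
    using \<Gamma> by (simp_all add: bilinear_def)
  have vadd_comp: "comp p (vadd X X' p) = comp p (X p) + comp p (X' p)"
    if "vector_field A W X" "vector_field A W X'" "p \<in> W" for X X' p
    using comp_lin[OF that(1,2)[THEN vector_field_tangent, OF that(3)], of 1 1] by (simp add: vadd_def)
  have vmult_comp: "comp p (vmult h X p) = h p *\<^sub>R comp p (X p)"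
    if "vector_field A W X" "p \<in> W" for X h p
    using comp_lin[OF vector_field_tangent[OF that] tangent_zero, of "h p" 0] by (simp add: vmult_def)
  have vderiv_vadd: "vderiv (vadd X X' p) h = vderiv (X p) h + vderiv (X' p) h" for X X' p h
    by (simp add: vderiv_def vadd_def vec_eq_iff)
  have vderiv_vmult: "vderiv (vmult k X p) h = k p *\<^sub>R vderiv (X p) h" for X k p h
    by (simp add: vderiv_def vmult_def vec_eq_iff)
  have "affine_connection A W (conn \<Gamma>)"
    unfolding affine_connection_def
  proof (intro conjI allI impI ballI)
    fix X Y assume X: "vector_field A W X" and Y: "vector_field A W Y"
    show "vector_field A W (conn \<Gamma> X Y)" by (rule conn_vector_field[OF \<Gamma> W X Y])
  next
    fix X X' Y p
    assume X: "vector_field A W X" and X': "vector_field A W X'" and Y: "vector_field A W Y" and p: "p \<in> W"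
    show "conn \<Gamma> (vadd X X') Y p = vadd (conn \<Gamma> X Y) (conn \<Gamma> X' Y) p"
      unfolding vadd_def[of "conn _ _ _"] conn_def of_comp_add[symmetric] vadd_comp[OF X X' p] vderiv_vadd linear_add[OF l]
      by (simp add: add_ac)
    have "vderiv (Y p) (\<lambda>q. comp q (vadd X X' q)) = vderiv (Y p) (\<lambda>q. comp q (X q) + comp q (X' q))"
      by (rule vderiv_cong[OF vector_field_tangent[OF Y p] _ W p vadd_comp[OF X X', symmetric], symmetric])
        (auto intro!: smooth_at_add comp_smooth_at[OF W p] X X')
    also have "\<dots> = vderiv (Y p) (\<lambda>q. comp q (X q)) + vderiv (Y p) (\<lambda>q. comp q (X' q))"
      by (rule vderiv_add[OF vector_field_tangent[OF Y p] comp_smooth_at[OF W p X] comp_smooth_at[OF W p X']])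
    finally show "conn \<Gamma> Y (vadd X X') p = vadd (conn \<Gamma> Y X) (conn \<Gamma> Y X') p"
      unfolding vadd_def[of "conn _ _ _"] conn_def of_comp_add[symmetric] vadd_comp[OF X X' p] linear_add[OF r]
      by (simp add: add_ac)
  next
    fix h X Y p
    assume h: "smooth_fun A W h" and X: "vector_field A W X" and Y: "vector_field A W Y" and p: "p \<in> W"
    note v = vector_field_tangent[OF X p] and hs = smooth_atI[OF h W p] and Ys = comp_smooth_at[OF W p Y]
    show "conn \<Gamma> (vmult h X) Y p = vmult h (conn \<Gamma> X Y) p"
      unfolding vmult_def[of _ "conn _ _ _"] conn_def of_comp_scaleR[symmetric] vmult_comp[OF X p] vderiv_vmult linear_cmul[OF l]
      by (simp add: scaleR_add_right)
    have "vderiv (X p) (\<lambda>q. comp q (vmult h Y q)) = vderiv (X p) (\<lambda>q. h q *\<^sub>R comp q (Y q))"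
      by (rule vderiv_cong[OF v _ W p vmult_comp[OF Y, symmetric], symmetric])
        (simp add: smooth_at_mult[OF hs Ys])
    also have "\<dots> = X p h *\<^sub>R comp p (Y p) + h p *\<^sub>R vderiv (X p) (\<lambda>q. comp q (Y q))"
      by (rule vderiv_scale[OF v hs Ys])
    finally have "conn \<Gamma> X (vmult h Y) p = of_comp p (X p h *\<^sub>R comp p (Y p)
        + h p *\<^sub>R (vderiv (X p) (\<lambda>q. comp q (Y q)) + \<Gamma> (comp p (X p)) (comp p (Y p))))"
      unfolding conn_def vmult_comp[OF Y p] linear_cmul[OF r] by (simp add: scaleR_add_right add_ac)
    then show "conn \<Gamma> X (vmult h Y) p = vadd (vmult (\<lambda>q. X q h) Y) (vmult h (conn \<Gamma> X Y)) p"
      unfolding of_comp_add of_comp_scaleR of_comp_comp[OF vector_field_tangent[OF Y p]]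
      by (simp add: vadd_def vmult_def conn_def of_comp_add)
  qed
  moreover have "vdiff (conn \<Gamma> X Y) (conn \<Gamma> Y X) p = lie_bracket A X Y p"
    if X: "vector_field A W X" and Y: "vector_field A W Y" and p: "p \<in> W" for X Y p
  proof -
    have "vdiff (conn \<Gamma> X Y) (conn \<Gamma> Y X) p = of_comp p (comp p (lie_bracket A X Y p))"
      unfolding vdiff_def conn_def of_comp_diff[symmetric] comp_lie_bracket[OF W p X Y] torsion[symmetric]
      by (simp add: algebra_simps)
    then show ?thesis by (simp only: of_comp_comp[OF lie_bracket_tangent[OF W p X Y]])
  qed
  moreover have "X p (\<lambda>q. exp (2 * \<sigma> q) * g q (Y q) (Z q))
      = exp (2 * \<sigma> p) * g p (conn \<Gamma> X Y p) (Z p) + exp (2 * \<sigma> p) * g p (Y p) (conn \<Gamma> X Z p)"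
    if X: "vector_field A W X" and Y: "vector_field A W Y" and Z: "vector_field A W Z" and p: "p \<in> W" for X Y Z p
  proof -
    let ?Y = "\<lambda>q. comp q (Y q)" and ?Z = "\<lambda>q. comp q (Z q)" and ?a = "comp p (X p)"
    note v = vector_field_tangent[OF X p] and \<sigma>s = smooth_at_cmult[OF smooth_atI[OF \<sigma> W p], of 2]
    note Ys = comp_smooth_at[OF W p Y] and Zs = comp_smooth_at[OF W p Z]
    have eq: "\<forall>\<^sub>F q in nhds p. exp (2 * \<sigma> q) * (?Y q \<bullet> ?Z q) = exp (2 * \<sigma> q) * g q (Y q) (Z q)"
      using eventually_nhds_in_open[OF W p]
      by eventually_elim
        (simp only: metric_comp[OF vector_field_tangent[OF Y] vector_field_tangent[OF Z]])
    have "X p (\<lambda>q. exp (2 * \<sigma> q) * g q (Y q) (Z q)) = X p (\<lambda>q. exp (2 * \<sigma> q) * (?Y q \<bullet> ?Z q))"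
      by (rule tangent_cong[OF v smooth_at_mult[OF smooth_at_exp[OF \<sigma>s] smooth_at_inner[OF Ys Zs]] eq, symmetric])
    also have "\<dots> = exp (2 * \<sigma> p) * X p (\<lambda>q. ?Y q \<bullet> ?Z q) + (?Y p \<bullet> ?Z p) * X p (\<lambda>q. exp (2 * \<sigma> q))"
      by (rule tangent_mult[OF v smooth_at_exp[OF \<sigma>s] smooth_at_inner[OF Ys Zs]])
    also have "X p (\<lambda>q. exp (2 * \<sigma> q)) = exp (2 * \<sigma> p) * (2 * (\<eta> \<bullet> ?a))"
      by (simp only: tangent_exp[OF v \<sigma>s] tangent_cmult[OF v smooth_atI[OF \<sigma> W p]] d\<sigma>[OF p v])
    also have "X p (\<lambda>q. ?Y q \<bullet> ?Z q) = vderiv (X p) ?Y \<bullet> ?Z p + ?Y p \<bullet> vderiv (X p) ?Z"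
      by (rule tangent_inner[OF v Ys Zs])
    also have "exp (2 * \<sigma> p) * (vderiv (X p) ?Y \<bullet> ?Z p + ?Y p \<bullet> vderiv (X p) ?Z)
        + (?Y p \<bullet> ?Z p) * (exp (2 * \<sigma> p) * (2 * (\<eta> \<bullet> ?a)))
        = exp (2 * \<sigma> p) * (vderiv (X p) ?Y \<bullet> ?Z p + ?Y p \<bullet> vderiv (X p) ?Z + 2 * (\<eta> \<bullet> ?a) * (?Y p \<bullet> ?Z p))"
      by (simp only: algebra_simps)
    also have "\<dots> = exp (2 * \<sigma> p) * (comp p (conn \<Gamma> X Y p) \<bullet> ?Z p) + exp (2 * \<sigma> p) * (?Y p \<bullet> comp p (conn \<Gamma> X Z p))"
      unfolding conformal[symmetric] comp_conn by (simp add: algebra_simps inner_add_left inner_add_right)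
    finally show ?thesis
      unfolding metric_comp[OF vector_field_tangent[OF conn_vector_field[OF \<Gamma> W X Y] p] vector_field_tangent[OF Z p]]
        metric_comp[OF vector_field_tangent[OF Y p] vector_field_tangent[OF conn_vector_field[OF \<Gamma> W X Z] p]] .
  qed
  ultimately show ?thesis
    unfolding levi_civita_def by blast
qed

text \<open>The exterior derivative of the form \<open>\<theta> = g(\<eta>, \<cdot>)\<close> with constant coefficients is
  \<open>d\<theta>(X,Y) = - \<theta>[X,Y]\<close> on frame fields, so it vanishes if \<open>\<eta>\<close> is orthogonal to all brackets.\<close>

lemma invariant_closed_form_primitive:
  assumes closed: "\<And>a b. \<eta> \<bullet> C a b = 0"
  obtains W \<sigma> where "open W" "p \<in> W" "smooth_fun A W \<sigma>"
    "\<And>q v. q \<in> W \<Longrightarrow> v \<in> tangent_space A q \<Longrightarrow> v \<sigma> = \<eta> \<bullet> comp q v"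
proof (rule closed_form_has_local_primitive[of "\<lambda>q v. \<eta> \<bullet> comp q v" p])
  fix q c and I :: "'e set" and v
  assume "\<And>i. i \<in> I \<Longrightarrow> v i \<in> tangent_space A q" "finite I"
  then show "\<eta> \<bullet> comp q (\<lambda>f. \<Sum>i\<in>I. c i * v i f) = (\<Sum>i\<in>I. c i * (\<eta> \<bullet> comp q (v i)))"
    by (simp only: comp_lincomb inner_sum_right inner_scaleR_right)
next
  fix W X assume "open W" "vector_field A W X"
  then show "smooth_fun A W (\<lambda>q. \<eta> \<bullet> comp q (X q))"
    unfolding inner_vec_def inner_real_def
    by (intro smooth_fun_sum smooth_fun_mult smooth_fun_const comp_smooth)
next
  fix W X Y q
  assume W: "open W" and X: "vector_field A W X" and Y: "vector_field A W Y" and q: "q \<in> W"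
  have "u (\<lambda>r. \<eta> \<bullet> comp r (Z r)) = \<eta> \<bullet> vderiv u (\<lambda>r. comp r (Z r))"
    if "vector_field A W Z" "u \<in> tangent_space A q" for Z u
    using tangent_inner[OF that(2) smooth_at_const comp_smooth_at[OF W q that(1)], of \<eta>]
    by (simp add: vderiv_const[OF that(2)])
  then show "X q (\<lambda>r. \<eta> \<bullet> comp r (Y r)) - Y q (\<lambda>r. \<eta> \<bullet> comp r (X r)) = \<eta> \<bullet> comp q (lie_bracket A X Y q)"
    using vector_field_tangent[OF X q] vector_field_tangent[OF Y q] X Y
    by (simp add: comp_lie_bracket[OF W q X Y] inner_add_right inner_diff_right closed)
qed (use that in blast)

text \<open>Associativity makes the connection flat: it turns \<open>\<Gamma> a (\<Gamma> b c) - \<Gamma> b (\<Gamma> a c)\<close> into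
  \<open>\<Gamma> (\<Gamma> a b - \<Gamma> b a) c\<close>, and the commutator of \<open>\<Gamma>\<close> is the bracket.\<close>

lemma conformally_flatI:
  assumes \<Gamma>: "bilinear \<Gamma>" and closed: "\<And>a b. \<eta> \<bullet> C a b = 0"
    and torsion: "\<And>a b. \<Gamma> a b - \<Gamma> b a = C a b"
    and conformal: "\<And>a b c. \<Gamma> a b \<bullet> c + b \<bullet> \<Gamma> a c = 2 * (\<eta> \<bullet> a) * (b \<bullet> c)"
    and assoc: "\<And>a b c. \<Gamma> a (\<Gamma> b c) = \<Gamma> (\<Gamma> a b) c"
  shows "conformally_flat A g"
  unfolding conformally_flat_def
proof
  fix p
  obtain W \<sigma> where W: "open W" "p \<in> W" and \<sigma>: "smooth_fun A W \<sigma>"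
    and d\<sigma>: "\<And>q v. q \<in> W \<Longrightarrow> v \<in> tangent_space A q \<Longrightarrow> v \<sigma> = \<eta> \<bullet> comp q v"
    using invariant_closed_form_primitive[OF closed] by metis
  have l: "linear (\<lambda>u. \<Gamma> u v)" for v
    using \<Gamma> by (simp add: bilinear_def)
  have "curvature_op A (conn \<Gamma>) X Y Z q = (\<lambda>f. 0)"
    if X: "vector_field A W X" and Y: "vector_field A W Y" and Z: "vector_field A W Z" and q: "q \<in> W" for X Y Z q
  proof -
    have "curvature_op A (conn \<Gamma>) X Y Z q = of_comp q (\<Gamma> (comp q (X q)) (\<Gamma> (comp q (Y q)) (comp q (Z q)))
        - \<Gamma> (comp q (Y q)) (\<Gamma> (comp q (X q)) (comp q (Z q))) - \<Gamma> (C (comp q (X q)) (comp q (Y q))) (comp q (Z q)))"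
      by (rule curvature_conn[OF \<Gamma> W(1) q _ _ X Y Z]) (simp_all add: conn_vector_field[OF \<Gamma> W(1)])
    also have "\<dots> = (\<lambda>f. 0)"
      by (simp only: torsion[symmetric] assoc linear_diff[OF l] diff_self of_comp_zero)
    finally show ?thesis .
  qed
  then have "flat_on A W (\<lambda>q v w. exp (2 * \<sigma> q) * g q v w)"
    unfolding flat_on_def
    using conn_levi_civita_rescaled[OF \<Gamma> W(1) \<sigma> d\<sigma> torsion conformal] by blast
  then show "\<exists>W \<sigma>. open W \<and> p \<in> W \<and> smooth_fun A W \<sigma> \<and>
      flat_on A W (\<lambda>q v w. exp (2 * \<sigma> q) * g q v w)"
    using W \<sigma> by blast
qed

section \<open>Traces in an arbitrary frame\<close>

text \<open>If \<open>E\<close> is the matrix of components of \<open>e\<close>, the Gram matrix is \<open>E E\<^sup>T\<close> and has the inverse \<open>F\<^sup>T F\<close>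
  with \<open>F\<close> the inverse of \<open>E\<close>. As \<open>E\<^sup>T (F\<^sup>T F) E\<close> is the unit matrix, the contraction of \<open>B\<close> in the
  frame \<open>e\<close> is its trace in the orthonormal frame.\<close>

lemma inverse_gram_trace:
  fixes e :: "'n \<Rightarrow> 'm vfield" and B :: "real^'n \<Rightarrow> real^'n \<Rightarrow> real"
  assumes e: "global_frame A e" and B: "bilinear B"
  shows "(\<Sum>i\<in>UNIV. \<Sum>j\<in>UNIV. inverse_gram g e p $ i $ j * B (comp p (e i p)) (comp p (e j p)))
    = (\<Sum>a\<in>UNIV. B (axis a 1) (axis a 1))"
proof -
  define E :: "real^'n^'n" where "E = (\<chi> i. comp p (e i p))"
  have et: "e i p \<in> tangent_space A p" for i
    using e vector_field_tangent[OF _ UNIV_I] unfolding global_frame_def by blast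
  have "\<exists>c. x a p = (\<lambda>f. \<Sum>i\<in>UNIV. c i * e i p f)" for a
    using e frame_tangent[of a p] unfolding global_frame_def by blast
  then obtain F where F: "x a p = (\<lambda>f. \<Sum>i\<in>UNIV. F a i * e i p f)" for a by metis
  define F' :: "real^'n^'n" where "F' = (\<chi> a i. F a i)"
  have "axis a 1 = (\<Sum>i\<in>UNIV. F a i *\<^sub>R comp p (e i p))" for a
    using comp_frame[of p a] unfolding F[of a] comp_lincomb[OF finite et] by (rule sym)
  then have FE: "F' ** E = mat 1"
    by (simp add: vec_eq_iff matrix_matrix_mult_def F'_def E_def mat_def sum_component axis_def eq_commute)
  then have EF: "E ** F' = mat 1" by (simp add: matrix_left_right_inverse)
  define H where "H = transpose F' ** F'"
  have gram: "(\<chi> i j. g p (e i p) (e j p)) = E ** transpose E"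
    by (simp add: vec_eq_iff matrix_matrix_mult_def E_def transpose_def metric_comp[OF et et] inner_vec_def)
  have FEt: "transpose E ** transpose F' = mat 1"
    using FE by (metis matrix_transpose_mul transpose_mat)
  have "E ** transpose E ** H = mat 1"
    unfolding H_def using FEt EF by (metis matrix_mul_assoc matrix_mul_rid)
  then have "inverse_gram g e p = H"
    unfolding inverse_gram_def gram by (rule matrix_inv_eq)
  moreover have "transpose E ** H ** E = mat 1"
    unfolding H_def using FEt FE by (metis matrix_mul_assoc matrix_mul_lid)
  moreover have "(transpose E ** H ** E) $ a $ b
      = (\<Sum>i\<in>UNIV. \<Sum>j\<in>UNIV. H $ i $ j * (comp p (e i p) $ a * comp p (e j p) $ b))" for a b
    by (simp add: matrix_matrix_mult_def transpose_def E_def sum_distrib_right sum_distrib_left mult_ac)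
      (subst sum.swap, simp add: mult_ac)
  ultimately have key: "(\<Sum>i\<in>UNIV. \<Sum>j\<in>UNIV. inverse_gram g e p $ i $ j * (comp p (e i p) $ a * comp p (e j p) $ b))
      = (if a = b then 1 else 0)" for a b
    by (simp add: mat_def)
  let ?h = "inverse_gram g e p" and ?e = "\<lambda>i. comp p (e i p)"
  have "(\<Sum>i\<in>UNIV. \<Sum>j\<in>UNIV. ?h $ i $ j * B (?e i) (?e j))
      = (\<Sum>i\<in>UNIV. \<Sum>j\<in>UNIV. \<Sum>a\<in>UNIV. \<Sum>b\<in>UNIV. ?h $ i $ j * (?e i $ a * ?e j $ b) * B (axis a 1) (axis b 1))"
    by (simp only: bilinear_coords[OF B, of "?e _"] sum_distrib_left real_scaleR_def mult.assoc)
  also have "\<dots> = (\<Sum>i\<in>UNIV. \<Sum>a\<in>UNIV. \<Sum>j\<in>UNIV. \<Sum>b\<in>UNIV. ?h $ i $ j * (?e i $ a * ?e j $ b) * B (axis a 1) (axis b 1))"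
    by (rule sum.cong[OF refl], rule sum.swap)
  also have "\<dots> = (\<Sum>a\<in>UNIV. \<Sum>i\<in>UNIV. \<Sum>j\<in>UNIV. \<Sum>b\<in>UNIV. ?h $ i $ j * (?e i $ a * ?e j $ b) * B (axis a 1) (axis b 1))"
    by (rule sum.swap)
  also have "\<dots> = (\<Sum>a\<in>UNIV. \<Sum>i\<in>UNIV. \<Sum>b\<in>UNIV. \<Sum>j\<in>UNIV. ?h $ i $ j * (?e i $ a * ?e j $ b) * B (axis a 1) (axis b 1))"
    by (rule sum.cong[OF refl], rule sum.cong[OF refl], rule sum.swap)
  also have "\<dots> = (\<Sum>a\<in>UNIV. \<Sum>b\<in>UNIV. \<Sum>i\<in>UNIV. \<Sum>j\<in>UNIV. ?h $ i $ j * (?e i $ a * ?e j $ b) * B (axis a 1) (axis b 1))"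
    by (rule sum.cong[OF refl], rule sum.swap)
  also have "\<dots> = (\<Sum>a\<in>UNIV. \<Sum>b\<in>UNIV. (if a = b then 1 else 0) * B (axis a 1) (axis b 1))"
    by (simp only: sum_distrib_right[symmetric] key)
  also have "\<dots> = (\<Sum>a\<in>UNIV. B (axis a 1) (axis a 1))"
    by (simp add: if_distrib[of "\<lambda>z. z * _"] cong: if_cong)
  finally show ?thesis .
qed

end

section \<open>Curvature of bi-invariant metrics\<close>

locale bi_invariant_frame = orthonormal_frame A x g C
  for A :: "('m::topological_space, 'e::euclidean_space) atlas" and x :: "'n::finite \<Rightarrow> 'm vfield"
    and g and C +
  fixes D :: "'m connection"
  assumes LC: "levi_civita A UNIV g D"
    and anti: "C a b = - C b a" and skew: "C a b \<bullet> c = - (C a c \<bullet> b)"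
    and jacobi: "C a (C b c) - C b (C a c) = C (C a b) c"
begin

lemma C_inner_bilinear: "bilinear (\<lambda>u v. k * (C u y \<bullet> C v z))" "bilinear (\<lambda>u v. k * (C u y \<bullet> C z v))"
  using bilinear_C
  by (auto simp: bilinear_def linear_iff inner_add_left inner_add_right algebra_simps)

text \<open>With \<open>\<Gamma> = C / 2\<close>, the Jacobi identity reduces the curvature to
  \<open>C (C a b) c / 4 - C (C a b) c / 2\<close>, and skewness moves \<open>c\<close> to the other side of the product.\<close>

lemma curvature_comp:
  assumes X: "vector_field A UNIV X" and Y: "vector_field A UNIV Y" and Z: "vector_field A UNIV Z"
    and U: "vector_field A UNIV U"
  shows "curvature A g D X Y Z U p
    = - (1/4) * (C (comp p (X p)) (comp p (Y p)) \<bullet> C (comp p (Z p)) (comp p (U p)))"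
proof -
  let ?\<Gamma> = "\<lambda>a b. (1/2) *\<^sub>R C a b"
  have l: "linear (\<lambda>u. C u v)" and r: "linear (C v)" for v
    using bilinear_C by (simp_all add: bilinear_def)
  have \<Gamma>: "bilinear ?\<Gamma>"
    using bilinear_C by (auto simp: bilinear_def linear_iff algebra_simps)
  have D: "affine_connection A UNIV D"
    using LC unfolding levi_civita_def by (elim conjE)
  let ?a = "comp p (X p)" and ?b = "comp p (Y p)" and ?c = "comp p (Z p)" and ?d = "comp p (U p)"
  have "curvature_op A D X Y Z p = of_comp p (?\<Gamma> ?a (?\<Gamma> ?b ?c) - ?\<Gamma> ?b (?\<Gamma> ?a ?c) - ?\<Gamma> (C ?a ?b) ?c)"
    by (rule curvature_conn[OF \<Gamma> open_UNIV UNIV_I levi_civita_conn[OF LC anti skew]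
          affine_connection_vector_field[OF D] X Y Z])
  also have "?\<Gamma> ?a (?\<Gamma> ?b ?c) - ?\<Gamma> ?b (?\<Gamma> ?a ?c) - ?\<Gamma> (C ?a ?b) ?c = - (1/4) *\<^sub>R C (C ?a ?b) ?c"
    unfolding jacobi[symmetric] linear_cmul[OF r] by (simp add: algebra_simps)
  finally have "curvature A g D X Y Z U p = - (1/4) * (C (C ?a ?b) ?c \<bullet> ?d)"
    unfolding curvature_def
    by (simp add: metric_comp[OF of_comp_tangent vector_field_tangent[OF U UNIV_I]] comp_of_comp)
  also have "C (C ?a ?b) ?c \<bullet> ?d = C ?a ?b \<bullet> C ?c ?d"
    using skew[of ?c "C ?a ?b" ?d] by (simp add: anti[of "C ?a ?b" ?c] inner_commute)
  finally show ?thesis .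
qed

lemma curvature_frame:
  "curvature A g D (x i) (x j) (x k) (x h) p
    = - (1/4) * (C (axis i 1) (axis j 1) \<bullet> C (axis k 1) (axis h 1))"
  by (simp only: curvature_comp frame_vector_field comp_frame)

lemma ricci_comp:
  fixes e :: "'n \<Rightarrow> 'm vfield"
  assumes e: "global_frame A e" and Y: "vector_field A UNIV Y" and Z: "vector_field A UNIV Z"
  shows "ricci A g D e Y Z p
    = (1/4) * (\<Sum>a\<in>UNIV. C (axis a 1) (comp p (Y p)) \<bullet> C (axis a 1) (comp p (Z p)))"
proof -
  have ev: "vector_field A UNIV (e i)" for i using e by (simp add: global_frame_def)
  have "ricci A g D e Y Z p = (\<Sum>a\<in>UNIV. - (1/4) * (C (axis a 1) (comp p (Y p)) \<bullet> C (comp p (Z p)) (axis a 1)))"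
    unfolding ricci_def curvature_comp[OF ev Y Z ev] by (rule inverse_gram_trace[OF e C_inner_bilinear(2)])
  also have "\<dots> = (\<Sum>a\<in>UNIV. (1/4) * (C (axis a 1) (comp p (Y p)) \<bullet> C (axis a 1) (comp p (Z p))))"
    by (rule sum.cong[OF refl], subst anti[of "comp p (Z p)"]) simp
  finally show ?thesis by (simp only: sum_distrib_left)
qed

lemma ricci_frame:
  fixes e :: "'n \<Rightarrow> 'm vfield"
  assumes "global_frame A e"
  shows "ricci A g D e (x i) (x j) p
    = (1/4) * (\<Sum>a\<in>UNIV. C (axis a 1) (axis i 1) \<bullet> C (axis a 1) (axis j 1))"
  by (simp only: ricci_comp[OF assms] frame_vector_field comp_frame)

lemma scalar_curvature_frame:
  fixes e :: "'n \<Rightarrow> 'm vfield"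
  assumes e: "global_frame A e"
  shows "scalar_curvature A g D e p
    = (1/4) * (\<Sum>b\<in>UNIV. \<Sum>a\<in>UNIV. C (axis a 1) (axis b 1) \<bullet> C (axis a 1) (axis b 1))"
proof -
  have ev: "vector_field A UNIV (e i)" for i using e by (simp add: global_frame_def)
  have "bilinear (\<lambda>u v. (1/4) * (\<Sum>a\<in>UNIV. C (axis a 1) u \<bullet> C (axis a 1) v))"
    using bilinear_C
    by (auto simp: bilinear_def linear_iff inner_add_left inner_add_right sum.distrib sum_distrib_left
        add_divide_distrib)
  from inverse_gram_trace[OF e this]
  show ?thesis
    unfolding scalar_curvature_def ricci_comp[OF e ev ev] by (simp only: sum_distrib_left)
qed

lemma sectional_curvature_frame:
  "i \<noteq> j \<Longrightarrow> sectional_curvature A g D (x i) (x j) p = curvature A g D (x i) (x j) (x i) (x j) p"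
  by (simp add: sectional_curvature_def orthonormal)

end

section \<open>The quaternion product behind the Killing brackets\<close>

text \<open>Quaternion multiplication, with \<open>1, i, j, k\<close> as basis.\<close>

definition qmult :: "real^4 \<Rightarrow> real^4 \<Rightarrow> real^4" where
  "qmult a b = (\<chi> k.
    if k = 1 then a$1 * b$1 - a$2 * b$2 - a$3 * b$3 - a$4 * b$4
    else if k = 2 then a$1 * b$2 + a$2 * b$1 + a$3 * b$4 - a$4 * b$3
    else if k = 3 then a$1 * b$3 - a$2 * b$4 + a$3 * b$1 + a$4 * b$2
    else a$1 * b$4 + a$2 * b$3 - a$3 * b$2 + a$4 * b$1)"

lemma qmult_nth:
  "qmult a b $ 1 = a$1 * b$1 - a$2 * b$2 - a$3 * b$3 - a$4 * b$4"
  "qmult a b $ 2 = a$1 * b$2 + a$2 * b$1 + a$3 * b$4 - a$4 * b$3"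
  "qmult a b $ 3 = a$1 * b$3 - a$2 * b$4 + a$3 * b$1 + a$4 * b$2"
  "qmult a b $ 4 = a$1 * b$4 + a$2 * b$3 - a$3 * b$2 + a$4 * b$1"
  by (simp_all add: qmult_def)

lemma bilinear_qmult: "bilinear qmult"
  unfolding bilinear_def linear_iff by (simp add: vec_eq_iff forall_4 qmult_nth algebra_simps)

lemma qmult_assoc: "qmult (qmult a b) c = qmult a (qmult b c)"
  by (simp add: vec_eq_iff forall_4 qmult_nth algebra_simps)

definition qcnj :: "real^4 \<Rightarrow> real^4" where
  "qcnj a = (\<chi> k. if k = 1 then a$1 else - a$k)"

text \<open>The order of the factors is reversed so that the commutator is the Killing bracket and not its
  negative.\<close>

definition wprod :: "real^4 \<Rightarrow> real^4 \<Rightarrow> real^4 \<Rightarrow> real^4" where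
  "wprod w a b = (1/2) *\<^sub>R qmult (qmult b (qcnj w)) a"

definition wbracket :: "real^4 \<Rightarrow> real^4 \<Rightarrow> real^4 \<Rightarrow> real^4" where
  "wbracket w a b = wprod w a b - wprod w b a"

lemma wprod_assoc: "wprod w a (wprod w b c) = wprod w (wprod w a b) c"
  by (simp add: wprod_def bilinear_lmul[OF bilinear_qmult] bilinear_rmul[OF bilinear_qmult] qmult_assoc)

lemma bilinear_wprod: "bilinear (wprod w)"
  using bilinear_qmult by (auto simp: bilinear_def linear_iff wprod_def algebra_simps)

lemma bilinear_wbracket: "bilinear (wbracket w)"
  using bilinear_wprod[of w] by (auto simp: bilinear_def linear_iff wbracket_def algebra_simps)

lemma wbracket_nth:
  "wbracket w a b $ 1 = w$4 * (a$2 * b$3 - a$3 * b$2) - w$3 * (a$2 * b$4 - a$4 * b$2) + w$2 * (a$3 * b$4 - a$4 * b$3)"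
  "wbracket w a b $ 2 = - w$4 * (a$1 * b$3 - a$3 * b$1) + w$3 * (a$1 * b$4 - a$4 * b$1) - w$1 * (a$3 * b$4 - a$4 * b$3)"
  "wbracket w a b $ 3 = w$4 * (a$1 * b$2 - a$2 * b$1) - w$2 * (a$1 * b$4 - a$4 * b$1) + w$1 * (a$2 * b$4 - a$4 * b$2)"
  "wbracket w a b $ 4 = - w$3 * (a$1 * b$2 - a$2 * b$1) + w$2 * (a$1 * b$3 - a$3 * b$1) - w$1 * (a$2 * b$3 - a$3 * b$2)"
  by (simp_all add: wbracket_def wprod_def qmult_nth qcnj_def field_simps)

lemma wbracket_anti: "wbracket w a b = - wbracket w b a"
  by (simp add: wbracket_def)

lemma wbracket_skew: "wbracket w a b \<bullet> c = - (wbracket w a c \<bullet> b)"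
  by (simp add: inner_vec_def sum_4 wbracket_nth algebra_simps)

lemma wbracket_orthogonal: "w \<bullet> wbracket w a b = 0"
  by (simp add: inner_vec_def sum_4 wbracket_nth algebra_simps)

text \<open>A bracket of two basis vectors is orthogonal to both of them. If \<open>i \<noteq> j\<close> and \<open>k \<noteq> h\<close>, every basis
  vector occurs in one of the two brackets, so that each term of the inner product vanishes.\<close>

lemma wbracket_disjoint_axes:
  fixes i j k h :: 4
  assumes "i \<noteq> k" "i \<noteq> h" "j \<noteq> k" "j \<noteq> h"
  shows "wbracket w (axis i 1) (axis j 1) \<bullet> wbracket w (axis k 1) (axis h 1) = 0"
proof (cases "i = j \<or> k = h")
  case True
  have "wbracket w a a = 0" for a by (simp add: wbracket_def)
  then show ?thesis using True by auto
next
  case False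
  have orth: "wbracket w a b \<bullet> b = 0" "wbracket w a b \<bullet> a = 0" for a b
    using wbracket_skew[of w a b b] wbracket_skew[of w a b a] by (simp_all add: wbracket_def)
  have zero: "wbracket w (axis m 1) b $ m = 0" "wbracket w b (axis m 1) $ m = 0" for m b
    using orth(2)[of "axis m 1" b] orth(1)[of b "axis m 1"] by (simp_all add: inner_axis)
  have "card {i, j, k, h} = CARD(4)" using False assms by simp
  then have "{i, j, k, h} = UNIV" by (intro card_subset_eq) auto
  then have cover: "m = i \<or> m = j \<or> m = k \<or> m = h" for m by blast
  have "wbracket w (axis i 1) (axis j 1) $ m * wbracket w (axis k 1) (axis h 1) $ m = 0" for m
    using cover[of m] by (elim disjE) (simp_all add: zero)
  then show ?thesis unfolding inner_vec_def inner_real_def by (intro sum.neutral ballI)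
qed

lemma wbracket_jacobi:
  "wbracket w a (wbracket w b c) - wbracket w b (wbracket w a c) = wbracket w (wbracket w a b) c"
  by (simp add: wbracket_def bilinear_lsub[OF bilinear_wprod] bilinear_rsub[OF bilinear_wprod] wprod_assoc)

text \<open>Left multiplication by \<open>a\<close> in this product is right multiplication by the quaternion
  \<open>w' a / 2\<close>, with \<open>w'\<close> the conjugate of \<open>w\<close>; it is skew up to the real part of that quaternion,
  which is \<open>w \<bullet> a / 2\<close>.\<close>

lemma wprod_conformal: "wprod w a b \<bullet> c + b \<bullet> wprod w a c = (w \<bullet> a) * (b \<bullet> c)"
  by (simp add: wprod_def inner_vec_def sum_4 qmult_nth qcnj_def field_simps)

section \<open>The Lie group with Killing metric\<close>

text \<open>The vector \<open>w\<close> with \<open>g([x\<^sub>i,x\<^sub>j],x\<^sub>k) = \<Sum>l. \<epsilon>\<^sub>i\<^sub>j\<^sub>k\<^sub>l w\<^sub>l\<close>, where \<open>\<epsilon>\<^sub>i\<^sub>j\<^sub>k\<^sub>l\<close> is the sign of the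
  permutation. In dimension \<open>4\<close> every alternating \<open>3\<close>-form arises in this way.\<close>

definition killing_vector :: "real \<Rightarrow> real \<Rightarrow> real \<Rightarrow> real \<Rightarrow> real^4" where
  "killing_vector l1 l2 l3 l4 = (\<chi> k. if k = 1 then - l3 else if k = 2 then l4 else if k = 3 then - l2 else l1)"

lemma killing_vector_nth:
  "killing_vector l1 l2 l3 l4 $ 1 = - l3" "killing_vector l1 l2 l3 l4 $ 2 = l4"
  "killing_vector l1 l2 l3 l4 $ 3 = - l2" "killing_vector l1 l2 l3 l4 $ 4 = l1"
  by (simp_all add: killing_vector_def)

lemma wbracket_axes:
  fixes l1 l2 l3 l4 :: real
  defines "killing_bracket \<equiv> wbracket (killing_vector l1 l2 l3 l4)"
  shows
  "killing_bracket (axis 1 1) (axis 2 1) = l1 *\<^sub>R axis 3 1 + l2 *\<^sub>R axis 4 1"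
  "killing_bracket (axis 2 1) (axis 1 1) = (- l1) *\<^sub>R axis 3 1 + (- l2) *\<^sub>R axis 4 1"
  "killing_bracket (axis 1 1) (axis 3 1) = (- l1) *\<^sub>R axis 2 1 + l4 *\<^sub>R axis 4 1"
  "killing_bracket (axis 3 1) (axis 1 1) = l1 *\<^sub>R axis 2 1 + (- l4) *\<^sub>R axis 4 1"
  "killing_bracket (axis 2 1) (axis 3 1) = l1 *\<^sub>R axis 1 1 + l3 *\<^sub>R axis 4 1"
  "killing_bracket (axis 3 1) (axis 2 1) = (- l1) *\<^sub>R axis 1 1 + (- l3) *\<^sub>R axis 4 1"
  "killing_bracket (axis 1 1) (axis 4 1) = (- l2) *\<^sub>R axis 2 1 + (- l4) *\<^sub>R axis 3 1"
  "killing_bracket (axis 4 1) (axis 1 1) = l2 *\<^sub>R axis 2 1 + l4 *\<^sub>R axis 3 1"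
  "killing_bracket (axis 2 1) (axis 4 1) = l2 *\<^sub>R axis 1 1 + (- l3) *\<^sub>R axis 3 1"
  "killing_bracket (axis 4 1) (axis 2 1) = (- l2) *\<^sub>R axis 1 1 + l3 *\<^sub>R axis 3 1"
  "killing_bracket (axis 3 1) (axis 4 1) = l4 *\<^sub>R axis 1 1 + l3 *\<^sub>R axis 2 1"
  "killing_bracket (axis 4 1) (axis 3 1) = (- l4) *\<^sub>R axis 1 1 + (- l3) *\<^sub>R axis 2 1"
  by (simp_all add: killing_bracket_def vec_eq_iff forall_4 wbracket_nth killing_vector_nth axis_def)

lemma killing_brackets_frame:
  assumes "killing_brackets A x l1 l2 l3 l4"
  shows "lie_bracket A (x i) (x j) p f
    = (\<Sum>k\<in>UNIV. wbracket (killing_vector l1 l2 l3 l4) (axis i 1) (axis j 1) $ k * x k p f)"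
proof -
  have anti: "lie_bracket A X Y p f = - lie_bracket A Y X p f" for X Y
    by (simp add: lie_bracket_def)
  have self: "lie_bracket A X X p f = 0" for X
    by (simp add: lie_bracket_def)
  note b = assms[unfolded killing_brackets_def vadd_def vscale_def vmult_def]
  have "\<forall>i j. lie_bracket A (x i) (x j) p f
      = (\<Sum>k\<in>UNIV. wbracket (killing_vector l1 l2 l3 l4) (axis i 1) (axis j 1) $ k * x k p f)"
    unfolding forall_4 sum_4
    using b anti[of "x 2" "x 1"] anti[of "x 3" "x 1"] anti[of "x 4" "x 1"] anti[of "x 3" "x 2"]
      anti[of "x 4" "x 2"] anti[of "x 4" "x 3"]
    by (simp add: self wbracket_nth killing_vector_nth axis_def)
  then show ?thesis by blast
qed

text \<open>The first three equations are linear in the squares and make them all equal; the last two then fix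
  the signs, unless all parameters are \<open>0\<close>.\<close>

lemma circulant_invariance_parameters:
  fixes l1 l2 l3 l4 :: real
  assumes "l1\<^sup>2 + l2\<^sup>2 = l1\<^sup>2 + l3\<^sup>2" "l1\<^sup>2 + l3\<^sup>2 = l3\<^sup>2 + l4\<^sup>2" "l1\<^sup>2 + l4\<^sup>2 = l2\<^sup>2 + l3\<^sup>2"
    and "l2 * l4 = l1 * l2" "l1 * l2 = l1 * l3"
  shows "\<exists>\<epsilon>\<in>{1, -1}. l1 = \<epsilon> * l2 \<and> l1 = \<epsilon> * l3 \<and> l1 = l4"
proof (cases "l1 = 0")
  case True
  then show ?thesis using assms by auto
next
  case False
  have "l1\<^sup>2 = l2\<^sup>2" using assms by linarith
  then have "l1 = l2 \<or> l1 = - l2" by (rule power2_eq_iff[THEN iffD1])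
  then show ?thesis using False assms(4,5) by auto
qed


lemma cases_4:
  fixes i :: 4
  obtains "i = 1" | "i = 2" | "i = 3" | "i = 4"
  using exhaust_4[of i] by blast

text \<open>Up to the symmetries of \<open>R\<close>, the listed tuples are all pairs of two-element index sets \<open>{i, j}\<close> and
  \<open>{k, h}\<close> with a common index; the other components of \<open>R\<close> will turn out to vanish.\<close>

lemma curvature_index_cases:
  fixes i j k h :: 4
  shows "i = j \<or> k = h \<or> (i \<noteq> k \<and> i \<noteq> h \<and> j \<noteq> k \<and> j \<noteq> h) \<or>
    (i, j, k, h) \<in> (\<Union>t\<in>{(1,2,1,2), (1,4,1,4), (2,3,2,3), (3,4,3,4), (1,3,1,3), (2,4,2,4),
                                (1,2,1,3), (2,4,3,4), (2,3,2,4), (1,3,1,4),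
                                (1,4,2,4), (3,4,3,1), (1,3,2,3), (2,1,2,4),
                                (1,2,1,4), (3,2,3,4), (1,4,3,4), (2,1,2,3)}.
                              curvature_orbit t)"
  unfolding UN_insert UN_empty curvature_orbit.simps Un_iff insert_iff empty_iff Pair_inject
  by (cases i rule: cases_4; simp; cases j rule: cases_4; simp; cases k rule: cases_4; simp)
    (cases h rule: cases_4; simp)+

theorem proposition3p3:
  fixes G :: "'g::{t2_space, second_countable_topology} monoid"
    and A :: "('g, real^4) atlas"
    and x :: "4 \<Rightarrow> 'g vfield"
    and g :: "'g metric"
    and D :: "'g connection"
    and q :: "'g \<Rightarrow> 'g tvec \<Rightarrow> 'g tvec"
    and l1 l2 l3 l4 :: real
  defines "R \<equiv> \<lambda>i j k h. curvature A g D (x i) (x j) (x k) (x h)"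
  assumes "lie_group G A" and "connected (UNIV :: 'g set)"
    and "global_frame A x" and "\<forall>i. left_invariant_field G (x i)"
    and "killing_brackets A x l1 l2 l3 l4"
    and "riemannian_metric A UNIV g" and "left_invariant_metric G A g"
    and "\<forall>i j p. g p (x i p) (x j p) = (if i = j then 1 else 0)"
    and "levi_civita A UNIV g D"
    and "circulant_structure A x q"
    and "\<forall>X Y Z U p. vector_field A UNIV X \<longrightarrow> vector_field A UNIV Y \<longrightarrow>
           vector_field A UNIV Z \<longrightarrow> vector_field A UNIV U \<longrightarrow>
           curvature A g D (apply_endo q X) (apply_endo q Y) (apply_endo q Z) (apply_endo q U) p
             = curvature A g D X Y Z U p"
  shows "(\<exists>\<epsilon>\<in>{1, -1}. l1 = \<epsilon> * l2 \<and> l1 = \<epsilon> * l3 \<and> l1 = l4) \<and>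
    (\<forall>\<epsilon>\<in>{1, -1}. l1 = \<epsilon> * l2 \<and> l1 = \<epsilon> * l3 \<and> l1 = l4 \<longrightarrow>
      \<comment> \<open>(i)\<close>
      (\<forall>p.
        (\<forall>(i, j, k, h) \<in> {(1,2,1,2), (1,4,1,4), (2,3,2,3), (3,4,3,4), (1,3,1,3), (2,4,2,4)}.
           R i j k h p = - (1/2) * l1\<^sup>2) \<and>
        (\<forall>(i, j, k, h) \<in> {(1,2,1,3), (2,4,3,4), (2,3,2,4), (1,3,1,4),
                          (1,4,2,4), (3,4,3,1), (1,3,2,3), (2,1,2,4)}.
           R i j k h p = - (1/4) * \<epsilon> * l1\<^sup>2) \<and>
        (\<forall>(i, j, k, h) \<in> {(1,2,1,4), (3,2,3,4), (1,4,3,4), (2,1,2,3)}.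
           R i j k h p = (1/4) * l1\<^sup>2) \<and>
        (\<forall>i j k h. R j i k h p = - R i j k h p \<and> R i j h k p = - R i j k h p \<and>
                   R k h i j p = R i j k h p) \<and>
        (\<forall>i j k h. R i j k h p \<noteq> 0 \<longrightarrow>
           (i, j, k, h) \<in> (\<Union>t\<in>{(1,2,1,2), (1,4,1,4), (2,3,2,3), (3,4,3,4), (1,3,1,3), (2,4,2,4),
                                (1,2,1,3), (2,4,3,4), (2,3,2,4), (1,3,1,4),
                                (1,4,2,4), (3,4,3,1), (1,3,2,3), (2,1,2,4),
                                (1,2,1,4), (3,2,3,4), (1,4,3,4), (2,1,2,3)}.
                              curvature_orbit t))) \<and>
      (\<forall>e :: 4 \<Rightarrow> 'g vfield. global_frame A e \<longrightarrow> (\<forall>p.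
        (\<forall>(i, j) \<in> {(1,1), (2,2), (3,3), (4,4)}. ricci A g D e (x i) (x j) p = (3/2) * l1\<^sup>2) \<and>
        (\<forall>(i, j) \<in> {(1,2), (1,4), (2,3), (3,4)}. ricci A g D e (x i) (x j) p = (1/2) * \<epsilon> * l1\<^sup>2) \<and>
        (\<forall>(i, j) \<in> {(1,3), (2,4)}. ricci A g D e (x i) (x j) p = - (1/2) * l1\<^sup>2) \<and>
        (\<forall>i j. ricci A g D e (x j) (x i) p = ricci A g D e (x i) (x j) p))) \<and>
      \<comment> \<open>(ii)\<close>
      (\<forall>e :: 4 \<Rightarrow> 'g vfield. global_frame A e \<longrightarrow>
        (\<forall>p. scalar_curvature A g D e p = 6 * l1\<^sup>2)) \<and>
      \<comment> \<open>(iii)\<close>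
      (\<forall>(i, j) \<in> {(1,2), (1,4), (2,3), (2,4), (1,3)}.
        \<forall>p. sectional_curvature A g D (x i) (x j) p = - (1/2) * l1\<^sup>2) \<and>
      conformally_flat A g)"
proof -
  define w where "w = killing_vector l1 l2 l3 l4"
  interpret bi_invariant_frame A x g "wbracket w" D
  proof unfold_locales
    show "smooth_atlas A" using assms(2) by (simp add: lie_group_def)
    show "global_frame A x" "riemannian_metric A UNIV g" "levi_civita A UNIV g D"
      "g p (x i p) (x j p) = (if i = j then 1 else 0)" for i j p
      using assms by blast+
    show "lie_bracket A (x i) (x j) p f = (\<Sum>k\<in>UNIV. wbracket w (axis i 1) (axis j 1) $ k * x k p f)" for i j p f
      unfolding w_def by (rule killing_brackets_frame[OF assms(6)])
  qed (rule bilinear_wbracket wbracket_anti wbracket_skew wbracket_jacobi)+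
  let ?S = "\<lambda>i j. wbracket w (axis i 1) (axis j 1)"
  have R: "R i j k h p = - (1/4) * (?S i j \<bullet> ?S k h)" for i j k h p
    unfolding R_def by (rule curvature_frame)
  have self: "?S i i = 0" for i
    by (simp add: wbracket_def)
  note eval = wbracket_axes[of l1 l2 l3 l4, folded w_def] self sum_4 inner_add_left inner_add_right
    inner_diff_left inner_diff_right
    inner_axis_axis power2_eq_square

  have shift: "apply_endo q (x 1) = x 2" "apply_endo q (x 2) = x 3" "apply_endo q (x 3) = x 4"
    "apply_endo q (x 4) = x 1"
    using assms(11) by (simp_all add: circulant_structure_def)
  have invariant: "curvature A g D (apply_endo q (x i)) (apply_endo q (x j)) (apply_endo q (x k))
      (apply_endo q (x h)) p = R i j k h p" for i j k h p
    unfolding R_def using assms(12) frame_vector_field by blast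
  \<comment> \<open>These instances of the invariance force the relations between the parameters.\<close>
  have "R 2 3 2 3 p = R 1 2 1 2 p" "R 3 4 3 4 p = R 2 3 2 3 p" "R 2 4 2 4 p = R 1 3 1 3 p"
    "R 2 3 2 4 p = R 1 2 1 3 p" "R 3 4 3 1 p = R 2 3 2 4 p" for p
    using invariant[of 1 2 1 2 p] invariant[of 2 3 2 3 p] invariant[of 1 3 1 3 p]
      invariant[of 1 2 1 3 p] invariant[of 2 3 2 4 p]
    unfolding shift by (simp_all add: R_def)
  then have parameters: "\<exists>\<epsilon>\<in>{1, -1}. l1 = \<epsilon> * l2 \<and> l1 = \<epsilon> * l3 \<and> l1 = l4"
    unfolding R by (intro circulant_invariance_parameters) (auto simp: eval algebra_simps)

  have skew12: "R j i k h p = - R i j k h p" and skew34: "R i j h k p = - R i j k h p"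
    and pair_sym: "R k h i j p = R i j k h p" for i j k h p
    unfolding R using wbracket_anti[of w "axis j 1" "axis i 1"] wbracket_anti[of w "axis h 1" "axis k 1"]
    by (simp_all add: inner_commute)
  have support: "(i, j, k, h) \<in> (\<Union>t\<in>{(1,2,1,2), (1,4,1,4), (2,3,2,3), (3,4,3,4), (1,3,1,3), (2,4,2,4),
                                (1,2,1,3), (2,4,3,4), (2,3,2,4), (1,3,1,4),
                                (1,4,2,4), (3,4,3,1), (1,3,2,3), (2,1,2,4),
                                (1,2,1,4), (3,2,3,4), (1,4,3,4), (2,1,2,3)}.
                              curvature_orbit t)" if "R i j k h p \<noteq> 0" for i j k h p
  proof -
    have "i \<noteq> j" "k \<noteq> h" using that by (auto simp: R self)
    moreover have "\<not> (i \<noteq> k \<and> i \<noteq> h \<and> j \<noteq> k \<and> j \<noteq> h)"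
      using that wbracket_disjoint_axes[of i k h j w] by (auto simp: R)
    ultimately show ?thesis using curvature_index_cases[of i j k h] by blast
  qed
  have conf: "conformally_flat A g"
  proof (rule conformally_flatI[OF bilinear_wprod[of w], of "(1/2) *\<^sub>R w"])
    show "((1/2) *\<^sub>R w) \<bullet> wbracket w a b = 0" for a b by (simp add: wbracket_orthogonal)
    show "wprod w a b \<bullet> c + b \<bullet> wprod w a c = 2 * (((1/2) *\<^sub>R w) \<bullet> a) * (b \<bullet> c)" for a b c
      by (simp add: wprod_conformal)
  qed (simp_all only: wbracket_def wprod_assoc)

  show ?thesis
  proof (rule conjI[OF parameters], rule ballI, rule impI)
    fix \<epsilon> :: real
    assume \<epsilon>: "\<epsilon> \<in> {1, -1}" "l1 = \<epsilon> * l2 \<and> l1 = \<epsilon> * l3 \<and> l1 = l4"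
    then have sign: "\<epsilon> = 1 \<and> l2 = l1 \<and> l3 = l1 \<and> l4 = l1 \<or> \<epsilon> = - 1 \<and> l2 = - l1 \<and> l3 = - l1 \<and> l4 = l1"
      by auto
    have R_half: "\<forall>(i, j, k, h) \<in> {(1,2,1,2), (1,4,1,4), (2,3,2,3), (3,4,3,4), (1,3,1,3), (2,4,2,4)}.
        R i j k h p = - (1/2) * l1\<^sup>2" for p
      using sign unfolding R by (elim disjE) (simp_all add: eval)
    have R_eps: "\<forall>(i, j, k, h) \<in> {(1,2,1,3), (2,4,3,4), (2,3,2,4), (1,3,1,4),
                          (1,4,2,4), (3,4,3,1), (1,3,2,3), (2,1,2,4)}.
        R i j k h p = - (1/4) * \<epsilon> * l1\<^sup>2" for p
      using sign unfolding R by (elim disjE) (simp_all add: eval)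
    have R_quarter: "\<forall>(i, j, k, h) \<in> {(1,2,1,4), (3,2,3,4), (1,4,3,4), (2,1,2,3)}.
        R i j k h p = (1/4) * l1\<^sup>2" for p
      using sign unfolding R by (elim disjE) (simp_all add: eval)
    have sectional: "\<forall>(i, j) \<in> {(1,2), (1,4), (2,3), (2,4), (1,3)}.
        \<forall>p. sectional_curvature A g D (x i) (x j) p = - (1/2) * l1\<^sup>2"
      using R_half by (auto simp: sectional_curvature_frame R_def)
    have ric_diag: "\<forall>(i, j) \<in> {(1,1), (2,2), (3,3), (4,4)}. ricci A g D e (x i) (x j) p = (3/2) * l1\<^sup>2"
      and ric_eps: "\<forall>(i, j) \<in> {(1,2), (1,4), (2,3), (3,4)}. ricci A g D e (x i) (x j) p = (1/2) * \<epsilon> * l1\<^sup>2"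
      and ric_half: "\<forall>(i, j) \<in> {(1,3), (2,4)}. ricci A g D e (x i) (x j) p = - (1/2) * l1\<^sup>2"
      and ric_sym: "ricci A g D e (x l) (x k) p = ricci A g D e (x k) (x l) p"
      and scal: "scalar_curvature A g D e p = 6 * l1\<^sup>2"
      if e: "global_frame A e" for e :: "4 \<Rightarrow> 'g vfield" and k l p
    proof -
      show "\<forall>(i, j) \<in> {(1,1), (2,2), (3,3), (4,4)}. ricci A g D e (x i) (x j) p = (3/2) * l1\<^sup>2"
        using sign unfolding ricci_frame[OF e] by (elim disjE) (simp_all add: eval)
      show "\<forall>(i, j) \<in> {(1,2), (1,4), (2,3), (3,4)}. ricci A g D e (x i) (x j) p = (1/2) * \<epsilon> * l1\<^sup>2"
        using sign unfolding ricci_frame[OF e] by (elim disjE) (simp_all add: eval)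
      show "\<forall>(i, j) \<in> {(1,3), (2,4)}. ricci A g D e (x i) (x j) p = - (1/2) * l1\<^sup>2"
        using sign unfolding ricci_frame[OF e] by (elim disjE) (simp_all add: eval)
      show "ricci A g D e (x l) (x k) p = ricci A g D e (x k) (x l) p"
        unfolding ricci_frame[OF e] by (simp only: inner_commute)
      show "scalar_curvature A g D e p = 6 * l1\<^sup>2"
        using sign unfolding scalar_curvature_frame[OF e] by (elim disjE) (simp_all add: eval)
    qed
    show "(\<forall>p.
        (\<forall>(i, j, k, h) \<in> {(1,2,1,2), (1,4,1,4), (2,3,2,3), (3,4,3,4), (1,3,1,3), (2,4,2,4)}.
           R i j k h p = - (1/2) * l1\<^sup>2) \<and>
        (\<forall>(i, j, k, h) \<in> {(1,2,1,3), (2,4,3,4), (2,3,2,4), (1,3,1,4),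
                          (1,4,2,4), (3,4,3,1), (1,3,2,3), (2,1,2,4)}.
           R i j k h p = - (1/4) * \<epsilon> * l1\<^sup>2) \<and>
        (\<forall>(i, j, k, h) \<in> {(1,2,1,4), (3,2,3,4), (1,4,3,4), (2,1,2,3)}.
           R i j k h p = (1/4) * l1\<^sup>2) \<and>
        (\<forall>i j k h. R j i k h p = - R i j k h p \<and> R i j h k p = - R i j k h p \<and>
                   R k h i j p = R i j k h p) \<and>
        (\<forall>i j k h. R i j k h p \<noteq> 0 \<longrightarrow>
           (i, j, k, h) \<in> (\<Union>t\<in>{(1,2,1,2), (1,4,1,4), (2,3,2,3), (3,4,3,4), (1,3,1,3), (2,4,2,4),
                                (1,2,1,3), (2,4,3,4), (2,3,2,4), (1,3,1,4),
                                (1,4,2,4), (3,4,3,1), (1,3,2,3), (2,1,2,4),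
                                (1,2,1,4), (3,2,3,4), (1,4,3,4), (2,1,2,3)}.
                              curvature_orbit t))) \<and>
      (\<forall>e :: 4 \<Rightarrow> 'g vfield. global_frame A e \<longrightarrow> (\<forall>p.
        (\<forall>(i, j) \<in> {(1,1), (2,2), (3,3), (4,4)}. ricci A g D e (x i) (x j) p = (3/2) * l1\<^sup>2) \<and>
        (\<forall>(i, j) \<in> {(1,2), (1,4), (2,3), (3,4)}. ricci A g D e (x i) (x j) p = (1/2) * \<epsilon> * l1\<^sup>2) \<and>
        (\<forall>(i, j) \<in> {(1,3), (2,4)}. ricci A g D e (x i) (x j) p = - (1/2) * l1\<^sup>2) \<and>
        (\<forall>i j. ricci A g D e (x j) (x i) p = ricci A g D e (x i) (x j) p))) \<and>
      (\<forall>e :: 4 \<Rightarrow> 'g vfield. global_frame A e \<longrightarrow>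
        (\<forall>p. scalar_curvature A g D e p = 6 * l1\<^sup>2)) \<and>
      (\<forall>(i, j) \<in> {(1,2), (1,4), (2,3), (2,4), (1,3)}.
        \<forall>p. sectional_curvature A g D (x i) (x j) p = - (1/2) * l1\<^sup>2) \<and>
      conformally_flat A g"
      by (intro conjI allI impI R_half R_eps R_quarter skew12 skew34 pair_sym support sectional conf
          ric_diag ric_eps ric_half ric_sym scal)
  qed
qed

end
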